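(* Let $\mathcal{O}\subseteq\mathbb{R}^n$ be open and let $\mathcal{X}$ be an open subset of $\mathbb{R}^{k+1}$ or of $\mathbb{R}\times\mathbb{T}^k$. Let $\alpha\in(0,1)$ with $\alpha>\frac13$, let $G\in C^2(\mathcal{O};\mathbb{M}^{n\times(k+1)})$, and let $U\in B^{\alpha}_{3,\infty}(\mathcal{X};\mathcal{O})$ be a weak solution of $$\operatorname{div}_X\big(G(U(X))\big)=0\quad\text{in }\mathcal{X}.$$ Assume that there are $Q\in C(\mathcal{O};\mathbb{M}^{1\times(k+1)})$ and $\mathcal{B}\in C^1(\mathcal{O};\mathbb{M}^{1\times n})$ such that $$D_UQ_j(U)=\mathcal{B}(U)\,D_UG_j(U)\quad\text{for all }U\in\mathcal{O},\ j\in\{0,\dots,k\},$$ and that all of the following conditions hold: (i) $\mathcal{O}$ is convex; (ii) $\mathcal{B}\in W^{1,\infty}(\mathcal{O};\mathbb{M}^{1\times n})$; (iii) there is a constant $C$ with $|Q(V)|\le C(1+|V|^3)$ for all $V\in\mathcal{O}$; (iv) $\sup_{i,j\in\{1,\dots,n\}}\ \sup_{V\in\mathcal{O}}|\partial_{U_i}\partial_{U_j}G(V)|<+\infty$. Then $U$ is a weak solution of the companion law $\operatorname{div}_X\big(Q(U(X))\big)=0$ in $\mathcal{X}$.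
   Context: $\mathbb{T}^k$ is the flat torus of dimension $k$; $\mathbb{M}^{a\times b}$ is the space of real $a\times b$ matrices. Coordinates on $\mathcal{X}$ are $X=(x_0,\dots,x_k)^T$. The columns of a matrix field $M$ with $k+1$ columns are $M_0,\dots,M_k$, and $\operatorname{div}_XM(X)=\sum_{j=0}^k\partial_{x_j}M_j(X)$. $D_X=(\partial_{x_0},\dots,\partial_{x_k})$, and $D_U$ is the differential with respect to $U\in\mathcal{O}$; thus $D_UG_j(U)$ is an $n\times n$ matrix and $D_UQ_j(U)$ is a $1\times n$ row. Weak solution: a function $U:\mathcal{X}\to\mathcal{O}$ is a weak solution of $\operatorname{div}_X(G(U(X)))=0$ if $G(U)$ is locally integrable in $\mathcal{X}$ and $\int_{\mathcal{X}}G(U(X)):D_X\psi(X)\,dX=0$ for all smooth $\psi:\mathcal{X}\to\mathbb{R}^n$ with compact support in $\mathcal{X}$, where $A:B=\sum_{i,j}A_{ij}B_{ij}$. Weak solutions of $\operatorname{div}_X(Q(U(X)))=0$ are defined in the same way with $Q$ in place of $G$ and scalar test functions $\psi:\mathcal{X}\to\mathbb{R}$. Besov space: for $\alpha\in(0,1)$ and $q\in[1,\infty)$, $B^\alpha_{q,\infty}(\mathcal{X})$ is the set of $U\in L^q(\mathcal{X})$ with $\sup_{\xi\ne0}|\xi|^{-\alpha}\|U(\cdot)-U(\cdot-\xi)\|_{L^q(\mathcal{X}\cap(\mathcal{X}+\xi))}<\infty$, where $\xi$ ranges over $\mathbb{R}^{k+1}$ (acting by translation modulo periods in torus directions). $B^\alpha_{q,\infty}(\mathcal{X};\mathcal{O})$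 denotes $\mathcal{O}$-valued functions whose components all lie in $B^\alpha_{q,\infty}(\mathcal{X})$. *)

theory Defs
  imports "HOL-Analysis.Analysis"
begin

(* The coordinates x_0, ..., x_k are indexed by a finite type with k + 1 elements.
   R^{k+1} and R x T^k are treated together: points of R x T^k are represented in the
   universal cover R^{k+1}, and "per j" is the period of the j-th coordinate, where
   per j = 0 means that this coordinate is not periodic.  A subset of R x T^k is then a
   subset of R^{k+1} invariant under the period lattice, a function on it is a periodic
   function, and integrals are taken over one fundamental cell.  If per = (%j. 0), then
   the lattice is {0}, the cell is everything, and all notions are those of R^{k+1}. *)

definition period_lattice :: "('m::finite \<Rightarrow> real) \<Rightarrow> (real^'m) set" where
  "period_lattice per = {z. \<forall>j. \<exists>i::int. z $ j = of_int i * per j}"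

definition period_cell :: "('m::finite \<Rightarrow> real) \<Rightarrow> (real^'m) set" where
  "period_cell per = {x. \<forall>j. per j \<noteq> 0 \<longrightarrow> 0 \<le> x $ j \<and> x $ j < per j}"

definition euclidean_periods :: "('m::finite \<Rightarrow> real) \<Rightarrow> bool" where
  "euclidean_periods per \<longleftrightarrow> (\<forall>j. per j = 0)"

(* R x T^k, where t is the index of the coordinate x_0. *)
definition cylinder_periods :: "'m::finite \<Rightarrow> ('m \<Rightarrow> real) \<Rightarrow> bool" where
  "cylinder_periods t per \<longleftrightarrow> per t = 0 \<and> (\<forall>j. j \<noteq> t \<longrightarrow> per j > 0)"

definition open_domain :: "('m::finite \<Rightarrow> real) \<Rightarrow> (real^'m) set \<Rightarrow> bool" where
  "open_domain per \<X> \<longleftrightarrow> open \<X> \<and> (\<forall>x\<in>\<X>. \<forall>z\<in>period_lattice per. x + z \<in> \<X>)"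

definition maps_on :: "('m::finite \<Rightarrow> real) \<Rightarrow> (real^'m) set \<Rightarrow> 'b set \<Rightarrow> (real^'m \<Rightarrow> 'b) set" where
  "maps_on per \<X> S =
     {f. \<forall>x\<in>\<X>. f x \<in> S \<and> (\<forall>z\<in>period_lattice per. f (x + z) = f x)}"

definition partial_deriv ::
  "'a \<Rightarrow> ('a::euclidean_space \<Rightarrow> 'b::real_normed_vector) \<Rightarrow> 'a \<Rightarrow> 'b" where
  "partial_deriv i f x = frechet_derivative f (at x) i"

(* f is of class C^m on S; meant for open S. *)
primrec C_on ::
  "nat \<Rightarrow> ('a::euclidean_space \<Rightarrow> 'b::real_normed_vector) \<Rightarrow> 'a set \<Rightarrow> bool" where
  "C_on 0 f S = continuous_on S f"
| "C_on (Suc m) f S =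
     ((\<forall>x\<in>S. f differentiable (at x)) \<and> (\<forall>i\<in>Basis. C_on m (partial_deriv i f) S))"

definition smooth_on :: "('a::euclidean_space \<Rightarrow> 'b::real_normed_vector) \<Rightarrow> 'a set \<Rightarrow> bool" where
  "smooth_on f S \<longleftrightarrow> (\<forall>m. C_on m f S)"

(* Smooth functions on the domain whose support is compact in it.  In the periodic case
   the compact subsets of the quotient are the images of the compact subsets of the cover. *)
definition test_functions ::
  "('m::finite \<Rightarrow> real) \<Rightarrow> (real^'m) set \<Rightarrow> (real^'m \<Rightarrow> 'b::real_normed_vector) set" where
  "test_functions per \<X> =
     {\<psi>. \<psi> \<in> maps_on per \<X> UNIV \<and> smooth_on \<psi> \<X> \<and>
         (\<exists>K. compact K \<and> K \<subseteq> \<X> \<and>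
              (\<forall>x\<in>\<X>. \<psi> x \<noteq> 0 \<longrightarrow> (\<exists>y\<in>K. \<exists>z\<in>period_lattice per. x = y + z)))}"

definition locally_integrable_on ::
  "('a::euclidean_space \<Rightarrow> 'b::euclidean_space) \<Rightarrow> 'a set \<Rightarrow> bool" where
  "locally_integrable_on f S \<longleftrightarrow> (\<forall>K. compact K \<and> K \<subseteq> S \<longrightarrow> set_integrable lebesgue K f)"

(* The inner product of matrices in real^'m^'r is A : B; for 'r = 1 this covers the
   scalar law of Q, with scalars as 1-by-1 matrices. *)
definition weak_solution ::
  "('m::finite \<Rightarrow> real) \<Rightarrow> (real^'m) set \<Rightarrow> (real^'n::finite) set \<Rightarrow>
   (real^'n \<Rightarrow> real^'m^'r::finite) \<Rightarrow> (real^'m \<Rightarrow> real^'n) \<Rightarrow> bool" where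
  "weak_solution per \<X> \<O> G U \<longleftrightarrow>
     U \<in> maps_on per \<X> \<O> \<and>
     locally_integrable_on (\<lambda>x. G (U x)) \<X> \<and>
     (\<forall>\<psi> \<in> (test_functions per \<X> :: (real^'m \<Rightarrow> real^'r) set).
        (LINT x : \<X> \<inter> period_cell per | lebesgue. G (U x) \<bullet> jacobian \<psi> (at x)) = 0)"

definition Lq_norm :: "real \<Rightarrow> 'a::euclidean_space set \<Rightarrow> ('a \<Rightarrow> real) \<Rightarrow> real" where
  "Lq_norm q S f = (LINT x : S | lebesgue. \<bar>f x\<bar> powr q) powr (1 / q)"

definition Lq_space :: "real \<Rightarrow> 'a::euclidean_space set \<Rightarrow> ('a \<Rightarrow> real) set" where
  "Lq_space q S =
     {f. set_borel_measurable lebesgue S f \<and> set_integrable lebesgue S (\<lambda>x. \<bar>f x\<bar> powr q)}"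

definition besov ::
  "real \<Rightarrow> real \<Rightarrow> ('m::finite \<Rightarrow> real) \<Rightarrow> (real^'m) set \<Rightarrow> (real^'m \<Rightarrow> real) set" where
  "besov \<alpha> q per \<X> =
     {u. u \<in> maps_on per \<X> UNIV \<and>
         u \<in> Lq_space q (\<X> \<inter> period_cell per) \<and>
         bdd_above ((\<lambda>\<xi>. norm \<xi> powr (-\<alpha>) *
             Lq_norm q (\<X> \<inter> (\<lambda>x. x + \<xi>) ` \<X> \<inter> period_cell per) (\<lambda>x. u x - u (x - \<xi>))) ` {\<xi>. \<xi> \<noteq> 0})}"

definition besov_maps ::
  "real \<Rightarrow> real \<Rightarrow> ('m::finite \<Rightarrow> real) \<Rightarrow> (real^'m) set \<Rightarrow> (real^'n::finite) set \<Rightarrow>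
   (real^'m \<Rightarrow> real^'n) set" where
  "besov_maps \<alpha> q per \<X> \<O> =
     {U. U \<in> maps_on per \<X> \<O> \<and> (\<forall>i. (\<lambda>x. U x $ i) \<in> besov \<alpha> q per \<X>)}"

definition Linf_space :: "'a::euclidean_space set \<Rightarrow> ('a \<Rightarrow> 'b::euclidean_space) set" where
  "Linf_space S =
     {f. set_borel_measurable lebesgue S f \<and> (\<exists>C. AE x in lebesgue. x \<in> S \<longrightarrow> norm (f x) \<le> C)}"

(* W^{1,\<infinity>}, with distributional partial derivatives. *)
definition W1inf_space :: "(real^'n::finite) set \<Rightarrow> (real^'n \<Rightarrow> 'b::euclidean_space) set" where
  "W1inf_space S =
     {f. f \<in> Linf_space S \<and>
         (\<forall>i. \<exists>g \<in> Linf_space S. \<forall>\<phi> \<in> (test_functions (\<lambda>_. 0) S :: (real^'n \<Rightarrow> real) set).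
            (LINT x : S | lebesgue. partial_deriv (axis i 1) \<phi> x *\<^sub>R f x) =
            - (LINT x : S | lebesgue. \<phi> x *\<^sub>R g x))}"

end

theory Submission
  imports Defs
begin

text \<open>
  The proof is a commutator argument.  Let \<open>V\<close> and \<open>W\<close> be the mollifications of \<open>U\<close> and
  \<open>G(U)\<close> at scale \<open>\<epsilon>\<close>, let \<open>b\<close> and \<open>q\<close> be the single rows of \<open>\<B>\<close> and \<open>Q\<close>, and let
  \<open>E = G(V) - W\<close>.  Because \<open>V\<close> is smooth, the companion relation \<open>Dq = b DG\<close> and the chain
  rule give \<open>div q(V) = b(V) div G(V) = b(V) div E + b(V) div W\<close>.  The last term is orthogonal
  to the test function \<open>\<psi>\<close>: this is the weak law for \<open>G\<close>, tested with the mollification of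
  \<open>\<psi> b(V)\<close> (lemma \<open>mollified_weak_law\<close>).  One integration by parts then turns
  \<open>\<integral> q(V) \<bullet> D\<psi>\<close> into \<open>\<integral> D(\<psi> b(V)) : E\<close>.

  The commutator \<open>E\<close> is quadratic in the increments \<open>U(x - w) - U(x)\<close> with \<open>|w| < \<epsilon>\<close>, since
  the linear term of the Taylor expansion of \<open>G\<close> at \<open>V(x)\<close> averages to zero (\<open>E_le\<close>); here
  convexity puts \<open>V(x)\<close> into the state space.  The derivative of \<open>V\<close> is linear in the
  increments, divided by \<open>\<epsilon>\<close> (\<open>DV_le\<close>).  By a Chebyshev inequality (\<open>weighted_moments\<close>)
  the product of a first and a second moment of the increments is at most their third moment,
  which Besov regularity makes of order \<open>\<epsilon>\<close> to the power \<open>3 \<alpha>\<close>.  Hence the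
  defect has order \<open>3 \<alpha> - 1 > 0\<close>.  Replacing \<open>q(U)\<close> by \<open>q(V)\<close> costs no more than that and
  \<open>sqrt \<epsilon>\<close>, because the increments of \<open>q\<close> grow at most quadratically (\<open>q_increment\<close>).
  The sum of these errors is the content of \<open>defect_bound\<close>.

  Torus directions are treated on the universal cover.  Integrals of periodic functions over
  a cell are translation invariant (\<open>cell_translate\<close>).  From this follow the integration by
  parts (\<open>cell_integral_derivative\<close>) and the rule for moving a convolution from one factor to
  the other (\<open>cell_convol_swap\<close>), so that the flat and the periodic case need no separate
  treatment and no partition of unity.

  Two preparations remain.  Membership of \<open>\<B>\<close> in \<open>W1inf_space \<O>\<close> has to be turned
  into pointwise bounds for \<open>\<B>\<close> and its derivative (\<open>W1inf_partial_deriv_bounded\<close>), and \<open>U\<close>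
  has to be replaced by a Borel function that is periodic and has values in the state
  space everywhere (\<open>periodic_borel_version\<close>), so that Fubini's theorem applies on products
  of Borel spaces.
\<close>

section \<open>Functions of class C^m\<close>

lemma C_on_subset: "C_on m f S \<Longrightarrow> T \<subseteq> S \<Longrightarrow> C_on m f T"
  by (induction m arbitrary: f) (auto intro: continuous_on_subset)

lemma C_on_SucD:
  "C_on (Suc m) f S \<Longrightarrow> i \<in> Basis \<Longrightarrow> C_on m (partial_deriv i f) S"
  by simp

lemma C_on_Suc_imp: "C_on (Suc m) f S \<Longrightarrow> C_on m f S"
proof (induction m arbitrary: f)
  case 0
  then show ?case
    by (simp add: continuous_at_imp_continuous_on differentiable_imp_continuous_within)
qed auto

lemma C_on_le:
  assumes "m \<le> n" shows "C_on n f S \<Longrightarrow> C_on m f S"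
  using assms
proof (induction rule: dec_induct)
  case (step k)
  from step.IH[OF C_on_Suc_imp[OF step.prems]] show ?case .
qed

lemma frechet_derivative_cong_open:
  assumes "open S" "x \<in> S" "\<And>y. y \<in> S \<Longrightarrow> f y = g y"
  shows "frechet_derivative f (at x) = frechet_derivative g (at x)"
    "f differentiable (at x) \<longleftrightarrow> g differentiable (at x)"
proof -
  have *: "(f has_derivative D) (at x) \<longleftrightarrow> (g has_derivative D) (at x)" for D
    using assms has_derivative_transform_within_open[of f D x UNIV S g]
      has_derivative_transform_within_open[of g D x UNIV S f] by auto
  then show "frechet_derivative f (at x) = frechet_derivative g (at x)"
    by (simp add: frechet_derivative_def)
  show "f differentiable (at x) \<longleftrightarrow> g differentiable (at x)"
    using * by (simp add: differentiable_def)
qed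

lemma frechet_derivative_eq_0_outside:
  assumes "closed S" "x \<notin> S" "\<And>y. y \<notin> S \<Longrightarrow> f y = 0"
  shows "frechet_derivative f (at x) = (\<lambda>_. 0)"
  using frechet_derivative_cong_open(1)[of "- S" x f "\<lambda>_. 0"] assms by auto

lemma C_on_cong:
  assumes "open S" "\<And>x. x \<in> S \<Longrightarrow> f x = g x" "C_on m f S"
  shows "C_on m g S"
  using assms(2,3)
proof (induction m arbitrary: f g)
  case 0
  then show ?case by (simp cong: continuous_on_cong)
next
  case (Suc m)
  have "C_on m (partial_deriv i g) S" if "i \<in> Basis" for i
  proof (rule Suc.IH[of "partial_deriv i f"])
    show "partial_deriv i f x = partial_deriv i g x" if "x \<in> S" for x
      unfolding partial_deriv_def
      using frechet_derivative_cong_open(1)[OF \<open>open S\<close> that Suc.prems(1)] by simp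
    show "C_on m (partial_deriv i f) S" using Suc.prems(2) that by simp
  qed
  then show ?case
    using frechet_derivative_cong_open(2)[OF \<open>open S\<close> _ Suc.prems(1)] Suc.prems(2) by simp
qed

text \<open>Being of class \<open>C^m\<close> is a local property; this is how a function that is given by
  different formulas on different open sets is recognised as smooth.\<close>

lemma C_on_Un:
  assumes "C_on m f S" "C_on m f T" "open S" "open T"
  shows "C_on m f (S \<union> T)"
  using assms
  by (induction m arbitrary: f) (auto intro: continuous_on_open_Un)

lemma C_on_const: "C_on m (\<lambda>x::'a::euclidean_space. c) S"
proof (induction m arbitrary: c)
  case (Suc m)
  have "partial_deriv i (\<lambda>x. c) = (\<lambda>x. 0)" for i :: 'a and c :: 'b
    by (simp add: partial_deriv_def fun_eq_iff)
  with Suc show ?case by simp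
qed simp

lemma C_on_add:
  assumes "open S" "C_on m f S" "C_on m g S"
  shows "C_on m (\<lambda>x. f x + g x) S"
  using assms(2,3)
proof (induction m arbitrary: f g)
  case (Suc m)
  have "C_on m (partial_deriv i (\<lambda>x. f x + g x)) S" if i: "i \<in> Basis" for i
  proof (rule C_on_cong[OF \<open>open S\<close>])
    show "C_on m (\<lambda>x. partial_deriv i f x + partial_deriv i g x) S"
      using Suc i by simp
    show "partial_deriv i f x + partial_deriv i g x = partial_deriv i (\<lambda>x. f x + g x) x"
      if "x \<in> S" for x
    proof -
      have "(f has_derivative frechet_derivative f (at x)) (at x)"
        "(g has_derivative frechet_derivative g (at x)) (at x)"
        using Suc.prems that by (auto simp: frechet_derivative_works)
      from has_derivative_add[OF this] show ?thesis
        by (simp add: partial_deriv_def frechet_derivative_at[symmetric])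
    qed
  qed
  with Suc.prems show ?case by simp
qed (simp add: continuous_on_add)

lemma C_on_mult:
  fixes f g :: "'a::euclidean_space \<Rightarrow> real"
  assumes "open S" "C_on m f S" "C_on m g S"
  shows "C_on m (\<lambda>x. f x * g x) S"
  using assms(2,3)
proof (induction m arbitrary: f g)
  case (Suc m)
  have "C_on m (partial_deriv i (\<lambda>x. f x * g x)) S" if i: "i \<in> Basis" for i
  proof (rule C_on_cong[OF \<open>open S\<close>])
    show "C_on m (\<lambda>x. f x * partial_deriv i g x + partial_deriv i f x * g x) S"
    proof (rule C_on_add[OF \<open>open S\<close>])
      show "C_on m (\<lambda>x. f x * partial_deriv i g x) S"
        by (rule Suc.IH[OF C_on_Suc_imp[OF Suc.prems(1)] C_on_SucD[OF Suc.prems(2) i]])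
      show "C_on m (\<lambda>x. partial_deriv i f x * g x) S"
        by (rule Suc.IH[OF C_on_SucD[OF Suc.prems(1) i] C_on_Suc_imp[OF Suc.prems(2)]])
    qed
    show "f x * partial_deriv i g x + partial_deriv i f x * g x = partial_deriv i (\<lambda>x. f x * g x) x"
      if "x \<in> S" for x
    proof -
      have "(f has_derivative frechet_derivative f (at x)) (at x)"
        "(g has_derivative frechet_derivative g (at x)) (at x)"
        using Suc.prems that by (auto simp: frechet_derivative_works)
      from has_derivative_mult[OF this] show ?thesis
        by (simp add: partial_deriv_def frechet_derivative_at[symmetric])
    qed
  qed
  with Suc.prems show ?case by simp
qed (simp add: continuous_on_mult)

lemma bounded_linear_frechet_derivative:
  "f differentiable (at x) \<Longrightarrow> bounded_linear (frechet_derivative f (at x))"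
  unfolding frechet_derivative_works by (rule has_derivative_bounded_linear)

lemma frechet_derivative_eq_sum_partial:
  fixes f :: "'a::euclidean_space \<Rightarrow> 'b::real_normed_vector"
  assumes "f differentiable (at x)"
  shows "frechet_derivative f (at x) h = (\<Sum>i\<in>Basis. (h \<bullet> i) *\<^sub>R partial_deriv i f x)"
proof -
  interpret bounded_linear "frechet_derivative f (at x)"
    using assms by (simp add: bounded_linear_frechet_derivative)
  have "frechet_derivative f (at x) h = frechet_derivative f (at x) (\<Sum>i\<in>Basis. (h \<bullet> i) *\<^sub>R i)"
    by (simp add: euclidean_representation)
  then show ?thesis by (simp add: sum scaleR partial_deriv_def)
qed

lemma norm_frechet_derivative_le_sum:
  fixes f :: "'a::euclidean_space \<Rightarrow> 'b::real_normed_vector" and M :: real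
  assumes "f differentiable (at x)" "\<And>i. i \<in> Basis \<Longrightarrow> norm (partial_deriv i f x) \<le> M"
  shows "norm (frechet_derivative f (at x) h) \<le> DIM('a) * M * norm h"
proof -
  have M: "0 \<le> M" by (rule order_trans[OF norm_ge_zero assms(2)[OF SOME_Basis]])
  have "norm (frechet_derivative f (at x) h) \<le> (\<Sum>i\<in>Basis. norm ((h \<bullet> i) *\<^sub>R partial_deriv i f x))"
    unfolding frechet_derivative_eq_sum_partial[OF assms(1)] by (rule norm_sum)
  also have "\<dots> \<le> (\<Sum>i\<in>(Basis::'a set). norm h * M)"
    using assms(2) M by (intro sum_mono) (auto intro!: mult_mono Basis_le_norm)
  finally show ?thesis by (simp add: mult.commute mult.left_commute)
qed

text \<open>Second-order Taylor estimate.  On a convex set a bound on the second derivatives makes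
  the derivative Lipschitz, and the mean value theorem for \<open>y \<mapsto> f y - f' v y\<close> then
  bounds the remainder by a multiple of the squared distance.\<close>

lemma Taylor2_C_on:
  fixes f :: "'a::euclidean_space \<Rightarrow> 'b::real_normed_vector" and M :: real
  assumes C2: "C_on 2 f S" and "convex S" "open S"
    and M: "\<And>i j x. i \<in> Basis \<Longrightarrow> j \<in> Basis \<Longrightarrow> x \<in> S \<Longrightarrow>
              norm (partial_deriv i (partial_deriv j f) x) \<le> M"
  obtains c where "c \<ge> 0"
    "\<And>v w h. v \<in> S \<Longrightarrow> w \<in> S \<Longrightarrow>
       norm (frechet_derivative f (at w) h - frechet_derivative f (at v) h) \<le> c * norm (w - v) * norm h"
    "\<And>v w. v \<in> S \<Longrightarrow> w \<in> S \<Longrightarrow>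
       norm (f w - f v - frechet_derivative f (at v) (w - v)) \<le> c * (norm (w - v))\<^sup>2"
proof
  define d where "d = real DIM('a)"
  define c where "c = d * (d * \<bar>M\<bar>)"
  show "c \<ge> 0" by (simp add: c_def d_def)
  have df: "f differentiable (at x)" and dpf: "\<And>j. j \<in> Basis \<Longrightarrow> partial_deriv j f differentiable (at x)"
    if "x \<in> S" for x
    using C2 that by (auto simp: numeral_2_eq_2)
  have lip_partial: "norm (partial_deriv j f w - partial_deriv j f v) \<le> d * \<bar>M\<bar> * norm (w - v)"
    if "v \<in> S" "w \<in> S" "j \<in> Basis" for v w j
  proof (rule differentiable_bound[OF \<open>convex S\<close>])
    fix x assume x: "x \<in> S"
    show "(partial_deriv j f has_derivative frechet_derivative (partial_deriv j f) (at x)) (at x within S)"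
      using dpf[OF x \<open>j \<in> Basis\<close>] by (simp add: frechet_derivative_works has_derivative_at_withinI)
    show "onorm (frechet_derivative (partial_deriv j f) (at x)) \<le> d * \<bar>M\<bar>"
      unfolding d_def
      by (rule onorm_le, rule norm_frechet_derivative_le_sum[OF dpf[OF x \<open>j \<in> Basis\<close>]])
        (use M[OF _ \<open>j \<in> Basis\<close> x] in fastforce)
  qed (use that in auto)
  show lip: "norm (frechet_derivative f (at w) h - frechet_derivative f (at v) h) \<le> c * norm (w - v) * norm h"
    if "v \<in> S" "w \<in> S" for v w h
  proof -
    have "norm (frechet_derivative f (at w) h - frechet_derivative f (at v) h)
        = norm (\<Sum>i\<in>Basis. (h \<bullet> i) *\<^sub>R (partial_deriv i f w - partial_deriv i f v))"
      by (simp add: frechet_derivative_eq_sum_partial df that sum_subtractf scaleR_diff_right)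
    also have "\<dots> \<le> (\<Sum>i\<in>(Basis::'a set). norm h * (d * \<bar>M\<bar> * norm (w - v)))"
      by (intro sum_norm_le) (auto intro!: mult_mono lip_partial that Basis_le_norm)
    finally show ?thesis by (simp add: c_def d_def mult_ac)
  qed
  show "norm (f w - f v - frechet_derivative f (at v) (w - v)) \<le> c * (norm (w - v))\<^sup>2"
    if vw: "v \<in> S" "w \<in> S" for v w
  proof -
    let ?L = "frechet_derivative f (at v)"
    have bl: "bounded_linear ?L" using df[OF vw(1)] by (simp add: bounded_linear_frechet_derivative)
    have seg: "closed_segment v w \<subseteq> S"
      using vw \<open>convex S\<close> by (simp add: closed_segment_subset)
    have "norm ((f w - ?L w) - (f v - ?L v)) \<le> (c * norm (w - v)) * norm (w - v)"
    proof (rule differentiable_bound[of "closed_segment v w"])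
      fix x assume x: "x \<in> closed_segment v w"
      then have xS: "x \<in> S" using seg by auto
      show "((\<lambda>y. f y - ?L y) has_derivative (\<lambda>h. frechet_derivative f (at x) h - ?L h))
          (at x within closed_segment v w)"
        using df[OF xS]
        by (intro has_derivative_diff bounded_linear_imp_has_derivative bl)
          (simp add: frechet_derivative_works has_derivative_at_withinI)
      show "onorm (\<lambda>h. frechet_derivative f (at x) h - ?L h) \<le> c * norm (w - v)"
      proof (rule onorm_le)
        fix h
        have "norm (frechet_derivative f (at x) h - ?L h) \<le> c * norm (x - v) * norm h"
          by (rule lip[OF vw(1) xS])
        also have "\<dots> \<le> c * norm (w - v) * norm h"
          using segment_bound(1)[OF x] \<open>c \<ge> 0\<close>
          by (intro mult_right_mono mult_left_mono) auto
        finally show "norm (frechet_derivative f (at x) h - ?L h) \<le> c * norm (w - v) * norm h" .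
      qed
    qed auto
    moreover have "f w - f v - ?L (w - v) = (f w - ?L w) - (f v - ?L v)"
      using bl by (simp add: bounded_linear.linear linear_diff)
    ultimately show ?thesis by (simp only: power2_eq_square mult.assoc)
  qed
qed

section \<open>Smooth mollifiers with quantitative bounds\<close>

text \<open>All bounds for the profile at the origin come from comparing \<open>exp\<close> with one term of its series.\<close>

lemma power_le_fact_exp:
  assumes "0 \<le> (t::real)" shows "t ^ k \<le> fact k * exp t"
proof -
  have "(\<Sum>n\<in>{k}. t ^ n /\<^sub>R fact n) \<le> exp t"
    unfolding exp_def using assms by (intro sum_le_suminf summable_exp_generic) auto
  then show ?thesis by (simp add: field_simps)
qed

text \<open>The standard profile \<open>exp (-1/s)\<close> is the member \<open>n = 0\<close>.  The span of the family is closed under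
  differentiation, so that smoothness of all members is a single induction on the order.\<close>

definition flat_profile :: "nat \<Rightarrow> real \<Rightarrow> real" where
  "flat_profile n s = (if s \<le> 0 then 0 else inverse s ^ n * exp (- inverse s))"

lemma flat_profile_nonneg: "0 \<le> flat_profile n s"
  by (simp add: flat_profile_def)

lemma flat_profile_le_fact: "flat_profile n s \<le> fact n"
proof (cases "s \<le> 0")
  case False
  then have "inverse s ^ n / exp (inverse s) \<le> fact n"
    using power_le_fact_exp[of "inverse s" n] by (simp add: pos_divide_le_eq del: power_inverse)
  with False show ?thesis by (simp add: flat_profile_def exp_minus divide_inverse)
qed (simp add: flat_profile_def)

lemma flat_profile_le_square: "flat_profile n s \<le> fact (n + 2) * s\<^sup>2"
proof (cases "s \<le> 0")
  case False
  then have "flat_profile n s = flat_profile (n + 2) s * s\<^sup>2"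
    by (simp add: flat_profile_def power_add power2_eq_square field_simps)
  also have "\<dots> \<le> fact (n + 2) * s\<^sup>2"
    by (intro mult_right_mono flat_profile_le_fact) auto
  finally show ?thesis .
qed (simp add: flat_profile_def)

lemma flat_profile_has_derivative:
  "(flat_profile n has_real_derivative - real n * flat_profile (n + 1) s + flat_profile (n + 2) s) (at s)"
proof (cases s "0::real" rule: linorder_cases)
  case less
  have "((\<lambda>_. 0) has_real_derivative 0) (at s)" by simp
  then have "(flat_profile n has_real_derivative 0) (at s)"
    by (rule has_field_derivative_transform_within_open[where S = "{..<0}"])
      (use less in \<open>auto simp: flat_profile_def\<close>)
  with less show ?thesis by (simp add: flat_profile_def)
next
  case greater
  have "((\<lambda>s. inverse s ^ n * exp (- inverse s)) has_real_derivative
      - real n * flat_profile (n + 1) s + flat_profile (n + 2) s) (at s)"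
  proof -
    have "((\<lambda>s. inverse s) has_real_derivative - (inverse s ^ 2)) (at s)"
      using greater by (auto intro!: derivative_eq_intros simp: power2_eq_square)
    from DERIV_mult[OF DERIV_power[OF this, of n] DERIV_fun_exp[OF DERIV_minus[OF this]]]
    have "((\<lambda>s. inverse s ^ n * exp (- inverse s)) has_real_derivative
        - (real n * inverse s ^ (n - 1) * inverse s ^ 2) * exp (- inverse s)
          + inverse s ^ n * inverse s ^ 2 * exp (- inverse s)) (at s)"
      by (rule DERIV_cong) (simp add: mult_ac)
    moreover have "real n * inverse s ^ (n - 1) * inverse s ^ 2 = real n * inverse s ^ (n + 1)"
      by (cases n) (auto simp: power2_eq_square)
    ultimately have "((\<lambda>s. inverse s ^ n * exp (- inverse s)) has_real_derivative
        - (real n * inverse s ^ (n + 1)) * exp (- inverse s)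
          + inverse s ^ (n + 2) * exp (- inverse s)) (at s)"
      by (simp only: power_add)
    then show ?thesis
      using greater by (simp only: flat_profile_def not_le[symmetric] if_False mult.assoc mult_minus_left)
  qed
  then show ?thesis
    by (rule has_field_derivative_transform_within_open[where S = "{0<..}"])
      (use greater in \<open>auto simp: flat_profile_def\<close>)
next
  case equal
  have "((\<lambda>h. flat_profile n h / h) \<longlongrightarrow> 0) (at 0)"
  proof (rule Lim_null_comparison)
    show "eventually (\<lambda>h. norm (flat_profile n h / h) \<le> fact (n + 2) * \<bar>h\<bar>) (at 0)"
    proof (rule eventuallyI)
      fix h :: real
      show "norm (flat_profile n h / h) \<le> fact (n + 2) * \<bar>h\<bar>"
      proof (cases "h = 0")
        case False
        have "flat_profile n h \<le> fact (n + 2) * \<bar>h\<bar> * \<bar>h\<bar>"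
          using flat_profile_le_square[of n h] by (simp only: power2_eq_square mult.assoc abs_mult_self_eq)
        then show ?thesis
          using flat_profile_nonneg[of n h] False by (simp only: real_norm_def abs_divide abs_of_nonneg)
            (simp only: pos_divide_le_eq zero_less_abs_iff not_False_eq_True simp_thms)
      qed simp
    qed
    show "((\<lambda>h. fact (n + 2) * \<bar>h\<bar>) \<longlongrightarrow> (0::real)) (at 0)"
      by (auto intro!: tendsto_eq_intros)
  qed
  with equal show ?thesis
    by (simp add: DERIV_def flat_profile_def)
qed

lemma C_on_inner_left: "C_on m (\<lambda>x. a * (x \<bullet> i)) S"
proof (cases m)
  case 0
  then show ?thesis by (auto intro!: continuous_intros)
next
  case (Suc k)
  have hd: "((\<lambda>x. a * (x \<bullet> i)) has_derivative (\<lambda>h. a * (h \<bullet> i))) (at x)" for x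
    by (auto intro!: derivative_eq_intros)
  have "partial_deriv j (\<lambda>x. a * (x \<bullet> i)) = (\<lambda>_. a * (j \<bullet> i))" for j
    by (simp add: partial_deriv_def fun_eq_iff frechet_derivative_at[OF hd, symmetric])
  with hd show ?thesis
    unfolding Suc by (auto simp: C_on_const differentiable_def)
qed

lemma radial_profile_has_derivative:
  "((\<lambda>x::'a::euclidean_space. flat_profile n (1 - a * (x \<bullet> x))) has_derivative
    (\<lambda>h. (- real n * flat_profile (n + 1) (1 - a * (x \<bullet> x)) + flat_profile (n + 2) (1 - a * (x \<bullet> x)))
        * (- 2 * a * (h \<bullet> x)))) (at x)"
proof -
  have "((\<lambda>x. 1 - a * (x \<bullet> x)) has_derivative (\<lambda>h. - 2 * a * (h \<bullet> x))) (at x)"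
    by (auto intro!: derivative_eq_intros simp: inner_commute)
  from has_derivative_compose[OF this flat_profile_has_derivative[of n, unfolded has_field_derivative_def]]
  show ?thesis by (simp add: mult_ac)
qed

text \<open>The derivative of order one is again built from the profiles \<open>n + 1\<close> and \<open>n + 2\<close>, so the
  induction runs over all \<open>n\<close> at once.\<close>

lemma C_on_radial_profile:
  "C_on m (\<lambda>x::'a::euclidean_space. flat_profile n (1 - a * (x \<bullet> x))) UNIV"
proof (induction m arbitrary: n)
  case 0
  show ?case
    using radial_profile_has_derivative
    by (auto intro!: continuous_at_imp_continuous_on has_derivative_continuous)
next
  case (Suc m)
  have "C_on m (partial_deriv i (\<lambda>x::'a. flat_profile n (1 - a * (x \<bullet> x)))) UNIV" if "i \<in> Basis" for i
  proof (rule C_on_cong[OF open_UNIV])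
    show "C_on m (\<lambda>x::'a. (- real n * flat_profile (n + 1) (1 - a * (x \<bullet> x))
        + flat_profile (n + 2) (1 - a * (x \<bullet> x))) * (- 2 * a * (x \<bullet> i))) UNIV"
      by (intro C_on_mult C_on_add C_on_const C_on_inner_left Suc open_UNIV)
  qed (simp add: partial_deriv_def frechet_derivative_at[OF radial_profile_has_derivative, symmetric]
        inner_commute)
  then show ?case
    using radial_profile_has_derivative unfolding C_on.simps differentiable_def by blast
qed

text \<open>The uniform probability density on a ball.  Kernels and their derivatives are all compared with
  it, so that one and the same average of the increments controls every error term.\<close>

definition ball_density :: "real \<Rightarrow> 'a::euclidean_space \<Rightarrow> real" where
  "ball_density \<epsilon> w = indicator (ball 0 \<epsilon>) w / measure lborel (ball (0::'a) \<epsilon>)"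

lemma ball_density_nonneg: "0 \<le> ball_density \<epsilon> w"
  by (simp add: ball_density_def)

lemma ball_density_measurable [measurable]: "ball_density \<epsilon> \<in> borel_measurable borel"
  unfolding ball_density_def[abs_def]
  by (intro borel_measurable_divide borel_measurable_indicator borel_measurable_const) auto

lemma ball_density_eq_0: "\<epsilon> \<le> norm w \<Longrightarrow> ball_density \<epsilon> w = 0"
  by (simp add: ball_density_def)

lemma ball_density_integral:
  assumes "0 < \<epsilon>"
  shows "integrable lborel (ball_density \<epsilon> :: 'a::euclidean_space \<Rightarrow> real)"
    and "(LINT w|lborel. ball_density \<epsilon> (w::'a)) = 1"
proof -
  have fin: "emeasure lborel (ball (0::'a) \<epsilon>) < \<infinity>" by (rule emeasure_bounded_finite[OF bounded_ball])
  then have "integrable lborel (indicator (ball (0::'a) \<epsilon>) :: 'a \<Rightarrow> real)"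
    by (simp add: integrable_indicator_iff)
  then show "integrable lborel (ball_density \<epsilon> :: 'a \<Rightarrow> real)"
    by (simp add: ball_density_def[abs_def])
  have "measure lborel (ball (0::'a) \<epsilon>) > 0" using assms by simp
  then show "(LINT w|lborel. ball_density \<epsilon> (w::'a)) = 1"
    by (simp add: ball_density_def[abs_def])
qed

definition mollifier :: "real \<Rightarrow> real \<Rightarrow> ('a::euclidean_space \<Rightarrow> real) \<Rightarrow> bool" where
  "mollifier c \<epsilon> \<eta> \<longleftrightarrow> (\<forall>m. C_on m \<eta> UNIV) \<and> (\<forall>w. 0 \<le> \<eta> w) \<and> (\<forall>w. \<eta> (- w) = \<eta> w) \<and>
     (\<forall>w. \<epsilon> \<le> norm w \<longrightarrow> \<eta> w = 0) \<and> integrable lborel \<eta> \<and> (LINT w|lborel. \<eta> w) = 1 \<and>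
     (\<forall>w. \<eta> w \<le> c * ball_density \<epsilon> w) \<and>
     (\<forall>w. \<forall>i\<in>Basis. \<bar>partial_deriv i \<eta> w\<bar> \<le> c / \<epsilon> * ball_density \<epsilon> w)"

text \<open>The constant must not depend on \<open>\<epsilon>\<close>.  Bounding the normalising integral from below by its
  part over the half ball gives this without a change of variables.\<close>

lemma exists_mollifier:
  obtains c :: real where "0 < c"
    "\<And>\<epsilon>. 0 < \<epsilon> \<Longrightarrow> \<exists>\<eta>::'a::euclidean_space \<Rightarrow> real. mollifier c \<epsilon> \<eta>"
proof
  \<comment> \<open>\<open>exp (4/3)\<close> and \<open>2 ^ DIM('a)\<close> come from the half ball, on which the profile is at least
    \<open>exp (-4/3)\<close>; the factor 4 is the bound \<open>fact 2\<close> for the second profile times the 2 from \<open>|x|\<^sup>2\<close>.\<close>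
  define c :: real where "c = 4 * exp (4/3) * 2 ^ DIM('a)"
  show "0 < c" by (simp add: c_def)
  fix \<epsilon> :: real assume e: "0 < \<epsilon>"
  define a where "a = 1 / \<epsilon>\<^sup>2"
  define \<phi> where "\<phi> n x = flat_profile n (1 - a * (x \<bullet> x))" for n and x :: 'a
  have smooth: "C_on m (\<phi> n) UNIV" for m n
    unfolding \<phi>_def by (rule C_on_radial_profile)
  have [measurable]: "\<phi> n \<in> borel_measurable borel" for n
    using smooth[of 0 n] by (simp add: borel_measurable_continuous_onI)
  have out: "\<phi> n x = 0" if "\<epsilon> \<le> norm x" for n x
  proof -
    have "\<epsilon>\<^sup>2 \<le> x \<bullet> x" using that e by (simp add: dot_square_norm power_mono)
    then show ?thesis using e by (simp add: \<phi>_def flat_profile_def a_def field_simps)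
  qed
  have \<phi>le: "\<phi> n x \<le> fact n * indicator (ball 0 \<epsilon>) x" for n x
    using out[of x n] flat_profile_le_fact[of n] by (auto simp: \<phi>_def indicator_def not_less)
  have \<phi>nn: "0 \<le> \<phi> n x" for n x by (simp add: \<phi>_def flat_profile_nonneg)
  have int: "integrable lborel (\<phi> 0)"
  proof (rule Bochner_Integration.integrable_bound)
    show "integrable lborel (\<lambda>x. fact 0 * indicator (ball (0::'a) \<epsilon>) x :: real)"
      by (simp add: integrable_indicator_iff emeasure_bounded_finite[OF bounded_ball, simplified])
  qed (use \<phi>le[of 0] \<phi>nn in \<open>auto simp: abs_of_nonneg intro!: AE_I2\<close>)
  define I where "I = (LINT x|lborel. \<phi> 0 x)"
  let ?v = "measure lborel (ball (0::'a) \<epsilon>)"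
  have half: "exp (- 4/3) \<le> \<phi> 0 x" if "x \<in> ball 0 (\<epsilon>/2)" for x
  proof -
    have "(norm x)\<^sup>2 \<le> (\<epsilon>/2)\<^sup>2" using that by (intro power_mono) auto
    then have "a * (x \<bullet> x) \<le> 1/4"
      using e by (simp add: a_def dot_square_norm field_simps power2_eq_square)
    then have s: "3/4 \<le> 1 - a * (x \<bullet> x)" by simp
    then have "inverse (1 - a * (x \<bullet> x)) \<le> inverse (3/4)"
      by (intro le_imp_inverse_le) auto
    with s show ?thesis by (simp add: \<phi>_def flat_profile_def)
  qed
  have "measure lborel (ball (0::'a) (\<epsilon>/2)) * exp (-4/3) \<le> I"
  proof -
    have "(LINT x|lborel. indicator (ball (0::'a) (\<epsilon>/2)) x * exp (-4/3)) \<le> I"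
      unfolding I_def
    proof (rule integral_mono[OF _ int])
      show "integrable lborel (\<lambda>x. indicator (ball (0::'a) (\<epsilon>/2)) x * exp (-4/3) :: real)"
        by (simp add: integrable_indicator_iff emeasure_bounded_finite[OF bounded_ball, simplified])
    qed (use half \<phi>nn in \<open>auto simp: indicator_def\<close>)
    then show ?thesis by simp
  qed
  moreover have "measure lborel (ball (0::'a) (\<epsilon>/2)) = ?v / 2 ^ DIM('a)"
    using e content_ball_conv_unit_ball[of "\<epsilon>/2" "0::'a"] content_ball_conv_unit_ball[of "\<epsilon>" "0::'a"]
    by (simp add: power_divide)
  ultimately have Ilow: "?v / 2 ^ DIM('a) * exp (-4/3) \<le> I" by simp
  have v: "0 < ?v" using e by simp
  have I: "0 < I" using Ilow v by (smt (verit) divide_pos_pos exp_gt_zero mult_pos_pos zero_less_power)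
  have inv: "1 / I \<le> exp (4/3) * 2 ^ DIM('a) / ?v"
  proof -
    have "?v \<le> I * (exp (4/3) * 2 ^ DIM('a))"
      using mult_right_mono[OF Ilow, of "exp (4/3) * 2 ^ DIM('a)"] by (simp add: field_simps exp_minus)
    then show ?thesis using I v by (simp add: field_simps)
  qed
  have deriv: "((\<lambda>x. \<phi> 0 x / I) has_derivative (\<lambda>h. \<phi> 2 x * (- 2 * a * (h \<bullet> x)) / I)) (at x)" for x
    using has_derivative_mult_left[OF radial_profile_has_derivative[of 0 a x], of "1 / I"]
    by (simp add: \<phi>_def numeral_2_eq_2)
  show "\<exists>\<eta>::'a \<Rightarrow> real. mollifier c \<epsilon> \<eta>"
    unfolding mollifier_def
  proof (intro exI[of _ "\<lambda>x. \<phi> 0 x / I"] conjI allI ballI impI)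
    show "C_on m (\<lambda>x. \<phi> 0 x / I) UNIV" for m
      using C_on_mult[OF open_UNIV smooth C_on_const[of m "1 / I"], of 0] by simp
    show "integrable lborel (\<lambda>x. \<phi> 0 x / I)" using int by simp
    show "(LINT w|lborel. \<phi> 0 w / I) = 1" using I by (simp add: I_def)
    show "\<phi> 0 w / I \<le> c * ball_density \<epsilon> w" for w
    proof -
      have "\<phi> 0 w * (1 / I) \<le> indicator (ball 0 \<epsilon>) w * (exp (4/3) * 2 ^ DIM('a) / ?v)"
        using \<phi>le[of 0 w] \<phi>nn inv I by (intro mult_mono) auto
      also have "\<dots> \<le> c * ball_density \<epsilon> w"
        using v by (auto simp: c_def ball_density_def indicator_def field_simps)
      finally show ?thesis by simp
    qed
    show "\<bar>partial_deriv i (\<lambda>x. \<phi> 0 x / I) w\<bar> \<le> c / \<epsilon> * ball_density \<epsilon> w" if "i \<in> Basis" for w i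
    proof -
      have "\<bar>partial_deriv i (\<lambda>x. \<phi> 0 x / I) w\<bar> = \<phi> 2 w * (2 * a * \<bar>i \<bullet> w\<bar>) * (1 / I)"
        using I \<phi>nn[of 2 w] e
        by (simp add: partial_deriv_def frechet_derivative_at[OF deriv, symmetric] abs_mult a_def)
      also have "\<dots> \<le> (2 * indicator (ball 0 \<epsilon>) w) * (2 / \<epsilon>) * (exp (4/3) * 2 ^ DIM('a) / ?v)"
      proof (cases "w \<in> ball 0 \<epsilon>")
        case True
        have "\<bar>i \<bullet> w\<bar> \<le> \<epsilon>" using Basis_le_norm[OF that, of w] True by (simp add: inner_commute)
        then have "2 * a * \<bar>i \<bullet> w\<bar> \<le> 2 / \<epsilon>" using e by (simp add: a_def field_simps power2_eq_square)
        then show ?thesis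
          using \<phi>le[of 2 w] \<phi>nn inv I e v by (intro mult_mono) (auto simp: a_def)
      qed (use out[of w 2] e in \<open>auto simp: not_less\<close>)
      also have "\<dots> = c / \<epsilon> * ball_density \<epsilon> w" by (simp add: c_def ball_density_def)
      finally show ?thesis .
    qed
  qed (use I \<phi>nn out int in \<open>auto simp: \<phi>_def\<close>)
qed

section \<open>Convolution with a smooth kernel\<close>

lemma integrable_dominated:
  fixes f :: "'a \<Rightarrow> 'b::{banach, second_countable_topology}"
    and g :: "'a \<Rightarrow> 'c::{banach, second_countable_topology}"
  assumes "integrable M g" "f \<in> borel_measurable M" "\<And>x. norm (f x) \<le> norm (g x)"
  shows "integrable M f"
  by (rule Bochner_Integration.integrable_bound[OF assms(1,2)]) (use assms(3) in simp)

lemma norm_integral_le: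
  fixes f :: "'a \<Rightarrow> 'b::{banach, second_countable_topology}"
  assumes "integrable M g" "\<And>x. norm (f x) \<le> g x"
  shows "norm (LINT x|M. f x) \<le> (LINT x|M. g x)"
proof (rule order_trans[OF Bochner_Integration.integral_norm_bound])
  show "(LINT x|M. norm (f x)) \<le> (LINT x|M. g x)"
    using assms(2) order_trans[OF norm_ge_zero assms(2)] by (intro integral_mono'[OF assms(1)])
qed

lemma lborel_distr_reflect: "distr lborel borel (\<lambda>w::'a::euclidean_space. x - w) = lborel"
  by (subst (2) lborel_affine[of "- 1" x]) (auto simp: density_1 one_ennreal_def[symmetric])

lemma lborel_reflect:
  fixes f :: "'a::euclidean_space \<Rightarrow> 'b::{banach, second_countable_topology}"
  assumes [measurable]: "f \<in> borel_measurable borel"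
  shows "(LINT w|lborel. f (x - w)) = (LINT y|lborel. f y)"
    and "integrable lborel (\<lambda>w. f (x - w)) \<longleftrightarrow> integrable lborel f"
proof -
  have [measurable]: "(\<lambda>w. x - w) \<in> lborel \<rightarrow>\<^sub>M borel" by simp
  show "(LINT w|lborel. f (x - w)) = (LINT y|lborel. f y)"
    by (subst (2) lborel_distr_reflect[of x, symmetric]) (simp add: integral_distr)
  show "integrable lborel (\<lambda>w. f (x - w)) \<longleftrightarrow> integrable lborel f"
    by (subst (2) lborel_distr_reflect[of x, symmetric]) (simp add: integrable_distr_eq)
qed

lemma nn_integral_lborel_translate:
  fixes f :: "'a::euclidean_space \<Rightarrow> ennreal"
  assumes [measurable]: "f \<in> borel_measurable borel"
  shows "(\<integral>\<^sup>+x. f (x + a) \<partial>lborel) = (\<integral>\<^sup>+x. f x \<partial>lborel)"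
  by (subst (2) lborel_distr_plus[of a, symmetric]) (simp add: nn_integral_distr add.commute)

text \<open>The variable \<open>x\<close> occurs in the kernel only, which makes smoothness in \<open>x\<close> visible.\<close>

definition convol :: "('a::euclidean_space \<Rightarrow> real) \<Rightarrow> ('a \<Rightarrow> 'b::euclidean_space) \<Rightarrow> 'a \<Rightarrow> 'b" where
  "convol \<rho> f x = (LINT y|lborel. \<rho> (x - y) *\<^sub>R f y)"

definition bump_within :: "real \<Rightarrow> ('a::euclidean_space \<Rightarrow> real) \<Rightarrow> bool" where
  "bump_within r \<rho> \<longleftrightarrow> (\<forall>m. C_on m \<rho> UNIV) \<and> (\<forall>w. r < norm w \<longrightarrow> \<rho> w = 0)"

text \<open>Integrability on balls of one fixed radius is what a periodic function inherits from
  integrability over a cell, and it suffices for kernels supported in smaller balls.\<close>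

definition ball_integrable :: "real \<Rightarrow> ('a::euclidean_space \<Rightarrow> 'b::euclidean_space) \<Rightarrow> bool" where
  "ball_integrable r f \<longleftrightarrow> f \<in> borel_measurable borel \<and> (\<forall>x. set_integrable lborel (ball x r) f)"

lemma bump_within_partial:
  assumes "bump_within r \<rho>" "i \<in> Basis"
  shows "bump_within r (partial_deriv i \<rho>)"
  unfolding bump_within_def
proof (intro conjI allI impI)
  show "C_on m (partial_deriv i \<rho>) UNIV" for m
    using assms by (intro C_on_SucD) (auto simp: bump_within_def)
  fix w :: 'a assume w: "r < norm w"
  have "frechet_derivative \<rho> (at w) = (\<lambda>_. 0)"
    by (rule frechet_derivative_eq_0_outside[of "cball 0 r"]) (use w assms(1) in \<open>auto simp: bump_within_def\<close>)
  then show "partial_deriv i \<rho> w = 0" by (simp add: partial_deriv_def)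
qed

lemma bump_within_bounded:
  assumes "bump_within r (\<rho> :: 'a::euclidean_space \<Rightarrow> real)"
  obtains M where "0 \<le> M" "\<And>w. \<bar>\<rho> w\<bar> \<le> M"
proof -
  have "continuous_on UNIV \<rho>" using assms by (metis C_on.simps(1) bump_within_def)
  then have "compact (\<rho> ` cball 0 r)"
    by (intro compact_continuous_image compact_cball) (auto intro: continuous_on_subset)
  then obtain B where B: "\<And>w. w \<in> cball 0 r \<Longrightarrow> \<bar>\<rho> w\<bar> \<le> B"
    by (metis compact_imp_bounded bounded_iff imageI real_norm_def)
  have "\<bar>\<rho> w\<bar> \<le> max B 0" for w
    using B[of w] assms by (cases "norm w \<le> r") (auto simp: bump_within_def)
  then show thesis by (intro that[of "max B 0"]) auto
qed

lemma bump_within_measurable: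
  "bump_within r (\<rho> :: 'a::euclidean_space \<Rightarrow> real) \<Longrightarrow> \<rho> \<in> borel_measurable borel"
  by (rule borel_measurable_continuous_onI) (metis C_on.simps(1) bump_within_def)

lemma convol_integrable:
  fixes f :: "'a::euclidean_space \<Rightarrow> 'b::euclidean_space"
  assumes \<rho>: "bump_within r \<rho>"
    and f: "set_integrable lborel S f" "f \<in> borel_measurable borel" "cball x r \<subseteq> S"
  shows "integrable lborel (\<lambda>y. \<rho> (x - y) *\<^sub>R f y)"
proof -
  note [measurable] = bump_within_measurable[OF \<rho>] f(2)
  obtain M where M: "0 \<le> M" "\<And>w. \<bar>\<rho> w\<bar> \<le> M" using bump_within_bounded[OF \<rho>] by blast
  show ?thesis
  proof (rule integrable_dominated)
    show "integrable lborel (\<lambda>y. M *\<^sub>R (indicator S y *\<^sub>R f y))"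
      using f(1) unfolding set_integrable_def by (rule integrable_scaleR_right)
    show "norm (\<rho> (x - y) *\<^sub>R f y) \<le> norm (M *\<^sub>R (indicator S y *\<^sub>R f y))" for y
    proof (cases "y \<in> S")
      case True
      then show ?thesis using M by (auto intro!: mult_right_mono)
    next
      case False
      then have "y \<notin> cball x r" using f(3) by blast
      then have "r < norm (x - y)" by (simp add: dist_norm)
      then show ?thesis using \<rho> by (simp add: bump_within_def)
    qed
  qed measurable
qed

text \<open>The integrand of the convolution with the constant one at the origin is the reflected bump.\<close>

lemma integrable_bump: "bump_within r (\<rho> :: 'a::euclidean_space \<Rightarrow> real) \<Longrightarrow> integrable lborel \<rho>"
proof -
  assume \<rho>: "bump_within r \<rho>"
  have "set_integrable lborel (cball (0::'a) r) (\<lambda>_. 1::real)"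
    unfolding set_integrable_def
    using emeasure_bounded_finite[OF bounded_cball, of "0::'a" r] by (simp add: integrable_indicator_iff)
  from convol_integrable[OF \<rho> this, of 0] have "integrable lborel (\<lambda>y. \<rho> (0 - y))" by simp
  then show ?thesis
    using lborel_reflect(2)[OF bump_within_measurable[OF \<rho>], of 0] by simp
qed

lemma cball_subset_double: "0 < r \<Longrightarrow> dist x y < r \<Longrightarrow> cball y r \<subseteq> ball x (2 * r)"
proof
  fix z assume "0 < r" "dist x y < r" "z \<in> cball y r"
  then show "z \<in> ball x (2 * r)" using dist_triangle[of x z y] by auto
qed

lemma convol_integrable_ball:
  assumes "bump_within r \<rho>" "ball_integrable (2 * r) f" "0 < r"
  shows "integrable lborel (\<lambda>y. \<rho> (x - y) *\<^sub>R f y)"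
  using assms cball_subset_double[of r x x]
  by (intro convol_integrable[where S = "ball x (2 * r)" and r = r]) (auto simp: ball_integrable_def)

lemma convol_eq:
  assumes "bump_within r \<rho>" "f \<in> borel_measurable borel"
  shows "convol \<rho> f x = (LINT w|lborel. \<rho> w *\<^sub>R f (x - w))"
proof -
  note [measurable] = bump_within_measurable[OF assms(1)] assms(2)
  show ?thesis
    unfolding convol_def using lborel_reflect(1)[of "\<lambda>y. \<rho> (x - y) *\<^sub>R f y" x] by simp
qed

lemma convol_integrable_reflected:
  assumes "bump_within r \<rho>" "ball_integrable (2 * r) f" "0 < r"
  shows "integrable lborel (\<lambda>w. \<rho> w *\<^sub>R f (x - w))"
proof -
  have [measurable]: "\<rho> \<in> borel_measurable borel" "f \<in> borel_measurable borel"
    using assms bump_within_measurable by (auto simp: ball_integrable_def)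
  show ?thesis
    using convol_integrable_ball[OF assms, of x]
      lborel_reflect(2)[of "\<lambda>y. \<rho> (x - y) *\<^sub>R f y" x] by simp
qed

text \<open>The Taylor estimate for the kernel bounds the difference quotients of a convolution
  directly, so that differentiation under the integral needs no limit theorem.\<close>

lemma has_derivative_convol:
  assumes \<rho>: "bump_within r \<rho>" and f: "ball_integrable (2 * r) f" and r: "0 < r"
  shows "(convol \<rho> f has_derivative (\<lambda>h. \<Sum>i\<in>Basis. (h \<bullet> i) *\<^sub>R convol (partial_deriv i \<rho>) f x)) (at x)"
proof -
  let ?D = "\<lambda>h. \<Sum>i\<in>Basis. (h \<bullet> i) *\<^sub>R convol (partial_deriv i \<rho>) f x"
  have "\<exists>M. \<forall>w. \<bar>partial_deriv i (partial_deriv j \<rho>) w\<bar> \<le> M" if "i \<in> Basis" "j \<in> Basis" for i j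
    using bump_within_bounded[OF bump_within_partial[OF bump_within_partial[OF \<rho> that(2)] that(1)]] by blast
  then obtain M where M: "\<And>i j w. i \<in> Basis \<Longrightarrow> j \<in> Basis \<Longrightarrow>
      \<bar>partial_deriv i (partial_deriv j \<rho>) w\<bar> \<le> M i j" by metis
  define M0 where "M0 = (\<Sum>i\<in>Basis. \<Sum>j\<in>Basis. \<bar>M i j\<bar>)"
  have M0: "norm (partial_deriv i (partial_deriv j \<rho>) w) \<le> M0" if "i \<in> Basis" "j \<in> Basis" for i j w
  proof -
    have "M i j \<le> (\<Sum>j\<in>Basis. \<bar>M i j\<bar>)"
      by (rule order_trans[OF abs_ge_self]) (rule member_le_sum[OF that(2)], auto)
    also have "\<dots> \<le> M0"
      unfolding M0_def by (rule member_le_sum[OF that(1)]) (auto intro: sum_nonneg)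
    finally show ?thesis using M[OF that, of w] by simp
  qed
  obtain c where c: "0 \<le> c" and Taylor: "\<And>v w. norm (\<rho> w - \<rho> v - frechet_derivative \<rho> (at v) (w - v)) \<le> c * (norm (w - v))\<^sup>2"
  proof (rule Taylor2_C_on[OF _ convex_UNIV open_UNIV M0])
    show "C_on 2 \<rho> UNIV" using \<rho> by (simp only: bump_within_def)
  qed (auto intro: that)
  define A where "A = (LINT y|lborel. indicator (ball x (2 * r)) y * norm (f y))"
  have fint: "integrable lborel (\<lambda>y. indicator (ball x (2 * r)) y * norm (f y))"
    using f unfolding ball_integrable_def set_integrable_def
    by (metis (no_types, lifting) ext abs_indicator integrable_norm norm_scaleR)
  show ?thesis
  proof (rule has_derivativeI_sandwich[where H = "\<lambda>y. c * A * norm (y - x)"])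
    show "0 < r" by fact
    show "bounded_linear ?D" by (intro bounded_linear_intros)
    show "((\<lambda>y. c * A * norm (y - x)) \<longlongrightarrow> 0) (at x)"
      by (auto intro!: tendsto_eq_intros)
    fix x' assume "x' \<noteq> x" "dist x' x < r"
    let ?R = "\<lambda>y. \<rho> (x' - y) - \<rho> (x - y) - frechet_derivative \<rho> (at (x - y)) (x' - x)"
    have df: "\<rho> differentiable (at w)" for w
      using \<rho> unfolding bump_within_def by (metis C_on.simps(2) UNIV_I)
    have i1: "integrable lborel (\<lambda>y. \<rho> (x' - y) *\<^sub>R f y)" for x'
      by (rule convol_integrable_ball[OF \<rho> f r])
    have i2: "integrable lborel (\<lambda>y. partial_deriv i \<rho> (x - y) *\<^sub>R f y)" if "i \<in> Basis" for i
      by (rule convol_integrable_ball[OF bump_within_partial[OF \<rho> that] f r])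
    have e: "?R y *\<^sub>R f y = \<rho> (x' - y) *\<^sub>R f y - \<rho> (x - y) *\<^sub>R f y
        - (\<Sum>i\<in>Basis. ((x' - x) \<bullet> i) *\<^sub>R partial_deriv i \<rho> (x - y) *\<^sub>R f y)" for y
      by (simp add: frechet_derivative_eq_sum_partial[OF df] scaleR_diff_left scaleR_sum_left)
    have eq: "convol \<rho> f x' - convol \<rho> f x - ?D (x' - x) = (LINT y|lborel. ?R y *\<^sub>R f y)"
      unfolding e convol_def using i1 i2 by (simp del: scaleR_scaleR)
    have bd: "norm (?R y *\<^sub>R f y) \<le> c * (norm (x' - x))\<^sup>2 * (indicator (ball x (2 * r)) y * norm (f y))" for y
    proof (cases "y \<in> ball x (2 * r)")
      case True
      have "norm (?R y) \<le> c * (norm (x' - x))\<^sup>2" using Taylor[of "x' - y" "x - y"] by simp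
      with True show ?thesis by (auto intro: mult_right_mono)
    next
      case False
      have "y \<notin> cball x r" "y \<notin> cball x' r"
        using False cball_subset_double[of r x x] cball_subset_double[of r x x'] r \<open>dist x' x < r\<close>
        by (auto simp: dist_commute)
      then have "r < norm (x - y)" "r < norm (x' - y)" by (auto simp: dist_norm)
      then show ?thesis
        using \<rho> bump_within_partial[OF \<rho>]
        by (simp add: frechet_derivative_eq_sum_partial[OF df] bump_within_def c)
    qed
    have "norm (convol \<rho> f x' - convol \<rho> f x - ?D (x' - x))
        \<le> (LINT y|lborel. c * (norm (x' - x))\<^sup>2 * (indicator (ball x (2 * r)) y * norm (f y)))"
      unfolding eq by (intro norm_integral_le integrable_mult_right fint bd)
    also have "\<dots> = c * (norm (x' - x))\<^sup>2 * A" by (simp add: A_def)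
    finally show "norm (convol \<rho> f x' - convol \<rho> f x - ?D (x' - x)) / norm (x' - x) \<le> c * A * norm (x' - x)"
      using \<open>x' \<noteq> x\<close> by (simp add: divide_le_eq power2_eq_square mult_ac)
  qed
qed

lemma partial_deriv_convol:
  assumes "bump_within r \<rho>" "ball_integrable (2 * r) f" "0 < r" "i \<in> Basis"
  shows "partial_deriv i (convol \<rho> f) x = convol (partial_deriv i \<rho>) f x"
proof -
  have "partial_deriv i (convol \<rho> f) x = (\<Sum>j\<in>Basis. (i \<bullet> j) *\<^sub>R convol (partial_deriv j \<rho>) f x)"
    unfolding partial_deriv_def frechet_derivative_at[OF has_derivative_convol[OF assms(1-3)], symmetric] ..
  also have "\<dots> = (\<Sum>j\<in>Basis. if j = i then convol (partial_deriv j \<rho>) f x else 0)"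
    using assms(4) by (intro sum.cong) (auto simp: inner_Basis)
  finally show ?thesis using assms(4) by simp
qed

lemma C_on_convol:
  assumes "bump_within r \<rho>" "ball_integrable (2 * r) f" "0 < r"
  shows "C_on m (convol \<rho> f) UNIV"
  using assms(1)
proof (induction m arbitrary: \<rho>)
  case 0
  show ?case
    using has_derivative_convol[OF 0 assms(2,3)]
    by (auto intro!: continuous_at_imp_continuous_on has_derivative_continuous)
next
  case (Suc m)
  have "partial_deriv i (convol \<rho> f) = convol (partial_deriv i \<rho>) f" if "i \<in> Basis" for i
    using partial_deriv_convol[OF Suc.prems assms(2,3) that] by auto
  then show ?case
    using Suc.IH[OF bump_within_partial[OF Suc.prems]] has_derivative_convol[OF Suc.prems assms(2,3)]
    by (auto simp: differentiable_def)
qed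

lemma convol_translate:
  assumes "bump_within r \<rho>" "f \<in> borel_measurable borel" "\<And>x. f (x + z) = f x"
  shows "convol \<rho> f (x + z) = convol \<rho> f x"
proof -
  have "f (x + z - w) = f (x - w)" for w using assms(3)[of "x - w"] by (simp add: algebra_simps)
  then show ?thesis by (simp add: convol_eq[OF assms(1,2)])
qed

section \<open>The period lattice and integration over a cell\<close>

definition periodic :: "('m::finite \<Rightarrow> real) \<Rightarrow> (real^'m \<Rightarrow> 'b) \<Rightarrow> bool" where
  "periodic per f \<longleftrightarrow> (\<forall>x. \<forall>z\<in>period_lattice per. f (x + z) = f x)"

text \<open>The representative of \<open>x\<close> in the cell.  In a direction with \<open>per j = 0\<close> the quotient
  \<open>x $ j / per j\<close> is \<open>0\<close>, so the coordinate stays as it is.\<close>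

definition reduce :: "('m::finite \<Rightarrow> real) \<Rightarrow> real^'m \<Rightarrow> real^'m" where
  "reduce per x = (\<chi> j. x $ j - of_int \<lfloor>x $ j / per j\<rfloor> * per j)"

text \<open>A density on the whole space, so that periodic functions need not be restricted to the cell.\<close>

definition cell_measure :: "('m::finite \<Rightarrow> real) \<Rightarrow> (real^'m) measure" where
  "cell_measure per = density lborel (indicator (period_cell per))"

lemma component_measurable [measurable]: "(\<lambda>x::real^'m::finite. x $ j) \<in> borel_measurable borel"
  by (intro borel_measurable_continuous_onI continuous_intros)

lemma period_cell_borel [measurable]: "period_cell (per :: 'm::finite \<Rightarrow> real) \<in> sets borel"
proof -
  have "period_cell per = (\<Inter>j\<in>UNIV. {x. per j \<noteq> 0 \<longrightarrow> 0 \<le> x $ j \<and> x $ j < per j})"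
    by (auto simp: period_cell_def)
  also have "\<dots> \<in> sets borel" by (intro sets.finite_INT) auto
  finally show ?thesis .
qed

lemma sets_cell_measure [measurable_cong, simp]: "sets (cell_measure per) = sets borel"
  by (simp add: cell_measure_def)

lemma sigma_finite_cell_measure: "sigma_finite_measure (cell_measure per)"
  unfolding cell_measure_def
  by (subst sigma_finite_measure.sigma_finite_iff_density_finite[OF sigma_finite_lborel]) (auto simp: indicator_def)

lemma nn_integral_cell_measure:
  "f \<in> borel_measurable borel \<Longrightarrow>
   (\<integral>\<^sup>+x. f x \<partial>cell_measure per) = (\<integral>\<^sup>+x. indicator (period_cell per) x * f x \<partial>lborel)"
  by (simp add: cell_measure_def nn_integral_density)

lemma integrable_cell_measure:
  fixes f :: "real^'m \<Rightarrow> 'b::{banach, second_countable_topology}"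
  assumes "f \<in> borel_measurable borel"
  shows "integrable (cell_measure per) f \<longleftrightarrow> set_integrable lborel (period_cell per) f"
    and "(LINT x|cell_measure per. f x) = (LINT x:period_cell per|lborel. f x)"
proof -
  have e: "cell_measure per = density lborel (\<lambda>x. ennreal (indicator (period_cell per) x))"
    by (simp add: cell_measure_def ennreal_indicator)
  show "integrable (cell_measure per) f \<longleftrightarrow> set_integrable lborel (period_cell per) f"
    "(LINT x|cell_measure per. f x) = (LINT x:period_cell per|lborel. f x)"
    unfolding e using assms
    by (simp_all add: integrable_density integral_density set_integrable_def set_lebesgue_integral_def)
qed

lemma period_lattice_add:
  assumes "z \<in> period_lattice per" "z' \<in> period_lattice per" shows "z + z' \<in> period_lattice per"
  unfolding period_lattice_def
proof (clarify)
  fix j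
  obtain i i' :: int where "z $ j = of_int i * per j" "z' $ j = of_int i' * per j"
    using assms by (auto simp: period_lattice_def) metis
  then have "(z + z') $ j = of_int (i + i') * per j" by (simp add: algebra_simps)
  then show "\<exists>i::int. (z + z') $ j = of_int i * per j" ..
qed

lemma period_lattice_uminus: "z \<in> period_lattice per \<Longrightarrow> - z \<in> period_lattice per"
  unfolding period_lattice_def
  by simp (metis mult_minus_left of_int_minus)

lemma zero_in_period_lattice: "0 \<in> period_lattice per"
  by (auto simp: period_lattice_def intro!: exI[of _ 0])

lemma countable_period_lattice: "countable (period_lattice (per :: 'm::finite \<Rightarrow> real))"
proof (rule countable_subset)
  show "period_lattice per \<subseteq> range (\<lambda>k :: 'm \<Rightarrow> int. \<chi> j. of_int (k j) * per j)"
  proof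
    fix z assume "z \<in> period_lattice per"
    then obtain k where "\<And>j. z $ j = of_int (k j) * per j" by (auto simp: period_lattice_def) metis
    then show "z \<in> range (\<lambda>k :: 'm \<Rightarrow> int. \<chi> j. of_int (k j) * per j)"
      by (auto simp: vec_eq_iff image_iff)
  qed
qed simp

lemma closed_period_lattice: "closed (period_lattice (per :: 'm::finite \<Rightarrow> real))"
proof -
  have "closed {x::real. \<exists>i::int. x = of_int i * p}" for p
  proof (cases "p = 0")
    case False
    have "{x::real. \<exists>i::int. x = of_int i * p} = (\<lambda>x. p * x) ` \<int>"
      by (auto simp: Ints_def mult.commute)
    moreover have "closed ((\<lambda>x::real. p *\<^sub>R x) ` \<int>)" by (intro closed_scaling closed_Ints)
    ultimately show ?thesis by simp
  qed simp
  then have "closed ((\<lambda>x::real^'m. x $ j) -` {x. \<exists>i::int. x = of_int i * per j})" for j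
    by (intro closed_vimage continuous_intros)
  moreover have "period_lattice per = (\<Inter>j. (\<lambda>x. x $ j) -` {x. \<exists>i::int. x = of_int i * per j})"
    by (auto simp: period_lattice_def)
  ultimately show ?thesis by auto
qed

context
  fixes per :: "'m::finite \<Rightarrow> real"
  assumes per: "\<And>j. 0 \<le> per j"
begin

lemma reduce_in_cell: "reduce per x \<in> period_cell per"
proof -
  have "0 \<le> x $ j - of_int \<lfloor>x $ j / per j\<rfloor> * per j \<and> x $ j - of_int \<lfloor>x $ j / per j\<rfloor> * per j < per j"
    if "per j \<noteq> 0" for j
  proof -
    have p: "0 < per j" using per[of j] that by simp
    have "of_int \<lfloor>x $ j / per j\<rfloor> * per j \<le> (x $ j / per j) * per j"
      using p by (intro mult_right_mono) auto
    moreover have "(x $ j / per j) * per j < (of_int \<lfloor>x $ j / per j\<rfloor> + 1) * per j"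
      using p by (intro mult_strict_right_mono) linarith+
    ultimately show ?thesis using p by (simp add: distrib_right)
  qed
  then show ?thesis by (simp add: period_cell_def reduce_def)
qed

lemma reduce_lattice: "reduce per x - x \<in> period_lattice per"
proof -
  have "(reduce per x - x) $ j = of_int (- \<lfloor>x $ j / per j\<rfloor>) * per j" for j
    by (simp add: reduce_def)
  then show ?thesis unfolding period_lattice_def by blast
qed

lemma lattice_cell_unique:
  assumes "z \<in> period_lattice per" "x \<in> period_cell per" "x + z \<in> period_cell per"
  shows "z = 0"
proof -
  have "z $ j = 0" for j
  proof (cases "per j = 0")
    case False
    then have p: "0 < per j" using per[of j] by simp
    obtain i :: int where i: "z $ j = of_int i * per j" using assms(1) by (auto simp: period_lattice_def)
    have "\<bar>of_int i * per j\<bar> < 1 * per j"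
      using assms(2,3) False i by (auto simp: period_cell_def) (smt (verit))+
    then have "\<bar>i\<bar> < 1" using p by (simp add: abs_mult)
    then show ?thesis using i by simp
  next
    case True
    obtain i :: int where "z $ j = of_int i * per j" using assms(1) by (auto simp: period_lattice_def)
    with True show ?thesis by simp
  qed
  then show ?thesis by (simp add: vec_eq_iff)
qed

lemma reduce_eq: 
  assumes "z \<in> period_lattice per" "x + z \<in> period_cell per" 
  shows "reduce per x = x + z"
proof -
  have "reduce per x - x - z \<in> period_lattice per"
    using period_lattice_add[OF reduce_lattice[of x] period_lattice_uminus[OF assms(1)]] by simp
  from lattice_cell_unique[OF this assms(2)] reduce_in_cell[of x]
  show ?thesis by (simp add: diff_eq_eq add.commute)
qed

lemma translate_in_cell_iff:
  assumes "z \<in> period_lattice per"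
  shows "x + z \<in> period_cell per \<longleftrightarrow> z = reduce per x - x"
proof
  assume "x + z \<in> period_cell per"
  from reduce_eq[OF assms this] show "z = reduce per x - x" by simp
next
  assume "z = reduce per x - x"
  then show "x + z \<in> period_cell per" using reduce_in_cell by simp
qed

lemma reduce_cell: "x \<in> period_cell per \<Longrightarrow> reduce per x = x"
  using reduce_eq[of 0 x] by (simp add: zero_in_period_lattice)

lemma periodic_reduce: "periodic per f \<Longrightarrow> f (reduce per x) = f x"
  using reduce_lattice[of x] unfolding periodic_def by (metis add.commute diff_add_cancel)

lemma periodic_comp_reduce: "periodic per (\<lambda>x. f (reduce per x))"
  unfolding periodic_def
proof (intro allI ballI)
  fix x z assume z: "z \<in> period_lattice per"
  have "reduce per (x + z) = x + z + (reduce per x - (x + z))"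
  proof (rule reduce_eq)
    show "reduce per x - (x + z) \<in> period_lattice per"
      using period_lattice_add[OF reduce_lattice[of x] period_lattice_uminus[OF z]]
      by (simp add: algebra_simps)
  qed (simp add: reduce_in_cell)
  then show "f (reduce per (x + z)) = f (reduce per x)" by simp
qed

lemma reduce_measurable [measurable]: "reduce per \<in> borel_measurable borel"
proof (rule borel_measurable_euclidean_space[THEN iffD2], rule ballI)
  fix i :: "real^'m" assume "i \<in> Basis"
  then obtain j where "i = axis j 1" by (auto simp: Basis_vec_def)
  then show "(\<lambda>x. reduce per x \<bullet> i) \<in> borel_measurable borel"
    unfolding \<open>i = axis j 1\<close> inner_axis reduce_def by simp
qed

text \<open>The translates of the cell tile the space.\<close>

lemma nn_sum_lattice_cell:
  "(\<integral>\<^sup>+z. indicator (period_cell per) (x + z) \<partial>count_space (period_lattice per)) = (1::ennreal)"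
  "(\<integral>\<^sup>+z. indicator (period_cell per) (x - z) \<partial>count_space (period_lattice per)) = (1::ennreal)"
proof -
  let ?z = "reduce per x - x"
  have z: "?z \<in> period_lattice per" by (rule reduce_lattice)
  have "(\<integral>\<^sup>+z. indicator (period_cell per) (x + z) \<partial>count_space (period_lattice per))
      = (\<integral>\<^sup>+z. indicator {?z} z \<partial>count_space (period_lattice per))"
  proof (intro nn_integral_cong)
    fix z assume "z \<in> space (count_space (period_lattice per))"
    then show "indicator (period_cell per) (x + z) = (indicator {?z} z :: ennreal)"
      by (simp add: translate_in_cell_iff indicator_def)
  qed
  then show "(\<integral>\<^sup>+z. indicator (period_cell per) (x + z) \<partial>count_space (period_lattice per)) = (1::ennreal)"
    using z by simp
  have "(\<integral>\<^sup>+z. indicator (period_cell per) (x - z) \<partial>count_space (period_lattice per))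
      = (\<integral>\<^sup>+z. indicator {- ?z} z \<partial>count_space (period_lattice per))"
  proof (intro nn_integral_cong)
    fix z assume "z \<in> space (count_space (period_lattice per))"
    then show "indicator (period_cell per) (x - z) = (indicator {- ?z} z :: ennreal)"
      using translate_in_cell_iff[OF period_lattice_uminus[of z], of x]
      by (simp add: indicator_def minus_equation_iff[of z] eq_commute[of z])
  qed
  then show "(\<integral>\<^sup>+z. indicator (period_cell per) (x - z) \<partial>count_space (period_lattice per)) = (1::ennreal)"
    using period_lattice_uminus[OF z] by simp
qed

text \<open>Insert \<open>1\<close> as the sum of the indicators of the translated cells, shift each summand by its
  lattice vector, and sum the other indicator over the lattice instead.\<close>

lemma nn_integral_cell_translate:
  fixes f :: "real^'m \<Rightarrow> ennreal"
  assumes [measurable]: "f \<in> borel_measurable borel" and f: "periodic per f"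
  shows "(\<integral>\<^sup>+x. indicator (period_cell per) x * f (x + w) \<partial>lborel)
       = (\<integral>\<^sup>+x. indicator (period_cell per) x * f x \<partial>lborel)"
proof -
  let ?C = "indicator (period_cell per) :: real^'m \<Rightarrow> ennreal" and ?L = "period_lattice per"
  have "(\<integral>\<^sup>+x. ?C x * f (x + w) \<partial>lborel) = (\<integral>\<^sup>+x. ?C (x - w) * f x \<partial>lborel)"
    using nn_integral_lborel_translate[of "\<lambda>x. ?C (x - w) * f x" w] by simp
  also have "\<dots> = (\<integral>\<^sup>+x. (\<integral>\<^sup>+z. ?C (x + z) \<partial>count_space ?L) * (?C (x - w) * f x) \<partial>lborel)"
    by (simp add: nn_sum_lattice_cell)
  also have "\<dots> = (\<integral>\<^sup>+x. (\<integral>\<^sup>+z. ?C (x + z) * (?C (x - w) * f x) \<partial>count_space ?L) \<partial>lborel)"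
    by (simp add: nn_integral_multc)
  also have "\<dots> = (\<integral>\<^sup>+z. (\<integral>\<^sup>+x. ?C (x + z) * (?C (x - w) * f x) \<partial>lborel) \<partial>count_space ?L)"
    by (intro nn_integral_count_space_nn_integral countable_period_lattice) measurable
  also have "\<dots> = (\<integral>\<^sup>+z. (\<integral>\<^sup>+x. ?C x * f x * ?C (x - w - z) \<partial>lborel) \<partial>count_space ?L)"
  proof (rule nn_integral_cong)
    fix z assume "z \<in> space (count_space ?L)"
    then have z: "f (x - z) = f x" for x
      using f period_lattice_uminus[of z] unfolding periodic_def by (metis add_uminus_conv_diff space_count_space)
    show "(\<integral>\<^sup>+x. ?C (x + z) * (?C (x - w) * f x) \<partial>lborel) = (\<integral>\<^sup>+x. ?C x * f x * ?C (x - w - z) \<partial>lborel)"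
      using nn_integral_lborel_translate[of "\<lambda>x. ?C (x + z) * (?C (x - w) * f x)" "- z"]
      by (simp add: z mult_ac algebra_simps)
  qed
  also have "\<dots> = (\<integral>\<^sup>+x. (\<integral>\<^sup>+z. ?C x * f x * ?C (x - w - z) \<partial>count_space ?L) \<partial>lborel)"
    by (intro nn_integral_count_space_nn_integral[symmetric] countable_period_lattice) measurable
  also have "\<dots> = (\<integral>\<^sup>+x. ?C x * f x \<partial>lborel)"
    by (simp add: nn_integral_cmult nn_sum_lattice_cell)
  finally show ?thesis .
qed

text \<open>Equality of measures carries the invariance over to integrals with values in Banach spaces.\<close>

lemma distr_cell_measure: "distr (cell_measure per) borel (\<lambda>x. reduce per (x + w)) = cell_measure per"
proof (rule measure_eqI)
  fix A assume "A \<in> sets (distr (cell_measure per) borel (\<lambda>x. reduce per (x + w)))"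
  then have [measurable]: "A \<in> sets borel" by simp
  let ?f = "\<lambda>x. indicator A (reduce per x) :: ennreal"
  have "emeasure (distr (cell_measure per) borel (\<lambda>x. reduce per (x + w))) A
      = (\<integral>\<^sup>+x. indicator A x \<partial>distr (cell_measure per) borel (\<lambda>x. reduce per (x + w)))"
    by simp
  also have "\<dots> = (\<integral>\<^sup>+x. ?f (x + w) \<partial>cell_measure per)"
    by (subst nn_integral_distr) auto
  also have "\<dots> = (\<integral>\<^sup>+x. indicator (period_cell per) x * ?f x \<partial>lborel)"
    by (simp add: nn_integral_cell_measure nn_integral_cell_translate[of ?f, OF _ periodic_comp_reduce])
  also have "\<dots> = (\<integral>\<^sup>+x. indicator (period_cell per) x * indicator A x \<partial>lborel)"
    by (intro nn_integral_cong) (auto simp: indicator_def reduce_cell)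
  also have "\<dots> = emeasure (cell_measure per) A"
    by (simp flip: nn_integral_cell_measure)
  finally show "emeasure (distr (cell_measure per) borel (\<lambda>x. reduce per (x + w))) A
      = emeasure (cell_measure per) A" .
qed simp

text \<open>A periodic \<open>f\<close> satisfies \<open>f = f \<circ> reduce per\<close>, and \<open>x \<mapsto> reduce per (x + w)\<close> preserves the
  measure of the cell.  Integration by parts, the symmetry of convolution and
  local integrability are all drawn from this lemma.\<close>

lemma cell_translate:
  fixes f :: "real^'m \<Rightarrow> 'b::{banach, second_countable_topology}"
  assumes [measurable]: "f \<in> borel_measurable borel" and f: "periodic per f"
  shows "integrable (cell_measure per) (\<lambda>x. f (x + w)) \<longleftrightarrow> integrable (cell_measure per) f"
    and "(LINT x|cell_measure per. f (x + w)) = (LINT x|cell_measure per. f x)"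
proof -
  have e: "(\<lambda>x. f (x + w)) = (\<lambda>x. f (reduce per (x + w)))"
    using periodic_reduce[OF f] by simp
  show "integrable (cell_measure per) (\<lambda>x. f (x + w)) \<longleftrightarrow> integrable (cell_measure per) f"
    unfolding e by (subst (2) distr_cell_measure[of w, symmetric]) (simp add: integrable_distr_eq)
  show "(LINT x|cell_measure per. f (x + w)) = (LINT x|cell_measure per. f x)"
    unfolding e by (subst (2) distr_cell_measure[of w, symmetric]) (simp add: integral_distr)
qed

end

section \<open>Integration by parts and Fubini over a cell\<close>

definition orbit :: "('m::finite \<Rightarrow> real) \<Rightarrow> (real^'m) set \<Rightarrow> (real^'m) set" where
  "orbit per K = (\<Union>y\<in>K. \<Union>z\<in>period_lattice per. {y + z})"

lemma orbit_iff: "x \<in> orbit per K \<longleftrightarrow> (\<exists>y\<in>K. \<exists>z\<in>period_lattice per. x = y + z)"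
  by (auto simp: orbit_def)

lemma orbit_closed: "compact K \<Longrightarrow> closed (orbit per K)"
  unfolding orbit_def by (intro compact_closed_sums closed_period_lattice)

lemma orbit_borel: "compact K \<Longrightarrow> orbit per K \<in> sets borel"
  by (intro borel_closed orbit_closed)

lemma orbit_translate:
  assumes "x \<in> orbit per K" "z \<in> period_lattice per" shows "x + z \<in> orbit per K"
proof -
  obtain y z' where "y \<in> K" "z' \<in> period_lattice per" "x = y + z'"
    using assms(1) by (auto simp: orbit_iff)
  then show ?thesis
    using period_lattice_add[OF _ assms(2), of z'] by (auto simp: orbit_iff add.assoc)
qed

lemma orbit_translate_iff:
  assumes "z \<in> period_lattice per" shows "x + z \<in> orbit per K \<longleftrightarrow> x \<in> orbit per K"
  using orbit_translate[OF _ assms, of x K] orbit_translate[OF _ period_lattice_uminus[OF assms], of "x + z" K]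
  by auto

lemma orbit_enlarge:
  assumes "x \<in> orbit per K" "norm w \<le> \<delta>"
  shows "x + w \<in> orbit per {y + v |y v. y \<in> K \<and> v \<in> cball 0 \<delta>}"
proof -
  obtain y z where "y \<in> K" "z \<in> period_lattice per" "x = y + z"
    using assms(1) by (auto simp: orbit_iff)
  then have "x + w = (y + w) + z" by (simp add: algebra_simps)
  moreover have "y + w \<in> {y + v |y v. y \<in> K \<and> v \<in> cball 0 \<delta>}"
    using \<open>y \<in> K\<close> assms(2) by (intro CollectI exI[of _ y] exI[of _ w]) simp
  ultimately show ?thesis using \<open>z \<in> _\<close> unfolding orbit_iff by blast
qed

lemma periodic_derivative:
  assumes "periodic per f" "\<And>x. f differentiable (at x)" "z \<in> period_lattice per"
  shows "frechet_derivative f (at (x + z)) = frechet_derivative f (at x)"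
proof -
  have "(f has_derivative frechet_derivative f (at (x + z))) (at (x + z))"
    using assms(2) by (simp flip: frechet_derivative_works)
  then have "((\<lambda>y. f (y + z)) has_derivative (\<lambda>h. frechet_derivative f (at (x + z)) h)) (at x)"
    by (rule has_derivative_compose[rotated]) (auto intro!: derivative_eq_intros)
  moreover have "(\<lambda>y. f (y + z)) = f" using assms(1,3) by (auto simp: periodic_def)
  ultimately show ?thesis by (metis frechet_derivative_at)
qed

context
  fixes per :: "'m::finite \<Rightarrow> real"
  assumes per: "\<And>j. 0 \<le> per j"
begin

text \<open>A cell may be unbounded, but the part of it that meets the translates of a compact set is
  bounded: non-periodic coordinates are controlled by the compact set, periodic ones by the cell.\<close>

lemma bounded_orbit_cell:
  assumes "compact K"
  shows "bounded (orbit per K \<inter> period_cell per)"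
proof -
  obtain B where B: "\<And>y. y \<in> K \<Longrightarrow> norm y \<le> B"
    using compact_imp_bounded[OF assms] by (auto simp: bounded_iff)
  have "norm x \<le> (\<Sum>j\<in>UNIV. B + per j)" if x: "x \<in> orbit per K \<inter> period_cell per" for x
  proof -
    obtain y z where y: "y \<in> K" and z: "z \<in> period_lattice per" "x = y + z"
      using x by (auto simp: orbit_iff)
    have B0: "0 \<le> B" using B[OF y] norm_ge_zero order_trans by blast
    have "\<bar>x $ j\<bar> \<le> B + per j" for j
    proof (cases "per j = 0")
      case True
      obtain i :: int where "z $ j = of_int i * per j" using z(1) by (auto simp: period_lattice_def)
      then show ?thesis
        using True z(2) B[OF y] component_le_norm_cart[of y j] by simp
    next
      case False
      then show ?thesis using x B0 by (auto simp: period_cell_def)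
    qed
    then have "(\<Sum>j\<in>UNIV. \<bar>x $ j\<bar>) \<le> (\<Sum>j\<in>UNIV. B + per j)" by (intro sum_mono)
    then show ?thesis using norm_le_l1_cart[of x] by linarith
  qed
  then show ?thesis by (auto simp: bounded_iff)
qed

lemma integrable_indicator_orbit:
  assumes K: "compact K"
  shows "integrable (cell_measure per) (indicator (orbit per K) :: _ \<Rightarrow> real)"
proof -
  note [measurable] = orbit_borel[OF K]
  have "emeasure (cell_measure per) (orbit per K)
      = (\<integral>\<^sup>+x. indicator (orbit per K \<inter> period_cell per) x \<partial>lborel)"
    unfolding cell_measure_def
    by (subst emeasure_density) (simp_all add: indicator_inter_arith[symmetric] Int_commute)
  also have "\<dots> < \<infinity>"
    using emeasure_bounded_finite[OF bounded_orbit_cell[OF K]] by simp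
  finally show ?thesis by (simp add: integrable_indicator_iff)
qed

lemma integrable_bounded_on_orbit:
  fixes h :: "real^'m \<Rightarrow> 'b::{banach, second_countable_topology}"
  assumes K: "compact K" and h: "h \<in> borel_measurable borel"
    and "\<And>x. x \<in> orbit per K \<Longrightarrow> norm (h x) \<le> M" "\<And>x. x \<notin> orbit per K \<Longrightarrow> h x = 0"
  shows "integrable (cell_measure per) h"
proof (rule integrable_dominated)
  show "integrable (cell_measure per) (\<lambda>x. M * indicator (orbit per K) x)"
    using integrable_indicator_orbit[OF K] by simp
  show "norm (h x) \<le> norm (M * indicator (orbit per K) x)" for x
    using assms(3)[of x] assms(4)[of x] by (cases "x \<in> orbit per K") auto
qed (use h in \<open>simp add: measurable_cong_sets[OF sets_cell_measure]\<close>)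

lemma bounded_periodic_continuous:
  fixes g :: "real^'m \<Rightarrow> 'b::real_normed_vector"
  assumes "compact K" "continuous_on UNIV g" "periodic per g"
  obtains M where "0 \<le> M" "\<And>x. x \<in> orbit per K \<Longrightarrow> norm (g x) \<le> M"
proof -
  have "compact (g ` K)" using assms by (intro compact_continuous_image) (auto intro: continuous_on_subset)
  then obtain M where M: "\<And>x. x \<in> K \<Longrightarrow> norm (g x) \<le> M"
    by (metis compact_imp_bounded bounded_iff imageI)
  have "norm (g x) \<le> max M 0" if "x \<in> orbit per K" for x
    using that assms(3) M by (force simp: orbit_iff periodic_def)
  then show thesis by (intro that[of "max M 0"]) auto
qed

text \<open>A bound that is uniform in \<open>w\<close> over the support of the kernel makes the product integrable, so
  the integrals may be exchanged.\<close>

lemma kernel_Fubini: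
  fixes p :: "real^'m \<Rightarrow> real^'m \<Rightarrow> real"
  assumes \<kappa>: "integrable lborel \<kappa>" "\<And>w. r < norm w \<Longrightarrow> \<kappa> w = (0::real)"
    and p [measurable]: "(\<lambda>(w, y). p w y) \<in> borel_measurable (borel \<Otimes>\<^sub>M borel)"
    and int: "\<And>w. norm w \<le> r \<Longrightarrow> integrable (cell_measure per) (p w)"
    and bd: "\<And>w. norm w \<le> r \<Longrightarrow> (LINT y|cell_measure per. \<bar>p w y\<bar>) \<le> A"
  shows "integrable (cell_measure per) (\<lambda>y. LINT w|lborel. \<kappa> w * p w y)"
    and "(LINT y|cell_measure per. LINT w|lborel. \<kappa> w * p w y)
       = (LINT w|lborel. \<kappa> w * (LINT y|cell_measure per. p w y))"
proof -
  have [measurable]: "\<kappa> \<in> borel_measurable borel" using \<kappa>(1) by auto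
  note [measurable_cong] = sets_cell_measure[of per]
  interpret C: sigma_finite_measure "cell_measure per" by (rule sigma_finite_cell_measure)
  interpret P: pair_sigma_finite lborel "cell_measure per" ..
  have H: "integrable (lborel \<Otimes>\<^sub>M cell_measure per) (\<lambda>(w, y). \<kappa> w * p w y)"
  proof (rule P.Fubini_integrable)
    have "integrable (cell_measure per) (\<lambda>y. \<kappa> w * p w y)" for w
      using int[of w] \<kappa>(2)[of w] by (cases "norm w \<le> r") auto
    then show "AE w in lborel. integrable (cell_measure per) (\<lambda>y. case (w, y) of (w, y) \<Rightarrow> \<kappa> w * p w y)"
      by simp
    show "integrable lborel (\<lambda>w. LINT y|cell_measure per. norm (case (w, y) of (w, y) \<Rightarrow> \<kappa> w * p w y))"
    proof (rule integrable_dominated)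
      show "integrable lborel (\<lambda>w. A * \<kappa> w)" using \<kappa>(1) by simp
      show "norm (LINT y|cell_measure per. norm (case (w, y) of (w, y) \<Rightarrow> \<kappa> w * p w y)) \<le> norm (A * \<kappa> w)" for w
      proof (cases "norm w \<le> r")
        case True
        have "0 \<le> (LINT y|cell_measure per. \<bar>p w y\<bar>)" by simp
        then show ?thesis
          using bd[OF True] by (simp add: abs_mult mult.commute[of A] mult_left_mono)
      qed (simp add: \<kappa>(2))
    qed measurable
  qed measurable
  from P.integrable_snd[OF H]
  show "integrable (cell_measure per) (\<lambda>y. LINT w|lborel. \<kappa> w * p w y)" .
  from P.Fubini_integral[OF H]
  show "(LINT y|cell_measure per. LINT w|lborel. \<kappa> w * p w y)
       = (LINT w|lborel. \<kappa> w * (LINT y|cell_measure per. p w y))" by simp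
qed

text \<open>Convolution with a kernel is, up to reflection of the kernel, a symmetric operation for
  the pairing over a cell: exchange the integrals and translate by \<open>w\<close>.\<close>

lemma cell_convol_swap:
  fixes a b :: "real^'m \<Rightarrow> real"
  assumes \<kappa>: "bump_within r \<kappa>" "bump_within r (\<lambda>w. \<kappa> (- w))"
    and [measurable]: "a \<in> borel_measurable borel" "b \<in> borel_measurable borel"
    and a: "periodic per a" and b: "periodic per b"
    and int: "\<And>w. norm w \<le> r \<Longrightarrow> integrable (cell_measure per) (\<lambda>y. a (y + w) * b y)"
    and bd: "\<And>w. norm w \<le> r \<Longrightarrow> (LINT y|cell_measure per. \<bar>a (y + w) * b y\<bar>) \<le> A"
  shows "(LINT x|cell_measure per. a x * convol \<kappa> b x)
       = (LINT y|cell_measure per. b y * convol (\<lambda>w. \<kappa> (- w)) a y)"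
    and "integrable (cell_measure per) (\<lambda>x. a x * convol \<kappa> b x)"
    and "integrable (cell_measure per) (\<lambda>y. b y * convol (\<lambda>w. \<kappa> (- w)) a y)"
proof -
  have [measurable]: "\<kappa> \<in> borel_measurable borel" by (rule bump_within_measurable[OF \<kappa>(1)])
  have supp: "\<kappa> w = 0" if "r < norm w" for w using \<kappa>(1) that by (simp add: bump_within_def)
  have per': "periodic per (\<lambda>y. a (y + w) * b y)" for w
    unfolding periodic_def
  proof (intro allI ballI)
    fix x z assume z: "z \<in> period_lattice per"
    have "a (x + z + w) = a (x + w)" using a z unfolding periodic_def by (metis add.assoc add.commute)
    then show "a (x + z + w) * b (x + z) = a (x + w) * b x" using b z by (simp add: periodic_def)
  qed
  have per'': "periodic per (\<lambda>y. \<bar>a (y + w) * b y\<bar>)" for w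
    using per'[of w] by (simp add: periodic_def)
  have tr: "integrable (cell_measure per) (\<lambda>x. a x * b (x - w)) \<longleftrightarrow> integrable (cell_measure per) (\<lambda>y. a (y + w) * b y)"
    "(LINT x|cell_measure per. a x * b (x - w)) = (LINT y|cell_measure per. a (y + w) * b y)"
    "(LINT x|cell_measure per. \<bar>a x * b (x - w)\<bar>) = (LINT y|cell_measure per. \<bar>a (y + w) * b y\<bar>)" for w
    using cell_translate[OF per, OF _ per'[of w], of "- w"] cell_translate(2)[OF per, OF _ per''[of w], of "- w"]
    by simp_all
  have F1: "integrable (cell_measure per) (\<lambda>y. LINT w|lborel. \<kappa> w * (a (y + w) * b y))"
    "(LINT y|cell_measure per. LINT w|lborel. \<kappa> w * (a (y + w) * b y))
       = (LINT w|lborel. \<kappa> w * (LINT y|cell_measure per. a (y + w) * b y))"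
    by (rule kernel_Fubini[where r = r and A = A]; use int bd supp integrable_bump[OF \<kappa>(1)] in simp)+
  have F2: "integrable (cell_measure per) (\<lambda>x. LINT w|lborel. \<kappa> w * (a x * b (x - w)))"
    "(LINT x|cell_measure per. LINT w|lborel. \<kappa> w * (a x * b (x - w)))
       = (LINT w|lborel. \<kappa> w * (LINT x|cell_measure per. a x * b (x - w)))"
    by (rule kernel_Fubini[where r = r and A = A];
        use int bd supp integrable_bump[OF \<kappa>(1)] tr in simp)+
  have e1: "(LINT w|lborel. \<kappa> w * (a (y + w) * b y)) = b y * convol (\<lambda>w. \<kappa> (- w)) a y" for y
  proof -
    have "(LINT w|lborel. \<kappa> w * (a (y + w) * b y)) = (LINT w|lborel. b y * (\<kappa> (- w) * a (y - w)))"
      using lborel_reflect(1)[of "\<lambda>w. \<kappa> w * (a (y + w) * b y)" 0] by (simp add: mult_ac)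
    then show ?thesis by (simp add: convol_eq[OF \<kappa>(2)])
  qed
  have e2: "(LINT w|lborel. \<kappa> w * (a x * b (x - w))) = a x * convol \<kappa> b x" for x
  proof -
    have "(LINT w|lborel. \<kappa> w * (a x * b (x - w))) = (LINT w|lborel. a x * (\<kappa> w * b (x - w)))"
      by (simp add: mult_ac)
    then show ?thesis by (simp add: convol_eq[OF \<kappa>(1)])
  qed
  show "integrable (cell_measure per) (\<lambda>x. a x * convol \<kappa> b x)"
    "integrable (cell_measure per) (\<lambda>y. b y * convol (\<lambda>w. \<kappa> (- w)) a y)"
    using F1(1) F2(1) by (simp_all add: e1 e2)
  show "(LINT x|cell_measure per. a x * convol \<kappa> b x)
       = (LINT y|cell_measure per. b y * convol (\<lambda>w. \<kappa> (- w)) a y)"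
    using F1(2) F2(2) by (simp add: e1 e2 tr)
qed

text \<open>Integration by parts.  Writing \<open>F (x + e) - F x\<close> as the integral of the derivative along
  the segment and integrating over a cell gives \<open>0\<close> on the left, by translation invariance, and
  the integral of the directional derivative on the right.\<close>

lemma cell_integral_derivative:
  fixes F :: "real^'m \<Rightarrow> 'b::euclidean_space"
  assumes K: "compact K" and F': "\<And>x. (F has_derivative F' x) (at x)"
    and cont: "continuous_on UNIV (\<lambda>x. F' x e)"
    and F: "periodic per F" "\<And>x. x \<notin> orbit per K \<Longrightarrow> F x = 0"
  shows "integrable (cell_measure per) (\<lambda>x. F' x e)"
    and "(LINT x|cell_measure per. F' x e) = 0"
proof -
  have F'_eq: "F' x = frechet_derivative F (at x)" for x by (rule frechet_derivative_at[OF F'])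
  have F'0: "F' x e = 0" if "x \<notin> orbit per K" for x
    using that by (simp add: F'_eq frechet_derivative_eq_0_outside[OF orbit_closed[OF K] _ F(2)])
  have perF': "periodic per (\<lambda>x. F' x e)"
    using periodic_derivative[OF F(1) differentiableI[OF F']] by (simp add: periodic_def F'_eq)
  have contF: "continuous_on UNIV F"
    using F' by (auto intro!: continuous_at_imp_continuous_on has_derivative_continuous)
  have [measurable]: "(\<lambda>x. F' x e) \<in> borel_measurable borel" "F \<in> borel_measurable borel"
    by (intro borel_measurable_continuous_onI cont contF)+
  obtain M where "\<And>x. x \<in> orbit per K \<Longrightarrow> norm (F' x e) \<le> M"
    using bounded_periodic_continuous[OF K cont perF'] by metis
  then show int: "integrable (cell_measure per) (\<lambda>x. F' x e)"
    using F'0 by (intro integrable_bounded_on_orbit[OF K, of _ M]) auto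
  obtain MF where "\<And>x. x \<in> orbit per K \<Longrightarrow> norm (F x) \<le> MF"
    using bounded_periodic_continuous[OF K contF F(1)] by metis
  then have intF: "integrable (cell_measure per) F"
    using F(2) by (intro integrable_bounded_on_orbit[OF K, of _ MF]) auto
  have FTC: "(LINT s|lborel. indicator {0..1} s *\<^sub>R F' (x + s *\<^sub>R e) e) = F (x + e) - F x" for x
  proof -
    have "(LINT s|lborel. indicator {0..1} s *\<^sub>R F' (x + s *\<^sub>R e) e) = F (x + 1 *\<^sub>R e) - F (x + 0 *\<^sub>R e)"
    proof (rule integral_FTC_Icc)
      fix s :: real
      have "((\<lambda>s. x + s *\<^sub>R e) has_derivative (\<lambda>h. h *\<^sub>R e)) (at s)"
        by (auto intro!: derivative_eq_intros)
      from has_derivative_compose[OF this F']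
      have "((\<lambda>s. F (x + s *\<^sub>R e)) has_derivative (\<lambda>h. F' (x + s *\<^sub>R e) (h *\<^sub>R e))) (at s)" .
      moreover have "F' (x + s *\<^sub>R e) (h *\<^sub>R e) = h *\<^sub>R F' (x + s *\<^sub>R e) e" for h
        using has_derivative_linear[OF F'] by (rule linear_scale)
      ultimately show "((\<lambda>s. F (x + s *\<^sub>R e)) has_vector_derivative F' (x + s *\<^sub>R e) e) (at s within {0..1})"
        by (simp add: has_vector_derivative_def has_derivative_at_withinI)
      show "continuous_on {0..1} (\<lambda>s. F' (x + s *\<^sub>R e) e)"
        by (rule continuous_on_compose2[OF cont]) (auto intro!: continuous_intros)
    qed simp
    then show ?thesis by simp
  qed
  let ?M = "cell_measure per"
  note [measurable_cong] = sets_cell_measure[of per]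
  interpret C: sigma_finite_measure ?M by (rule sigma_finite_cell_measure)
  interpret P: pair_sigma_finite "lborel :: real measure" ?M ..
  have tr: "integrable ?M (\<lambda>x. F' (x + w) e)" "(LINT x|?M. F' (x + w) e) = (LINT x|?M. F' x e)"
    "(LINT x|?M. norm (F' (x + w) e)) = (LINT x|?M. norm (F' x e))" for w
  proof -
    have "periodic per (\<lambda>x. norm (F' x e))" using perF' by (simp add: periodic_def)
    from cell_translate(2)[OF per _ this, of w]
    show "(LINT x|?M. norm (F' (x + w) e)) = (LINT x|?M. norm (F' x e))" by simp
  qed (use cell_translate[OF per _ perF', of w] int in simp_all)
  have cont2: "continuous_on UNIV (\<lambda>(s, x). F' (x + s *\<^sub>R e) e)"
    unfolding case_prod_beta by (rule continuous_on_compose2[OF cont]) (auto intro!: continuous_intros)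
  then have [measurable]: "(\<lambda>(s, x). F' (x + s *\<^sub>R e) e) \<in> borel_measurable (borel \<Otimes>\<^sub>M borel)"
    by (simp add: borel_prod borel_measurable_continuous_onI)
  have ind: "integrable lborel (indicator {0..1::real} :: real \<Rightarrow> real)"
    by (simp add: integrable_indicator_iff)
  have H: "integrable (lborel \<Otimes>\<^sub>M ?M) (\<lambda>(s, x). indicator {0..1} s *\<^sub>R F' (x + s *\<^sub>R e) e)"
  proof (rule P.Fubini_integrable)
    show "AE s in lborel. integrable ?M (\<lambda>x. case (s, x) of (s, x) \<Rightarrow> indicator {0..1} s *\<^sub>R F' (x + s *\<^sub>R e) e)"
      using tr by simp
    show "integrable lborel (\<lambda>s. LINT x|?M. norm (case (s, x) of (s, x) \<Rightarrow> indicator {0..1} s *\<^sub>R F' (x + s *\<^sub>R e) e))"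
      using ind by (simp add: tr)
  qed measurable
  have "(LINT x|?M. F' x e) = (LINT s|lborel. LINT x|?M. indicator {0..1} s *\<^sub>R F' (x + s *\<^sub>R e) e)"
    using ind by (simp add: tr)
  also have "\<dots> = (LINT x|?M. LINT s|lborel. indicator {0..1} s *\<^sub>R F' (x + s *\<^sub>R e) e)"
    using P.Fubini_integral[OF H] by simp
  also have "\<dots> = (LINT x|?M. F (x + e) - F x)" by (simp only: FTC)
  also have "\<dots> = 0"
    using cell_translate[OF per _ F(1), of e] intF by simp
  finally show "(LINT x|?M. F' x e) = 0" .
qed

end

section \<open>Convex means and weighted moments\<close>

text \<open>If the mean were outside, a hyperplane would separate it from \<open>S\<close>, strictly so because \<open>S\<close> is
  open; then a positive function would have integral zero.\<close>

lemma open_convex_mean: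
  fixes f :: "'a \<Rightarrow> 'b::euclidean_space" and \<kappa> :: "'a \<Rightarrow> real"
  assumes "open S" "convex S" and f: "\<And>w. f w \<in> S" and \<kappa>: "\<And>w. 0 \<le> \<kappa> w" "integrable M \<kappa>" "(LINT w|M. \<kappa> w) = 1"
    and int: "integrable M (\<lambda>w. \<kappa> w *\<^sub>R f w)"
  shows "(LINT w|M. \<kappa> w *\<^sub>R f w) \<in> S"
proof (rule ccontr)
  let ?V = "LINT w|M. \<kappa> w *\<^sub>R f w"
  assume "?V \<notin> S"
  then obtain a b where a: "a \<noteq> 0" and ab: "\<And>x. x \<in> S \<Longrightarrow> a \<bullet> x \<le> b" "b \<le> a \<bullet> ?V"
    using separating_hyperplane_sets[of S "{?V}"] \<open>convex S\<close> f by blast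
  have strict: "a \<bullet> x < a \<bullet> ?V" if "x \<in> S" for x
  proof -
    obtain e where e: "0 < e" "cball x e \<subseteq> S" using \<open>open S\<close> \<open>x \<in> S\<close> open_contains_cball by metis
    have "x + (e / norm a) *\<^sub>R a \<in> cball x e" using e a by (simp add: dist_norm)
    then have "a \<bullet> (x + (e / norm a) *\<^sub>R a) \<le> b" using e ab(1) by blast
    moreover have "a \<bullet> (x + (e / norm a) *\<^sub>R a) > a \<bullet> x" using e a by (simp add: inner_add_right)
    ultimately show ?thesis using ab(2) by linarith
  qed
  have int_a: "integrable M (\<lambda>w. a \<bullet> (\<kappa> w *\<^sub>R f w))" using int by (rule integrable_inner_right)
  have i: "integrable M (\<lambda>w. \<kappa> w * (a \<bullet> ?V) - a \<bullet> (\<kappa> w *\<^sub>R f w))" using \<kappa>(2) int_a by auto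
  have "(LINT w|M. \<kappa> w * (a \<bullet> ?V) - a \<bullet> (\<kappa> w *\<^sub>R f w)) = (LINT w|M. \<kappa> w * (a \<bullet> ?V)) - (LINT w|M. a \<bullet> (\<kappa> w *\<^sub>R f w))"
    using \<kappa>(2) int_a by (intro Bochner_Integration.integral_diff) auto
  also have "(LINT w|M. a \<bullet> (\<kappa> w *\<^sub>R f w)) = a \<bullet> ?V" by (rule integral_inner_right) (use int in simp)
  finally have 0: "(LINT w|M. \<kappa> w * (a \<bullet> ?V) - a \<bullet> (\<kappa> w *\<^sub>R f w)) = 0" using \<kappa>(3) by simp
  have e: "\<kappa> w * (a \<bullet> ?V) - a \<bullet> (\<kappa> w *\<^sub>R f w) = \<kappa> w * (a \<bullet> ?V - a \<bullet> f w)" for w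
    by (simp add: algebra_simps)
  have "AE w in M. 0 \<le> \<kappa> w * (a \<bullet> ?V - a \<bullet> f w)"
    using strict[OF f] \<kappa>(1) by (intro AE_I2 mult_nonneg_nonneg) (auto intro: less_imp_le)
  then have "AE w in M. \<kappa> w * (a \<bullet> ?V - a \<bullet> f w) = 0"
    using integral_nonneg_eq_0_iff_AE[OF i] 0 unfolding e by blast
  then have "AE w in M. \<kappa> w = 0"
    by eventually_elim (use strict[OF f] in \<open>metis less_irrefl mult_eq_0_iff right_minus_eq\<close>)
  then have "(LINT w|M. \<kappa> w) = 0" by (simp add: integral_eq_zero_AE)
  with \<kappa>(3) show False by simp
qed

lemma square_le_one_plus_cube: "0 \<le> x \<Longrightarrow> x\<^sup>2 \<le> 1 + x ^ 3" for x :: real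
proof (cases "x \<le> 1")
  case True
  moreover assume "0 \<le> x"
  ultimately show ?thesis using power_le_one[of x 2] zero_le_power[of x 3] by linarith
next
  case False
  then have "x\<^sup>2 \<le> x ^ 3" by (intro power_increasing) auto
  then show ?thesis by simp
qed

lemma le_one_plus_cube: "0 \<le> x \<Longrightarrow> x \<le> 1 + x ^ 3" for x :: real
proof (cases "x \<le> 1")
  case True
  moreover assume "0 \<le> x"
  ultimately show ?thesis using zero_le_power[of x 3] by linarith
next
  case False
  then have "x ^ 1 \<le> x ^ 3" by (intro power_increasing) auto
  then show ?thesis by simp
qed

text \<open>Chebyshev's inequality for the weighted mean \<open>a\<close> of \<open>d\<close>:
  \<open>(d - a) * (d\<^sup>2 - a\<^sup>2) \<ge> 0\<close>, integrated.  It replaces the H\<ouml>lder inequalities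
  by which one usually combines a first and a second moment into a third.\<close>

lemma weighted_moments:
  fixes \<beta> d :: "'a \<Rightarrow> real"
  assumes \<beta>: "\<And>w. 0 \<le> \<beta> w" "integrable M \<beta>" "(LINT w|M. \<beta> w) = 1"
    and d: "\<And>w. 0 \<le> d w" "d \<in> borel_measurable M" and int: "integrable M (\<lambda>w. \<beta> w * d w ^ 3)"
  defines "a \<equiv> LINT w|M. \<beta> w * d w" and "b \<equiv> LINT w|M. \<beta> w * (d w)\<^sup>2" and "t \<equiv> LINT w|M. \<beta> w * d w ^ 3"
  shows "integrable M (\<lambda>w. \<beta> w * d w)" and "integrable M (\<lambda>w. \<beta> w * (d w)\<^sup>2)"
    and "0 \<le> a" "0 \<le> b" "0 \<le> t" "a * b \<le> t" "a\<^sup>2 \<le> b" "a ^ 3 \<le> t"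
    and "\<And>e. 0 < e \<Longrightarrow> b \<le> t / e + e\<^sup>2"
proof -
  note [measurable] = d(2) borel_measurable_integrable[OF \<beta>(2)]
  have dom: "integrable M (\<lambda>w. \<beta> w + \<beta> w * d w ^ 3)" using \<beta>(2) int by simp
  show i1: "integrable M (\<lambda>w. \<beta> w * d w)"
  proof (rule Bochner_Integration.integrable_bound[OF dom])
    have "\<beta> w * d w \<le> \<beta> w * (1 + d w ^ 3)" for w by (intro mult_left_mono le_one_plus_cube d \<beta>)
    then show "AE w in M. norm (\<beta> w * d w) \<le> norm (\<beta> w + \<beta> w * d w ^ 3)"
      using \<beta> d by (simp add: distrib_left)
  qed measurable
  show i2: "integrable M (\<lambda>w. \<beta> w * (d w)\<^sup>2)"
  proof (rule Bochner_Integration.integrable_bound[OF dom])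
    have "\<beta> w * (d w)\<^sup>2 \<le> \<beta> w * (1 + d w ^ 3)" for w by (intro mult_left_mono square_le_one_plus_cube d \<beta>)
    then show "AE w in M. norm (\<beta> w * (d w)\<^sup>2) \<le> norm (\<beta> w + \<beta> w * d w ^ 3)"
      using \<beta> d by (simp add: distrib_left)
  qed measurable
  show a0: "0 \<le> a" and b0: "0 \<le> b" and t0: "0 \<le> t"
    unfolding a_def b_def t_def using \<beta> d by (auto intro!: Bochner_Integration.integral_nonneg)
  \<comment> \<open>\<open>(d - a) (d\<^sup>2 - a\<^sup>2)\<close>, factored\<close>
  have "0 \<le> (LINT w|M. \<beta> w * ((d w - a)\<^sup>2 * (d w + a)))"
    using \<beta> d a0 by (intro Bochner_Integration.integral_nonneg) auto
  also have "\<dots> = (LINT w|M. \<beta> w * d w ^ 3 - a * (\<beta> w * (d w)\<^sup>2) - a\<^sup>2 * (\<beta> w * d w) + a ^ 3 * \<beta> w)"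
    by (intro Bochner_Integration.integral_cong refl)
      (simp add: algebra_simps power2_eq_square power3_eq_cube)
  also have "\<dots> = t - a * b - a\<^sup>2 * a + a ^ 3"
    using i1 i2 int \<beta> by (simp add: a_def b_def t_def)
  finally show ab: "a * b \<le> t" by (simp add: power2_eq_square power3_eq_cube)
  have "0 \<le> (LINT w|M. \<beta> w * (d w - a)\<^sup>2)"
    using \<beta> by (intro Bochner_Integration.integral_nonneg) auto
  also have "\<dots> = (LINT w|M. \<beta> w * (d w)\<^sup>2 - 2 * a * (\<beta> w * d w) + a\<^sup>2 * \<beta> w)"
    by (intro Bochner_Integration.integral_cong refl) (simp add: algebra_simps power2_eq_square)
  also have "\<dots> = b - 2 * a * a + a\<^sup>2"
    using i1 i2 \<beta> by (simp add: a_def b_def)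
  finally show aa: "a\<^sup>2 \<le> b" by (simp add: power2_eq_square)
  have "a ^ 3 = a * a\<^sup>2" by (simp add: power2_eq_square power3_eq_cube)
  also have "\<dots> \<le> a * b" using aa a0 by (rule mult_left_mono)
  finally show "a ^ 3 \<le> t" using ab by simp
  fix e :: real assume e: "0 < e"
  have sq: "x\<^sup>2 \<le> x ^ 3 / e + e\<^sup>2" if "0 \<le> x" for x
  proof (cases "x \<le> e")
    case True
    then have "x\<^sup>2 \<le> e\<^sup>2" using that by (intro power_mono)
    then show ?thesis using that e by (smt (verit) divide_nonneg_pos zero_le_power)
  next
    case False
    then have "x\<^sup>2 * e \<le> x\<^sup>2 * x" by (intro mult_left_mono) auto
    then have "x\<^sup>2 \<le> x ^ 3 / e" using e by (simp add: le_divide_eq power2_eq_square power3_eq_cube)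
    then show ?thesis by (smt (verit) zero_le_power2)
  qed
  have "b \<le> (LINT w|M. \<beta> w * d w ^ 3 * (1 / e) + \<beta> w * e\<^sup>2)"
    unfolding b_def
  proof (rule integral_mono[OF i2])
    show "integrable M (\<lambda>w. \<beta> w * d w ^ 3 * (1 / e) + \<beta> w * e\<^sup>2)" using int \<beta> by auto
    fix w
    have "\<beta> w * (d w)\<^sup>2 \<le> \<beta> w * (d w ^ 3 / e + e\<^sup>2)" by (intro mult_left_mono sq d \<beta>)
    then show "\<beta> w * (d w)\<^sup>2 \<le> \<beta> w * d w ^ 3 * (1 / e) + \<beta> w * e\<^sup>2" by (simp add: distrib_left)
  qed
  also have "\<dots> = t * (1 / e) + e\<^sup>2"
  proof -
    have "(LINT w|M. \<beta> w * d w ^ 3 * (1 / e) + \<beta> w * e\<^sup>2)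
        = (LINT w|M. \<beta> w * d w ^ 3 * (1 / e)) + (LINT w|M. \<beta> w * e\<^sup>2)"
      using int \<beta> by (intro Bochner_Integration.integral_add) auto
    then show ?thesis unfolding t_def by (simp only: integral_mult_left_zero \<beta>(3) mult_1_left)
  qed
  finally show "b \<le> t / e + e\<^sup>2" by simp
qed

lemma borel_comp_continuous_on:
  fixes F :: "'a::euclidean_space \<Rightarrow> 'b::euclidean_space"
  assumes "continuous_on S F" "S \<in> sets borel" "u \<in> borel_measurable M" "\<And>x. u x \<in> S"
  shows "(\<lambda>x. F (u x)) \<in> borel_measurable M"
proof (rule measurable_compose[where f = u and g = F])
  show "u \<in> M \<rightarrow>\<^sub>M restrict_space borel S"
    using assms by (intro measurable_restrict_space2) auto
  show "F \<in> restrict_space borel S \<rightarrow>\<^sub>M borel"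
    using assms(1) by (rule borel_measurable_continuous_on_restrict)
qed

lemma kernel_integrable:
  fixes F :: "'a::euclidean_space \<Rightarrow> 'b::euclidean_space"
  assumes \<kappa>: "\<kappa> \<in> borel_measurable borel" "\<And>w. \<bar>\<kappa> w\<bar> \<le> C * ball_density \<epsilon> w"
    and F: "F \<in> borel_measurable borel" "set_integrable lborel (ball x r) F" "\<epsilon> \<le> r"
  shows "integrable lborel (\<lambda>w. \<kappa> w *\<^sub>R F (x - w))"
proof (rule Bochner_Integration.integrable_bound)
  note [measurable] = \<kappa>(1) F(1)
  let ?v = "measure lborel (ball (0::'a) \<epsilon>)"
  let ?g = "\<lambda>y. (C / ?v) *\<^sub>R (indicator (ball x r) y *\<^sub>R F y)"
  have g: "integrable lborel ?g"
    using F(2) unfolding set_integrable_def by (rule integrable_scaleR_right)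
  then have "?g \<in> borel_measurable borel" by (simp add: borel_measurable_integrable)
  from lborel_reflect(2)[OF this, of x] g show "integrable lborel (\<lambda>w. ?g (x - w))" by simp
  show "AE w in lborel. norm (\<kappa> w *\<^sub>R F (x - w)) \<le> norm (?g (x - w))"
  proof (intro AE_I2)
    fix w
    show "norm (\<kappa> w *\<^sub>R F (x - w)) \<le> norm (?g (x - w))"
    proof (cases "w \<in> ball 0 \<epsilon>")
      case True
      then have "x - w \<in> ball x r" using F(3) by (auto simp: dist_norm)
      moreover have "\<bar>\<kappa> w\<bar> \<le> C / ?v"
        using \<kappa>(2)[of w] True by (simp add: ball_density_def)
      then have "\<bar>\<kappa> w\<bar> \<le> \<bar>C / ?v\<bar>" by (rule order_trans[OF _ abs_ge_self])
      then have "\<bar>\<kappa> w\<bar> * norm (F (x - w)) \<le> \<bar>C / ?v\<bar> * norm (F (x - w))"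
        by (rule mult_right_mono) simp
      ultimately show ?thesis by simp
    next
      case False
      then have "\<kappa> w = 0" using \<kappa>(2)[of w] by (simp add: ball_density_def)
      then show ?thesis by simp
    qed
  qed
qed (use \<kappa>(1) F(1) in measurable)

lemma power3_add_le: "0 \<le> a \<Longrightarrow> 0 \<le> b \<Longrightarrow> (a + b) ^ 3 \<le> 4 * (a ^ 3 + b ^ 3)" for a b :: real
proof -
  assume "0 \<le> a" "0 \<le> b"
  then have "0 \<le> 3 * (a + b) * (a - b)\<^sup>2" by auto
  also have "\<dots> = 4 * (a ^ 3 + b ^ 3) - (a + b) ^ 3"
    by (simp add: power2_eq_square power3_eq_cube algebra_simps)
  finally show ?thesis by simp
qed

section \<open>The setting of the commutator argument\<close>

text \<open>The analytic core.  The field \<open>u\<close> is a Borel version of \<open>U\<close> on the whole space; of the domain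
  there remain only the compact set \<open>K\<close>, whose translates carry the test function \<open>\<psi>\<close>, and the
  distance \<open>\<delta>\<close> by which these translates may be enlarged inside the domain.  Besov regularity
  enters as a bound for the third moment of the increments over the support of \<open>\<psi>\<close>.\<close>

locale companion_law =
  fixes per :: "'m::finite \<Rightarrow> real" and u :: "real^'m \<Rightarrow> real^'n::finite" and \<O> :: "(real^'n) set"
    and G :: "real^'n \<Rightarrow> real^'m^'n" and b :: "real^'n \<Rightarrow> real^'n" and q :: "real^'n \<Rightarrow> real^'m"
    and \<psi> :: "real^'m \<Rightarrow> real" and K :: "(real^'m) set"
    and r0 \<delta> A \<alpha> cG Cb :: real
  assumes per: "\<And>j. 0 \<le> per j"
    and \<O>: "open \<O>" "convex \<O>"
    and u_borel [measurable]: "u \<in> borel_measurable borel"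
    and u_periodic: "periodic per u" and u_in: "\<And>x. u x \<in> \<O>"
    and r0: "0 < r0" and u_ball: "\<And>x. set_integrable lborel (ball x (2 * r0)) (\<lambda>y. norm (u y) ^ 3)"
    and K: "compact K"
    and \<psi>: "periodic per \<psi>" "C_on 1 \<psi> UNIV" "\<And>x. x \<notin> orbit per K \<Longrightarrow> \<psi> x = 0"
    and u_L3: "integrable (cell_measure per) (\<lambda>x. indicator (orbit per K) x * norm (u x) ^ 3)"
    and \<delta>: "0 < \<delta>"
    and besov: "\<And>w. norm w \<le> \<delta> \<Longrightarrow>
        integrable (cell_measure per) (\<lambda>x. indicator (orbit per K) x * norm (u (x - w) - u x) ^ 3)"
      "\<And>w. norm w \<le> \<delta> \<Longrightarrow>
        (LINT x|cell_measure per. indicator (orbit per K) x * norm (u (x - w) - u x) ^ 3) \<le> A * norm w powr (3 * \<alpha>)"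
    and A: "0 \<le> A" and \<alpha>: "1 / 3 < \<alpha>"
    and G_diff: "\<And>v. v \<in> \<O> \<Longrightarrow> G differentiable (at v)" and cG: "0 \<le> cG"
    and DG_lipschitz: "\<And>v w h. v \<in> \<O> \<Longrightarrow> w \<in> \<O> \<Longrightarrow>
       norm (frechet_derivative G (at w) h - frechet_derivative G (at v) h) \<le> cG * norm (w - v) * norm h"
    and G_Taylor: "\<And>v w. v \<in> \<O> \<Longrightarrow> w \<in> \<O> \<Longrightarrow>
       norm (G w - G v - frechet_derivative G (at v) (w - v)) \<le> cG * (norm (w - v))\<^sup>2"
    and b: "C_on 1 b \<O>" and Cb: "0 \<le> Cb" "\<And>v. v \<in> \<O> \<Longrightarrow> norm (b v) \<le> Cb"
      "\<And>v h. v \<in> \<O> \<Longrightarrow> norm (frechet_derivative b (at v) h) \<le> Cb * norm h"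
    and q_deriv: "\<And>v j. v \<in> \<O> \<Longrightarrow> ((\<lambda>v. q v $ j) has_derivative
        (\<lambda>h. \<Sum>i\<in>UNIV. b v $ i * frechet_derivative G (at v) h $ i $ j)) (at v)"
    and law: "\<And>\<phi>. (\<And>m. C_on m \<phi> UNIV) \<Longrightarrow> periodic per \<phi> \<Longrightarrow>
        (\<And>x. x \<notin> orbit per {y + v |y v. y \<in> K \<and> v \<in> cball 0 \<delta>} \<Longrightarrow> \<phi> x = 0) \<Longrightarrow>
        (LINT x|cell_measure per. (\<Sum>i\<in>UNIV. \<Sum>j\<in>UNIV. G (u x) $ i $ j * partial_deriv (axis j 1) \<phi> x $ i)) = 0"
begin

abbreviation "DG v \<equiv> frechet_derivative G (at v)"
abbreviation "Db v \<equiv> frechet_derivative b (at v)"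
abbreviation "S \<equiv> orbit per K"

lemma b_diff: "v \<in> \<O> \<Longrightarrow> b differentiable (at v)"
  using b by simp

lemma G_cont: "continuous_on \<O> G"
  using G_diff by (simp add: continuous_at_imp_continuous_on differentiable_imp_continuous_within)

lemma b_cont: "continuous_on \<O> b"
  using b_diff by (simp add: continuous_at_imp_continuous_on differentiable_imp_continuous_within)

lemma DG_bounded_linear: "v \<in> \<O> \<Longrightarrow> bounded_linear (DG v)"
  by (rule bounded_linear_frechet_derivative[OF G_diff])

lemma q_cont: "continuous_on \<O> (\<lambda>v. q v $ j)"
  using q_deriv[THEN has_derivative_continuous] by (simp add: continuous_at_imp_continuous_on)

lemma G_borel [measurable]: "(\<lambda>x. G (u x)) \<in> borel_measurable borel"
  by (intro borel_comp_continuous_on[OF G_cont] borel_open \<O> u_borel u_in)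

lemma q_borel [measurable]: "(\<lambda>x. q (u x) $ j) \<in> borel_measurable borel"
  by (intro borel_comp_continuous_on[OF q_cont] borel_open \<O> u_borel u_in)

text \<open>A Lipschitz derivative grows at most linearly, hence \<open>G\<close> at most quadratically.  The cubic bound
  fits the integrability of \<open>u\<close>.\<close>

lemma growth:
  obtains CG where "0 < CG" "\<And>v h. v \<in> \<O> \<Longrightarrow> norm (DG v h) \<le> CG * (1 + norm v) * norm h"
    "\<And>v. v \<in> \<O> \<Longrightarrow> norm (G v) \<le> CG * (1 + norm v ^ 3)"
proof -
  let ?v0 = "u 0"
  have v0: "?v0 \<in> \<O>" by (rule u_in)
  define k where "k = onorm (DG ?v0)"
  have k: "norm (DG ?v0 h) \<le> k * norm h" for h
    unfolding k_def by (rule onorm[OF DG_bounded_linear[OF v0]])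
  have k0: "0 \<le> k" unfolding k_def by (rule onorm_pos_le[OF DG_bounded_linear[OF v0]])
  define C1 where "C1 = k + cG * (1 + norm ?v0)"
  have C1: "0 \<le> C1" using k0 cG by (simp add: C1_def)
  have D: "norm (DG v h) \<le> C1 * (1 + norm v) * norm h" if "v \<in> \<O>" for v h
  proof -
    have "norm (DG v h) \<le> norm (DG ?v0 h) + norm (DG v h - DG ?v0 h)"
      by (metis add.commute diff_add_cancel norm_triangle_ineq)
    also have "\<dots> \<le> k * norm h + cG * (norm v + norm ?v0) * norm h"
    proof (intro add_mono k)
      have "cG * norm (v - ?v0) * norm h \<le> cG * (norm v + norm ?v0) * norm h"
        using cG norm_triangle_ineq4[of v ?v0] by (intro mult_right_mono mult_left_mono) auto
      then show "norm (DG v h - DG ?v0 h) \<le> cG * (norm v + norm ?v0) * norm h"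
        using DG_lipschitz[OF v0 that, of h] by linarith
    qed
    also have "\<dots> \<le> (k + cG * (1 + norm ?v0)) * (1 + norm v) * norm h"
    proof -
      have "k + cG * (norm v + norm ?v0) \<le> (k + cG * (1 + norm ?v0)) * (1 + norm v)"
        using k0 cG by (simp add: algebra_simps)
      then show ?thesis by (metis distrib_right mult_right_mono norm_ge_zero)
    qed
    finally show ?thesis by (simp add: C1_def)
  qed
  define C2 where "C2 = norm (G ?v0) + (k + cG) * (1 + 4 * norm ?v0 ^ 3) + 4 * (k + cG)"
  have C2: "0 \<le> C2" using k0 cG by (simp add: C2_def)
  have G: "norm (G v) \<le> C2 * (1 + norm v ^ 3)" if "v \<in> \<O>" for v
  proof -
    let ?y = "norm v + norm ?v0"
    have "norm (G v) \<le> norm (G ?v0) + norm (DG ?v0 (v - ?v0)) + norm (G v - G ?v0 - DG ?v0 (v - ?v0))"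
      by norm
    also have "\<dots> \<le> norm (G ?v0) + k * norm (v - ?v0) + cG * (norm (v - ?v0))\<^sup>2"
      using k G_Taylor[OF v0 that] by (intro add_mono) auto
    also have "\<dots> \<le> norm (G ?v0) + k * ?y + cG * ?y\<^sup>2"
      using norm_triangle_ineq4[of v ?v0] k0 cG by (intro add_mono mult_left_mono power_mono) auto
    also have "\<dots> \<le> norm (G ?v0) + k * (1 + ?y ^ 3) + cG * (1 + ?y ^ 3)"
      using k0 cG by (intro add_mono mult_left_mono le_one_plus_cube square_le_one_plus_cube) auto
    also have "\<dots> = norm (G ?v0) + (k + cG) * (1 + ?y ^ 3)" by (simp add: algebra_simps)
    also have "\<dots> \<le> norm (G ?v0) + (k + cG) * (1 + 4 * (norm v ^ 3 + norm ?v0 ^ 3))"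
      using k0 cG by (intro add_left_mono mult_left_mono power3_add_le) auto
    also have "\<dots> = norm (G ?v0) + (k + cG) * (1 + 4 * norm ?v0 ^ 3) + 4 * (k + cG) * norm v ^ 3"
      by (simp add: algebra_simps)
    also have "\<dots> \<le> C2 * 1 + C2 * norm v ^ 3"
      using k0 cG by (intro add_mono mult_right_mono) (auto simp: C2_def)
    finally show ?thesis by (simp add: distrib_left)
  qed
  show thesis
  proof (rule that[of "1 + C1 + C2"])
    show "0 < 1 + C1 + C2" using C1 C2 by simp
    show "norm (DG v h) \<le> (1 + C1 + C2) * (1 + norm v) * norm h" if "v \<in> \<O>" for v h
      by (rule order_trans[OF D[OF that]]) (use C1 C2 in \<open>auto intro!: mult_right_mono\<close>)
    show "norm (G v) \<le> (1 + C1 + C2) * (1 + norm v ^ 3)" if "v \<in> \<O>" for v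
      by (rule order_trans[OF G[OF that]]) (use C1 C2 in \<open>auto intro!: mult_right_mono\<close>)
  qed
qed

text \<open>The derivative of \<open>q\<close> is \<open>b DG\<close> with bounded \<open>b\<close>, so it grows at most linearly along the
  segment from \<open>v\<close> to \<open>w\<close>.\<close>

lemma q_increment:
  obtains Cq where "0 < Cq" "\<And>v w j. v \<in> \<O> \<Longrightarrow> w \<in> \<O> \<Longrightarrow>
    \<bar>q w $ j - q v $ j\<bar> \<le> Cq * (1 + norm v + norm (w - v)) * norm (w - v)"
proof -
  obtain CG where CG: "0 < CG" "\<And>v h. v \<in> \<O> \<Longrightarrow> norm (DG v h) \<le> CG * (1 + norm v) * norm h"
    using growth by metis
  define C where "C = real CARD('n) * (Cb * CG)"
  have C: "0 \<le> C" using CG Cb by (simp add: C_def)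
  have "\<bar>q w $ j - q v $ j\<bar> \<le> C * (1 + norm v + norm (w - v)) * norm (w - v)"
    if vw: "v \<in> \<O>" "w \<in> \<O>" for v w j
  proof -
    have seg: "closed_segment v w \<subseteq> \<O>" using vw \<O> by (simp add: closed_segment_subset)
    have "norm (q w $ j - q v $ j) \<le> (C * (1 + norm v + norm (w - v))) * norm (w - v)"
    proof (rule differentiable_bound[of "closed_segment v w"])
      fix x assume x: "x \<in> closed_segment v w"
      then have xO: "x \<in> \<O>" using seg by auto
      show "((\<lambda>v. q v $ j) has_derivative (\<lambda>h. \<Sum>i\<in>UNIV. b x $ i * DG x h $ i $ j)) (at x within closed_segment v w)"
        by (rule has_derivative_at_withinI[OF q_deriv[OF xO]])
      show "onorm (\<lambda>h. \<Sum>i\<in>UNIV. b x $ i * DG x h $ i $ j) \<le> C * (1 + norm v + norm (w - v))"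
      proof (rule onorm_le)
        fix h
        have "norm (\<Sum>i\<in>UNIV. b x $ i * DG x h $ i $ j) \<le> (\<Sum>i\<in>(UNIV::'n set). Cb * norm (DG x h))"
        proof (rule sum_norm_le)
          fix i
          have "\<bar>DG x h $ i $ j\<bar> \<le> norm (DG x h)"
            using component_le_norm_cart[of "DG x h $ i" j] Finite_Cartesian_Product.norm_nth_le[of "DG x h" i] by simp
          then show "norm (b x $ i * DG x h $ i $ j) \<le> Cb * norm (DG x h)"
            using component_le_norm_cart[of "b x" i] Cb(2)[OF xO] Cb(1)
            by (auto simp: abs_mult intro!: mult_mono)
        qed
        also have "\<dots> = real CARD('n) * (Cb * norm (DG x h))" by simp
        also have "\<dots> \<le> real CARD('n) * (Cb * (CG * (1 + norm x) * norm h))"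
          using CG(2)[OF xO] Cb(1) by (intro mult_left_mono) auto
        also have "\<dots> = C * (1 + norm x) * norm h" by (simp add: C_def)
        also have "\<dots> \<le> C * (1 + norm v + norm (w - v)) * norm h"
        proof -
          have "norm x \<le> norm v + norm (x - v)" by norm
          then have "1 + norm x \<le> 1 + norm v + norm (w - v)" using segment_bound(1)[OF x] by simp
          then show ?thesis using C by (intro mult_right_mono mult_left_mono) auto
        qed
        finally show "norm (\<Sum>i\<in>UNIV. b x $ i * DG x h $ i $ j) \<le> C * (1 + norm v + norm (w - v)) * norm h" .
      qed
    qed auto
    then show ?thesis by simp
  qed
  then have "\<bar>q w $ j - q v $ j\<bar> \<le> (C + 1) * (1 + norm v + norm (w - v)) * norm (w - v)"
    if vw: "v \<in> \<O>" "w \<in> \<O>" for v w j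
    by (rule order_trans) (use vw in \<open>auto intro!: mult_right_mono\<close>)
  with C show thesis by (intro that[of "C + 1"]) auto
qed

lemma ball_integrable_comp:
  fixes F :: "real^'n \<Rightarrow> 'c::euclidean_space"
  assumes "(\<lambda>x. F (u x)) \<in> borel_measurable borel" and F: "\<And>v. v \<in> \<O> \<Longrightarrow> norm (F v) \<le> C * (1 + norm v ^ 3)"
    and r: "r \<le> r0"
  shows "ball_integrable (2 * r) (\<lambda>x. F (u x))"
  unfolding ball_integrable_def
proof (intro conjI allI)
  note [measurable] = assms(1)
  fix x
  show "set_integrable lborel (ball x (2 * r)) (\<lambda>x. F (u x))"
    unfolding set_integrable_def
  proof (rule integrable_dominated)
    have "integrable lborel (indicator (ball x (2 * r0)) :: _ \<Rightarrow> real)"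
      using emeasure_bounded_finite[OF bounded_ball, of x "2 * r0"] by (simp add: integrable_indicator_iff)
    then show "integrable lborel (\<lambda>y. C * (indicator (ball x (2 * r0)) y + indicator (ball x (2 * r0)) y *\<^sub>R norm (u y) ^ 3))"
      using u_ball[of x] unfolding set_integrable_def by (intro integrable_mult_right Bochner_Integration.integrable_add)
    show "norm (indicator (ball x (2 * r)) y *\<^sub>R F (u y))
        \<le> norm (C * (indicator (ball x (2 * r0)) y + indicator (ball x (2 * r0)) y *\<^sub>R norm (u y) ^ 3))" for y
    proof (cases "y \<in> ball x (2 * r)")
      case True
      then have "y \<in> ball x (2 * r0)" using r by simp
      with True show ?thesis using order_trans[OF F[OF u_in[of y]] abs_ge_self] by (simp add: abs_mult)
    qed simp
    have "ball x (2 * r) \<in> sets borel" by simp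
    then show "(\<lambda>y. indicator (ball x (2 * r)) y *\<^sub>R F (u y)) \<in> borel_measurable lborel" by measurable
  qed
qed (fact assms(1))

lemma ball_integrable_u: "r \<le> r0 \<Longrightarrow> ball_integrable (2 * r) u"
  by (rule ball_integrable_comp[of "\<lambda>v. v" 1]) (auto intro: le_one_plus_cube)

lemma ball_integrable_G: "r \<le> r0 \<Longrightarrow> ball_integrable (2 * r) (\<lambda>x. G (u x))"
  using growth ball_integrable_comp[OF G_borel] by metis

end

section \<open>Mollification and its pointwise estimates\<close>

text \<open>Splits \<open>|q(V) - q(u)|\<close>, with \<open>x = |u|\<close> and \<open>d = |V - u|\<close>, into a part that is small because of
  the factor \<open>sqrt \<epsilon>\<close> and one that is controlled by the third moment; the loss \<open>1 / \<epsilon>\<close> in the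
  latter is the one that the commutator term has anyway.\<close>

lemma two_scale_bound:
  fixes x d \<epsilon> :: real
  assumes "0 \<le> x" "0 \<le> d" "0 < \<epsilon>" "\<epsilon> \<le> 1"
  shows "(1 + x + d) * d \<le> 17 * (sqrt \<epsilon> * (1 + x ^ 3) + d ^ 3 / \<epsilon>)"
proof -
  define s where "s = sqrt \<epsilon>"
  have s: "0 < s" "s \<le> 1" "s * s = \<epsilon>" using assms by (auto simp: s_def)
  let ?g = "1 + x + d"
  have g: "1 \<le> ?g" using assms by simp
  \<comment> \<open>arithmetic-geometric mean inequality with weight \<open>s\<close>\<close>
  have "0 \<le> (s * ?g - d)\<^sup>2 / s" using s by simp
  also have "\<dots> = s * ?g\<^sup>2 - 2 * (?g * d) + d\<^sup>2 / s"
    using s by (simp add: field_simps power2_eq_square)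
  finally have 1: "2 * (?g * d) \<le> s * ?g\<^sup>2 + d\<^sup>2 / s" by simp
  have 2: "d\<^sup>2 / s \<le> d ^ 3 / \<epsilon> + s"
  proof (cases "d \<le> s")
    case True
    then have "d * d \<le> s * s" using assms by (intro mult_mono) auto
    then have "d\<^sup>2 / s \<le> s" using s by (simp add: power2_eq_square divide_le_eq)
    moreover have "0 \<le> d ^ 3 / \<epsilon>" using assms by simp
    ultimately show ?thesis by linarith
  next
    case False
    then have "d\<^sup>2 * s \<le> d\<^sup>2 * d" by (intro mult_left_mono) auto
    then have "d\<^sup>2 * s / (s * s) \<le> d ^ 3 / (s * s)"
      using s by (intro divide_right_mono) (auto simp: power2_eq_square power3_eq_cube)
    moreover have "d\<^sup>2 / s = d\<^sup>2 * s / (s * s)" using s(1) by simp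
    ultimately have "d\<^sup>2 / s \<le> d ^ 3 / (s * s)" by simp
    then show ?thesis using s by simp
  qed
  have "?g\<^sup>2 \<le> ?g ^ 3" using g by (intro power_increasing) auto
  also have "\<dots> \<le> 4 * ((1 + x) ^ 3 + d ^ 3)" using assms by (intro power3_add_le) auto
  also have "\<dots> \<le> 4 * (4 * (1 ^ 3 + x ^ 3) + d ^ 3)"
    using assms power3_add_le[of 1 x] by simp
  finally have "s * ?g\<^sup>2 \<le> s * (16 * (1 + x ^ 3) + 4 * d ^ 3)" using s by (intro mult_left_mono) auto
  also have "\<dots> = 16 * (s * (1 + x ^ 3)) + 4 * (s * d ^ 3)" by (simp add: algebra_simps)
  finally have 3: "s * ?g\<^sup>2 \<le> 16 * (s * (1 + x ^ 3)) + 4 * (s * d ^ 3)" .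
  have "s * d ^ 3 \<le> 1 * d ^ 3" using s assms by (intro mult_right_mono) auto
  also have "d ^ 3 \<le> d ^ 3 / \<epsilon>" using assms by (simp add: le_divide_eq mult_left_le)
  finally have 4: "s * d ^ 3 \<le> d ^ 3 / \<epsilon>" by simp
  have 5: "s \<le> s * (1 + x ^ 3)" using s assms by simp
  have "0 \<le> s * (1 + x ^ 3)" "0 \<le> d ^ 3 / \<epsilon>" using s assms by auto
  with 1 2 3 4 5 show ?thesis unfolding s_def[symmetric] distrib_left by linarith
qed

lemma convol_bounded_linear:
  assumes "bounded_linear L" "bump_within r \<rho>" "ball_integrable (2 * r) f" "0 < r"
  shows "L (convol \<rho> f x) = convol \<rho> (\<lambda>x. L (f x)) x"
proof -
  have "L (convol \<rho> f x) = (LINT y|lborel. L (\<rho> (x - y) *\<^sub>R f y))"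
    unfolding convol_def
    by (rule integral_bounded_linear[OF assms(1) convol_integrable_ball[OF assms(2-4)], symmetric])
  then show ?thesis
    unfolding convol_def by (simp add: linear_scale[OF bounded_linear.linear[OF assms(1)]])
qed

lemma ball_integrable_bounded:
  fixes f :: "'a::euclidean_space \<Rightarrow> 'b::euclidean_space"
  assumes f: "f \<in> borel_measurable borel" "\<And>x. norm (f x) \<le> M"
  shows "ball_integrable r f"
  unfolding ball_integrable_def set_integrable_def
proof (intro conjI allI f(1))
  fix x
  show "integrable lborel (\<lambda>y. indicator (ball x r) y *\<^sub>R f y)"
  proof (rule integrable_dominated)
    show "integrable lborel (\<lambda>y. M * indicator (ball x r) y)"
      using emeasure_bounded_finite[OF bounded_ball, of x r] by (simp add: integrable_indicator_iff)
    show "norm (indicator (ball x r) y *\<^sub>R f y) \<le> norm (M * indicator (ball x r) y)" for y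
      using order_trans[OF f(2)[of y] abs_ge_self] by (auto simp: indicator_def)
    have "ball x r \<in> sets borel" by simp
    then show "(\<lambda>y. indicator (ball x r) y *\<^sub>R f y) \<in> borel_measurable lborel" using f(1) by measurable
  qed
qed

locale mollified_law = companion_law per u \<O> G b q \<psi> K r0 \<delta> A \<alpha> cG Cb
  for per :: "'m::finite \<Rightarrow> real" and u :: "real^'m \<Rightarrow> real^'n::finite" and \<O> G b q \<psi> K r0 \<delta> A \<alpha> cG Cb +
  fixes \<epsilon> c :: real and \<eta> :: "real^'m \<Rightarrow> real"
  assumes \<epsilon>: "0 < \<epsilon>" "\<epsilon> \<le> 1" "\<epsilon> \<le> \<delta>" "\<epsilon> \<le> r0" and c: "0 < c"
    and \<eta>: "mollifier c \<epsilon> \<eta>"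
begin

lemma \<eta>_smooth: "C_on m \<eta> UNIV" and \<eta>_nonneg: "0 \<le> \<eta> w" and \<eta>_even: "\<eta> (- w) = \<eta> w"
  and \<eta>_support: "\<epsilon> \<le> norm w \<Longrightarrow> \<eta> w = 0"
  and \<eta>_integrable: "integrable lborel \<eta>" and \<eta>_integral: "(LINT w|lborel. \<eta> w) = 1"
  and \<eta>_le: "\<eta> w \<le> c * ball_density \<epsilon> w"
  and D\<eta>_le: "i \<in> Basis \<Longrightarrow> \<bar>partial_deriv i \<eta> w\<bar> \<le> c / \<epsilon> * ball_density \<epsilon> w"
  using \<eta> unfolding mollifier_def by blast+

abbreviation "\<beta> \<equiv> ball_density \<epsilon> :: real^'m \<Rightarrow> real"
abbreviation "V \<equiv> convol \<eta> u"
abbreviation "W \<equiv> convol \<eta> (\<lambda>x. G (u x))"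
abbreviation "E x \<equiv> G (V x) - W x"
abbreviation "incr x w \<equiv> norm (u (x - w) - u x)"
abbreviation "D\<eta> j \<equiv> partial_deriv (axis j 1) \<eta>"
definition "moment p x = (LINT w|lborel. \<beta> w * incr x w ^ p)"

lemma bump: "bump_within \<epsilon> \<eta>"
  using \<eta>_smooth \<eta>_support by (auto simp: bump_within_def)

lemma bump_D: "bump_within \<epsilon> (D\<eta> j)"
  by (rule bump_within_partial[OF bump]) simp

lemma \<eta>_borel [measurable]: "\<eta> \<in> borel_measurable borel" "D\<eta> j \<in> borel_measurable borel"
  using bump_within_measurable[OF bump] bump_within_measurable[OF bump_D] .

lemma incr_cube_integrable: "integrable lborel (\<lambda>w. \<beta> w * incr x w ^ 3)"
proof (rule Bochner_Integration.integrable_bound)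
  have "integrable lborel (\<lambda>w. (4 * \<beta> w) *\<^sub>R norm (u (x - w)) ^ 3)"
    using u_ball[of x] \<epsilon> r0
    by (intro kernel_integrable[of _ 4 \<epsilon> "\<lambda>y. norm (u y) ^ 3" x "2 * r0"]) (auto simp: ball_density_nonneg)
  then show "integrable lborel (\<lambda>w. 4 * \<beta> w * norm (u (x - w)) ^ 3 + 4 * norm (u x) ^ 3 * \<beta> w)"
    using ball_density_integral(1)[OF \<epsilon>(1)] by auto
  have "\<beta> w * incr x w ^ 3 \<le> 4 * \<beta> w * norm (u (x - w)) ^ 3 + 4 * norm (u x) ^ 3 * \<beta> w" for w
  proof -
    have "incr x w ^ 3 \<le> (norm (u (x - w)) + norm (u x)) ^ 3"
      by (intro power_mono norm_triangle_ineq4) auto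
    also have "\<dots> \<le> 4 * (norm (u (x - w)) ^ 3 + norm (u x) ^ 3)" by (intro power3_add_le) auto
    finally have "\<beta> w * incr x w ^ 3 \<le> \<beta> w * (4 * (norm (u (x - w)) ^ 3 + norm (u x) ^ 3))"
      by (intro mult_left_mono ball_density_nonneg)
    then show ?thesis by (simp add: algebra_simps)
  qed
  then show "AE w in lborel. norm (\<beta> w * incr x w ^ 3)
      \<le> norm (4 * \<beta> w * norm (u (x - w)) ^ 3 + 4 * norm (u x) ^ 3 * \<beta> w)"
    using ball_density_nonneg[of \<epsilon>, where ?'a = "real^'m"]
    by (intro AE_I2) (simp add: order_trans[OF _ abs_ge_self])
qed measurable

lemma moment_facts:
  "integrable lborel (\<lambda>w. \<beta> w * incr x w)" "integrable lborel (\<lambda>w. \<beta> w * (incr x w)\<^sup>2)"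
  "0 \<le> moment 1 x" "0 \<le> moment 2 x" "0 \<le> moment 3 x" "moment 1 x * moment 2 x \<le> moment 3 x"
  "(moment 1 x)\<^sup>2 \<le> moment 2 x" "(moment 1 x) ^ 3 \<le> moment 3 x"
  "moment 2 x \<le> moment 3 x / \<epsilon> + \<epsilon>\<^sup>2"
proof -
  have m: "(\<lambda>w. incr x w) \<in> borel_measurable lborel" by measurable
  note * = weighted_moments[OF ball_density_nonneg ball_density_integral[OF \<epsilon>(1)] norm_ge_zero m incr_cube_integrable]
  from *(1-8) *(9)[OF \<epsilon>(1)]
  show "integrable lborel (\<lambda>w. \<beta> w * incr x w)" "integrable lborel (\<lambda>w. \<beta> w * (incr x w)\<^sup>2)"
  "0 \<le> moment 1 x" "0 \<le> moment 2 x" "0 \<le> moment 3 x" "moment 1 x * moment 2 x \<le> moment 3 x"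
  "(moment 1 x)\<^sup>2 \<le> moment 2 x" "(moment 1 x) ^ 3 \<le> moment 3 x"
  "moment 2 x \<le> moment 3 x / \<epsilon> + \<epsilon>\<^sup>2"
    by (simp_all add: moment_def)
qed

text \<open>Besov regularity, averaged over the ball of radius \<open>\<epsilon>\<close>.\<close>

lemma moment3_bound:
  "integrable (cell_measure per) (\<lambda>x. indicator S x * moment 3 x)"
  "(LINT x|cell_measure per. indicator S x * moment 3 x) \<le> A * \<epsilon> powr (3 * \<alpha>)"
proof -
  note [measurable] = orbit_borel[OF K]
  let ?p = "\<lambda>w x. indicator S x * incr x w ^ 3 :: real"
  have le: "(LINT x|cell_measure per. ?p w x) \<le> A * \<epsilon> powr (3 * \<alpha>)" if "norm w \<le> \<epsilon>" for w
  proof -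
    have "norm w powr (3 * \<alpha>) \<le> \<epsilon> powr (3 * \<alpha>)" using that \<alpha> by (intro powr_mono2) auto
    then have "A * norm w powr (3 * \<alpha>) \<le> A * \<epsilon> powr (3 * \<alpha>)" using A by (rule mult_left_mono)
    with besov(2)[of w] that \<epsilon> show ?thesis by auto
  qed
  have p: "(\<lambda>(w, x). ?p w x) \<in> borel_measurable (borel \<Otimes>\<^sub>M borel)" by measurable
  have z: "\<beta> w = 0" if "\<epsilon> < norm w" for w using that by (simp add: ball_density_eq_0)
  have eq: "(LINT w|lborel. \<beta> w * ?p w x) = indicator S x * moment 3 x" for x
    unfolding moment_def integral_mult_right_zero[symmetric] by (simp only: mult.left_commute)
  have i: "integrable (cell_measure per) (?p w)" if "norm w \<le> \<epsilon>" for w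
    using besov(1)[of w] that \<epsilon> by auto
  have l: "(LINT x|cell_measure per. \<bar>?p w x\<bar>) \<le> A * \<epsilon> powr (3 * \<alpha>)" if "norm w \<le> \<epsilon>" for w
    using le[OF that] by (simp add: abs_mult)
  have F: "integrable (cell_measure per) (\<lambda>x. LINT w|lborel. \<beta> w * ?p w x)"
    "(LINT x|cell_measure per. LINT w|lborel. \<beta> w * ?p w x)
       = (LINT w|lborel. \<beta> w * (LINT x|cell_measure per. ?p w x))"
    by (rule kernel_Fubini[where r = \<epsilon> and A = "A * \<epsilon> powr (3 * \<alpha>)"];
        fact per ball_density_integral(1)[OF \<epsilon>(1)] z p i l)+
  show "integrable (cell_measure per) (\<lambda>x. indicator S x * moment 3 x)"
    using F(1) by (simp only: eq)
  have "(LINT x|cell_measure per. indicator S x * moment 3 x) = (LINT w|lborel. \<beta> w * (LINT x|cell_measure per. ?p w x))"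
    using F(2) by (simp only: eq)
  also have "\<dots> \<le> (LINT w|lborel. \<beta> w * (A * \<epsilon> powr (3 * \<alpha>)))"
  proof (rule integral_mono')
    show "integrable lborel (\<lambda>w. \<beta> w * (A * \<epsilon> powr (3 * \<alpha>)))"
      by (intro integrable_mult_left ball_density_integral(1)[OF \<epsilon>(1)])
    show "\<beta> w * (LINT x|cell_measure per. ?p w x) \<le> \<beta> w * (A * \<epsilon> powr (3 * \<alpha>))" for w
      using le[of w] z[of w] ball_density_nonneg[of \<epsilon> w]
      by (cases "norm w \<le> \<epsilon>") (auto intro: mult_left_mono)
    show "0 \<le> \<beta> w * (A * \<epsilon> powr (3 * \<alpha>))" for w
      using A ball_density_nonneg[of \<epsilon> w] by auto
  qed
  also have "\<dots> = A * \<epsilon> powr (3 * \<alpha>)"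
    using ball_density_integral(2)[OF \<epsilon>(1), where ?'a = "real^'m"] by (simp only: integral_mult_left_zero mult_1_left)
  finally show "(LINT x|cell_measure per. indicator S x * moment 3 x) \<le> A * \<epsilon> powr (3 * \<alpha>)" .
qed

lemma int_u: "integrable lborel (\<lambda>w. \<eta> w *\<^sub>R u (x - w))"
  by (rule convol_integrable_reflected[OF bump ball_integrable_u[OF \<epsilon>(4)] \<epsilon>(1)])

lemma int_G: "integrable lborel (\<lambda>w. \<eta> w *\<^sub>R G (u (x - w)))"
  by (rule convol_integrable_reflected[OF bump ball_integrable_G[OF \<epsilon>(4)] \<epsilon>(1)])

lemma V_eq: "V x = (LINT w|lborel. \<eta> w *\<^sub>R u (x - w))"
  by (rule convol_eq[OF bump u_borel])

lemma V_in: "V x \<in> \<O>"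
  unfolding V_eq by (rule open_convex_mean[OF \<O> u_in \<eta>_nonneg \<eta>_integrable \<eta>_integral int_u])

lemma V_minus_u: "norm (V x - u x) \<le> c * moment 1 x"
proof -
  have "V x - u x = (LINT w|lborel. \<eta> w *\<^sub>R u (x - w)) - (LINT w|lborel. \<eta> w *\<^sub>R u x)"
    using \<eta>_integrable by (simp add: V_eq \<eta>_integral)
  also have "\<dots> = (LINT w|lborel. \<eta> w *\<^sub>R (u (x - w) - u x))"
    using int_u \<eta>_integrable by (simp add: scaleR_diff_right)
  also have "norm \<dots> \<le> (LINT w|lborel. c * (\<beta> w * incr x w))"
  proof (rule norm_integral_le)
    show "norm (\<eta> w *\<^sub>R (u (x - w) - u x)) \<le> c * (\<beta> w * incr x w)" for w
      using \<eta>_le[of w] \<eta>_nonneg[of w] by (simp add: mult_right_mono flip: mult.assoc)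
  qed (use moment_facts(1) in simp)
  also have "\<dots> = c * moment 1 x" by (simp add: moment_def)
  finally show ?thesis .
qed

text \<open>The kernel \<open>\<partial>\<^sub>j\<eta>\<close> has mean zero, since convolving \<open>\<eta>\<close> with \<open>1\<close> gives a constant.\<close>

lemma D\<eta>_integral: "integrable lborel (D\<eta> j)" "(LINT w|lborel. D\<eta> j w) = 0"
proof -
  show "integrable lborel (D\<eta> j)" by (rule integrable_bump[OF bump_D])
  have one: "ball_integrable (2 * \<epsilon>) (\<lambda>_::real^'m. 1::real)"
    by (rule ball_integrable_bounded[of _ 1]) auto
  have "convol \<eta> (\<lambda>_. 1::real) = (\<lambda>_. 1)"
    by (rule ext) (simp add: convol_eq[OF bump] \<eta>_integral)
  then have "partial_deriv (axis j 1) (convol \<eta> (\<lambda>_. 1::real)) 0 = 0"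
    by (simp add: partial_deriv_def)
  then show "(LINT w|lborel. D\<eta> j w) = 0"
    by (simp add: partial_deriv_convol[OF bump one \<epsilon>(1)] convol_eq[OF bump_D])
qed

text \<open>Since the kernel has mean zero, \<open>u x\<close> can be subtracted under the integral.\<close>

lemma DV_le: "norm (convol (D\<eta> j) u x) \<le> c / \<epsilon> * moment 1 x"
proof -
  have i: "integrable lborel (\<lambda>w. D\<eta> j w *\<^sub>R u (x - w))"
    by (rule convol_integrable_reflected[OF bump_D ball_integrable_u[OF \<epsilon>(4)] \<epsilon>(1)])
  have "convol (D\<eta> j) u x = (LINT w|lborel. D\<eta> j w *\<^sub>R u (x - w)) - (LINT w|lborel. D\<eta> j w *\<^sub>R u x)"
    using D\<eta>_integral[of j] by (simp add: convol_eq[OF bump_D])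
  also have "\<dots> = (LINT w|lborel. D\<eta> j w *\<^sub>R (u (x - w) - u x))"
    using i D\<eta>_integral(1)[of j] by (simp add: scaleR_diff_right)
  also have "norm \<dots> \<le> (LINT w|lborel. c / \<epsilon> * (\<beta> w * incr x w))"
  proof (rule norm_integral_le)
    show "norm (D\<eta> j w *\<^sub>R (u (x - w) - u x)) \<le> c / \<epsilon> * (\<beta> w * incr x w)" for w
      using mult_right_mono[OF D\<eta>_le[of "axis j 1" w], of "incr x w"] by (simp add: mult.assoc)
  qed (use moment_facts(1) in simp)
  also have "\<dots> = c / \<epsilon> * moment 1 x" by (simp add: moment_def)
  finally show ?thesis .
qed

text \<open>The commutator is quadratic in the increments: expand \<open>G\<close> at \<open>V x\<close>; the mean of the
  linear term vanishes because \<open>V x\<close> is the mean of \<open>u\<close>.\<close>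

lemma E_le: "norm (E x) \<le> 2 * cG * c * (1 + c\<^sup>2) * moment 2 x"
proof -
  let ?L = "DG (V x)"
  interpret L: bounded_linear ?L by (rule DG_bounded_linear[OF V_in])
  have i1: "integrable lborel (\<lambda>w. \<eta> w *\<^sub>R (u (x - w) - V x))"
    using int_u \<eta>_integrable by (simp add: scaleR_diff_right)
  have "(LINT w|lborel. \<eta> w *\<^sub>R (u (x - w) - V x)) = 0"
    using int_u \<eta>_integrable by (simp add: scaleR_diff_right V_eq \<eta>_integral)
  then have L0: "(LINT w|lborel. ?L (\<eta> w *\<^sub>R (u (x - w) - V x))) = 0"
    by (simp add: integral_bounded_linear[OF L.bounded_linear_axioms i1] L.zero)
  have L1: "integrable lborel (\<lambda>w. ?L (\<eta> w *\<^sub>R (u (x - w) - V x)))"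
    by (rule integrable_bounded_linear[OF L.bounded_linear_axioms i1])
  let ?T = "\<lambda>w. G (u (x - w)) - G (V x) - ?L (u (x - w) - V x)"
  have "W x - G (V x) = (LINT w|lborel. \<eta> w *\<^sub>R G (u (x - w))) - (LINT w|lborel. \<eta> w *\<^sub>R G (V x))
      - (LINT w|lborel. ?L (\<eta> w *\<^sub>R (u (x - w) - V x)))"
    using \<eta>_integrable by (simp add: convol_eq[OF bump G_borel] \<eta>_integral L0)
  also have "\<dots> = (LINT w|lborel. \<eta> w *\<^sub>R G (u (x - w)) - \<eta> w *\<^sub>R G (V x) - ?L (\<eta> w *\<^sub>R (u (x - w) - V x)))"
    using int_G \<eta>_integrable L1 by simp
  also have "\<dots> = (LINT w|lborel. \<eta> w *\<^sub>R ?T w)"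
    by (simp only: L.scaleR, simp only: scaleR_diff_right)
  finally have eq: "W x - G (V x) = (LINT w|lborel. \<eta> w *\<^sub>R ?T w)" .
  have "norm (W x - G (V x)) \<le> (LINT w|lborel. cG * c * (2 * (\<beta> w * (incr x w)\<^sup>2) + 2 * (c * moment 1 x)\<^sup>2 * \<beta> w))"
    unfolding eq
  proof (rule norm_integral_le)
    show "integrable lborel (\<lambda>w. cG * c * (2 * (\<beta> w * (incr x w)\<^sup>2) + 2 * (c * moment 1 x)\<^sup>2 * \<beta> w))"
      using moment_facts(2) ball_density_integral(1)[OF \<epsilon>(1)]
      by (intro integrable_mult_right Bochner_Integration.integrable_add)
    fix w
    have "norm (u (x - w) - V x) \<le> incr x w + c * moment 1 x"
    proof -
      have "norm (u (x - w) - V x) \<le> incr x w + norm (V x - u x)" by norm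
      then show ?thesis using V_minus_u[of x] by simp
    qed
    then have "(norm (u (x - w) - V x))\<^sup>2 \<le> (incr x w + c * moment 1 x)\<^sup>2" by (intro power_mono) auto
    also have "\<dots> \<le> 2 * (incr x w)\<^sup>2 + 2 * (c * moment 1 x)\<^sup>2"
      using zero_le_power2[of "incr x w - c * moment 1 x"] by (simp add: power2_eq_square algebra_simps)
    finally have "norm (?T w) \<le> cG * (2 * (incr x w)\<^sup>2 + 2 * (c * moment 1 x)\<^sup>2)"
      by (rule order_trans[OF G_Taylor[OF V_in u_in] mult_left_mono]) (rule cG)
    then have "\<eta> w * norm (?T w) \<le> (c * \<beta> w) * (cG * (2 * (incr x w)\<^sup>2 + 2 * (c * moment 1 x)\<^sup>2))"
      using \<eta>_le[of w] \<eta>_nonneg[of w] by (intro mult_mono) auto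
    also have "\<dots> = cG * c * (2 * (\<beta> w * (incr x w)\<^sup>2) + 2 * (c * moment 1 x)\<^sup>2 * \<beta> w)"
      by (simp add: algebra_simps)
    finally show "norm (\<eta> w *\<^sub>R ?T w) \<le> cG * c * (2 * (\<beta> w * (incr x w)\<^sup>2) + 2 * (c * moment 1 x)\<^sup>2 * \<beta> w)"
      by (simp only: norm_scaleR abs_of_nonneg[OF \<eta>_nonneg])
  qed
  also have "\<dots> = cG * c * (2 * moment 2 x + 2 * (c * moment 1 x)\<^sup>2)"
  proof -
    have "(LINT w|lborel. 2 * (\<beta> w * (incr x w)\<^sup>2) + 2 * (c * moment 1 x)\<^sup>2 * \<beta> w)
        = (LINT w|lborel. 2 * (\<beta> w * (incr x w)\<^sup>2)) + (LINT w|lborel. 2 * (c * moment 1 x)\<^sup>2 * \<beta> w)"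
      using moment_facts(2) ball_density_integral(1)[OF \<epsilon>(1)]
      by (intro Bochner_Integration.integral_add integrable_mult_right)
    then show ?thesis
      using ball_density_integral(2)[OF \<epsilon>(1), where ?'a = "real^'m"] by (simp add: moment_def)
  qed
  also have "\<dots> \<le> cG * c * (2 * moment 2 x + 2 * (c\<^sup>2 * moment 2 x))"
    using moment_facts(7)[of x] cG c by (intro mult_left_mono add_left_mono) (auto simp: power_mult_distrib)
  also have "\<dots> = 2 * cG * c * (1 + c\<^sup>2) * moment 2 x" by (simp add: algebra_simps)
  finally show ?thesis by (simp add: norm_minus_commute)
qed

end

section \<open>The mollified balance law\<close>

lemma borel_measurable_vec_component:
  fixes f :: "'a \<Rightarrow> 'b::euclidean_space ^ 'n::finite"
  assumes "f \<in> borel_measurable M" shows "(\<lambda>x. f x $ i) \<in> borel_measurable M"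
  using assms by (rule measurable_compose)
    (intro borel_measurable_continuous_onI continuous_on_component continuous_on_id)

context mollified_law
begin

abbreviation "dV x \<equiv> frechet_derivative V (at x)"
abbreviation "dW x \<equiv> frechet_derivative W (at x)"
abbreviation "d\<psi> x \<equiv> frechet_derivative \<psi> (at x)"

lemma V_C1: "C_on m V UNIV"
  by (rule C_on_convol[OF bump ball_integrable_u[OF \<epsilon>(4)] \<epsilon>(1)])

lemma W_C1: "C_on m W UNIV"
  by (rule C_on_convol[OF bump ball_integrable_G[OF \<epsilon>(4)] \<epsilon>(1)])

lemma dV_axis: "dV x (axis j 1) = convol (D\<eta> j) u x"
  using partial_deriv_convol[OF bump ball_integrable_u[OF \<epsilon>(4)] \<epsilon>(1), of "axis j 1" x]
  by (simp add: partial_deriv_def)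

lemma dW_axis: "dW x (axis j 1) = convol (D\<eta> j) (\<lambda>x. G (u x)) x"
  using partial_deriv_convol[OF bump ball_integrable_G[OF \<epsilon>(4)] \<epsilon>(1), of "axis j 1" x]
  by (simp add: partial_deriv_def)

lemma V_deriv: "(V has_derivative dV x) (at x)"
  using V_C1[of 1] by (simp add: frechet_derivative_works)

lemma W_deriv: "(W has_derivative dW x) (at x)"
  using W_C1[of 1] by (simp add: frechet_derivative_works)

lemma \<psi>_deriv: "(\<psi> has_derivative d\<psi> x) (at x)"
  using \<psi>(2) by (simp add: frechet_derivative_works)

lemma C1_continuous: "C_on 1 f UNIV \<Longrightarrow> continuous_on UNIV f"
  using C_on_le[of 0 1 f UNIV] by simp

lemma C1_axis_continuous:
  "C_on 1 f UNIV \<Longrightarrow> continuous_on UNIV (\<lambda>x. frechet_derivative f (at x) (axis (j::'m) (1::real)))"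
  by (auto simp: partial_deriv_def[abs_def])

text \<open>The vector field to which integration by parts is applied.  Subtracting \<open>b(V) E\<close> from \<open>q(V)\<close> in
  advance combines the chain rule for \<open>q(V)\<close> and the integration by parts for the
  commutator term in one step.\<close>

definition "flux j x = \<psi> x * (q (V x) $ j - (\<Sum>i\<in>UNIV. b (V x) $ i * E x $ i $ j))"
definition "dflux j x h =
  \<psi> x * ((\<Sum>i\<in>UNIV. b (V x) $ i * DG (V x) (dV x h) $ i $ j)
     - (\<Sum>i\<in>UNIV. b (V x) $ i * (DG (V x) (dV x h) - dW x h) $ i $ j + Db (V x) (dV x h) $ i * E x $ i $ j))
  + d\<psi> x h * (q (V x) $ j - (\<Sum>i\<in>UNIV. b (V x) $ i * E x $ i $ j))"

lemma flux_deriv: "(flux j has_derivative dflux j x) (at x)"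
proof -
  have hq: "((\<lambda>x. q (V x) $ j) has_derivative (\<lambda>h. \<Sum>i\<in>UNIV. b (V x) $ i * DG (V x) (dV x h) $ i $ j)) (at x)"
    by (rule has_derivative_compose[OF V_deriv q_deriv[OF V_in]])
  have hG: "((\<lambda>x. G (V x)) has_derivative (\<lambda>h. DG (V x) (dV x h))) (at x)"
    by (rule has_derivative_compose[OF V_deriv]) (simp add: G_diff[OF V_in] flip: frechet_derivative_works)
  have hb0: "((\<lambda>x. b (V x)) has_derivative (\<lambda>h. Db (V x) (dV x h))) (at x)"
    by (rule has_derivative_compose[OF V_deriv]) (simp add: b_diff[OF V_in] flip: frechet_derivative_works)
  have hb: "((\<lambda>x. b (V x) $ i) has_derivative (\<lambda>h. Db (V x) (dV x h) $ i)) (at x)" for i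
    by (rule bounded_linear.has_derivative[OF bounded_linear_vec_nth hb0])
  have hE: "((\<lambda>x. E x $ i $ j) has_derivative (\<lambda>h. (DG (V x) (dV x h) - dW x h) $ i $ j)) (at x)" for i
    by (rule bounded_linear.has_derivative[OF bounded_linear_vec_nth])
      (rule bounded_linear.has_derivative[OF bounded_linear_vec_nth has_derivative_diff[OF hG W_deriv]])
  show ?thesis
    unfolding flux_def[abs_def] dflux_def[abs_def]
    by (intro has_derivative_mult \<psi>_deriv has_derivative_diff hq has_derivative_sum hb hE)
qed

lemma Db_continuous: "continuous_on UNIV (\<lambda>x. Db (V x) (dV x (axis j 1)))"
proof -
  have "continuous_on UNIV (\<lambda>x. \<Sum>i\<in>Basis. (dV x (axis j 1) \<bullet> i) *\<^sub>R partial_deriv i b (V x))"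
  proof (intro continuous_on_sum continuous_on_scaleR continuous_on_inner continuous_on_const
      C1_axis_continuous V_C1)
    fix i :: "real^'n" assume "i \<in> Basis"
    then have "continuous_on \<O> (partial_deriv i b)" using b by simp
    then show "continuous_on UNIV (\<lambda>x. partial_deriv i b (V x))"
      by (rule continuous_on_compose2[OF _ C1_continuous[OF V_C1]]) (use V_in in auto)
  qed
  then show ?thesis
    by (simp add: frechet_derivative_eq_sum_partial[OF b_diff[OF V_in]])
qed

lemma comp_V_continuous: "continuous_on \<O> f \<Longrightarrow> continuous_on UNIV (\<lambda>x. f (V x))"
  by (rule continuous_on_compose2[OF _ C1_continuous[OF V_C1]]) (use V_in in auto)

text \<open>The derivative of \<open>G(V)\<close> occurs once through \<open>q(V)\<close> and once through \<open>E\<close>, and cancels by the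
  companion relation; only the derivative of \<open>W\<close> is left.\<close>

lemma dflux_axis: "dflux j x (axis j 1) =
   d\<psi> x (axis j 1) * q (V x) $ j + (\<Sum>i\<in>UNIV. \<psi> x * b (V x) $ i * dW x (axis j 1) $ i $ j)
   - (\<Sum>i\<in>UNIV. (d\<psi> x (axis j 1) * b (V x) $ i + \<psi> x * Db (V x) (dV x (axis j 1)) $ i) * E x $ i $ j)"
proof -
  let ?e = "axis j (1::real)"
  have "(\<Sum>i\<in>UNIV. b (V x) $ i * (DG (V x) (dV x ?e) - dW x ?e) $ i $ j + Db (V x) (dV x ?e) $ i * E x $ i $ j)
      = (\<Sum>i\<in>UNIV. b (V x) $ i * DG (V x) (dV x ?e) $ i $ j) - (\<Sum>i\<in>UNIV. b (V x) $ i * dW x ?e $ i $ j)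
        + (\<Sum>i\<in>UNIV. Db (V x) (dV x ?e) $ i * E x $ i $ j)"
    by (simp only: vector_minus_component right_diff_distrib sum.distrib sum_subtractf)
  then have "dflux j x ?e = \<psi> x * ((\<Sum>i\<in>UNIV. b (V x) $ i * dW x ?e $ i $ j)
        - (\<Sum>i\<in>UNIV. Db (V x) (dV x ?e) $ i * E x $ i $ j))
      + d\<psi> x ?e * (q (V x) $ j - (\<Sum>i\<in>UNIV. b (V x) $ i * E x $ i $ j))"
    by (simp only: dflux_def) simp
  also have "\<dots> = d\<psi> x ?e * q (V x) $ j + \<psi> x * (\<Sum>i\<in>UNIV. b (V x) $ i * dW x ?e $ i $ j)
      - (d\<psi> x ?e * (\<Sum>i\<in>UNIV. b (V x) $ i * E x $ i $ j) + \<psi> x * (\<Sum>i\<in>UNIV. Db (V x) (dV x ?e) $ i * E x $ i $ j))"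
    by (simp only: right_diff_distrib)
  finally show ?thesis
    by (simp only: sum_distrib_left distrib_right sum.distrib mult.assoc)
qed

lemma dflux_continuous: "continuous_on UNIV (\<lambda>x. dflux j x (axis j 1))"
proof -
  have [continuous_intros]: "continuous_on UNIV E"
    by (intro continuous_on_diff comp_V_continuous G_cont C1_continuous[OF W_C1])
  show ?thesis
    unfolding dflux_axis
    by (intro continuous_on_add continuous_on_diff continuous_on_mult continuous_on_sum
        continuous_on_component C1_axis_continuous \<psi>(2) V_C1 W_C1 C1_continuous[OF \<psi>(2)] Db_continuous
        comp_V_continuous q_cont b_cont \<open>continuous_on UNIV E\<close>)
qed

lemma V_periodic: "periodic per V"
  using u_periodic convol_translate[OF bump u_borel] by (simp add: periodic_def)

lemma W_periodic: "periodic per W"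
  using u_periodic convol_translate[OF bump G_borel] by (simp add: periodic_def)

lemma flux_periodic: "periodic per (flux j)"
  using V_periodic W_periodic \<psi>(1) by (simp add: periodic_def flux_def)

lemma dflux_integral:
  "integrable (cell_measure per) (\<lambda>x. dflux j x (axis j 1))"
  "(LINT x|cell_measure per. dflux j x (axis j 1)) = 0"
  by (rule cell_integral_derivative[OF per K flux_deriv dflux_continuous flux_periodic];
      simp add: flux_def \<psi>(3))+

lemma d\<psi>_outside: "x \<notin> S \<Longrightarrow> d\<psi> x h = 0"
  by (simp add: frechet_derivative_eq_0_outside[OF orbit_closed[OF K] _ \<psi>(3)])

lemma D\<eta>_odd: "D\<eta> j (- w) = - D\<eta> j w"
proof -
  have "\<eta> differentiable (at (- w))" using \<eta>_smooth[of 1] by simp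
  then have "(\<eta> has_derivative frechet_derivative \<eta> (at (- w))) (at (- w))"
    by (simp add: frechet_derivative_works)
  moreover have "((\<lambda>w. - w) has_derivative (\<lambda>h. - h)) (at w)" by (auto intro!: derivative_eq_intros)
  ultimately have "((\<lambda>w. \<eta> (- w)) has_derivative (\<lambda>h. frechet_derivative \<eta> (at (- w)) (- h))) (at w)"
    by (rule has_derivative_compose[rotated])
  then have "frechet_derivative \<eta> (at w) = (\<lambda>h. frechet_derivative \<eta> (at (- w)) (- h))"
    unfolding \<eta>_even by (rule frechet_derivative_at[symmetric])
  moreover have "linear (frechet_derivative \<eta> (at (- w)))"
    using \<open>(\<eta> has_derivative _) _\<close> by (rule has_derivative_linear)
  ultimately show ?thesis by (simp add: partial_deriv_def linear_neg)
qed

definition "g x = \<psi> x *\<^sub>R b (V x)"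

lemma g_borel [measurable]: "g \<in> borel_measurable borel"
  unfolding g_def[abs_def]
  by (intro borel_measurable_continuous_onI continuous_on_scaleR C1_continuous[OF \<psi>(2)] comp_V_continuous b_cont)

lemma g_periodic: "periodic per g"
  using V_periodic \<psi>(1) by (simp add: periodic_def g_def)

context
  fixes C\<psi> :: real
  assumes C\<psi>: "0 \<le> C\<psi>" "\<And>x. \<bar>\<psi> x\<bar> \<le> C\<psi>"
begin

lemma g_le: "norm (g x) \<le> C\<psi> * Cb * indicator S x"
  using C\<psi>(2)[of x] Cb(2)[OF V_in[of x]] C\<psi>(1) \<psi>(3)[of x] by (auto simp: g_def indicator_def intro!: mult_mono)

lemma g_ball: "ball_integrable r g"
  using order_trans[OF g_le] C\<psi>(1) Cb(1)
  by (intro ball_integrable_bounded[where M = "C\<psi> * Cb"] g_borel) (auto simp: indicator_def)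

text \<open>The weak law for \<open>G\<close> is tested with the mollification of \<open>g = \<psi> b(V)\<close>; moving the kernel to
  the other factor turns this into the statement that the divergence of the mollified flux
  \<open>W\<close> is orthogonal to \<open>g\<close>.\<close>

lemma mollified_weak_law:
  "integrable (cell_measure per) (\<lambda>x. \<Sum>j\<in>UNIV. \<Sum>i\<in>UNIV. \<psi> x * b (V x) $ i * dW x (axis j 1) $ i $ j)"
  "(LINT x|cell_measure per. (\<Sum>j\<in>UNIV. \<Sum>i\<in>UNIV. \<psi> x * b (V x) $ i * dW x (axis j 1) $ i $ j)) = 0"
proof -
  let ?\<phi> = "convol \<eta> g"
  let ?M = "cell_measure per"
  have smooth: "C_on m ?\<phi> UNIV" for m by (rule C_on_convol[OF bump g_ball \<epsilon>(1)])
  have perio: "periodic per ?\<phi>"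
    using g_periodic convol_translate[OF bump g_borel] by (simp add: periodic_def)
  have outside: "?\<phi> x = 0" if x: "x \<notin> orbit per {y + v |y v. y \<in> K \<and> v \<in> cball 0 \<delta>}" for x
  proof -
    have "\<eta> w *\<^sub>R g (x - w) = 0" for w
    proof (cases "norm w \<le> \<delta>")
      case True
      then have "x - w \<notin> S" using orbit_enlarge[of "x - w" per K w \<delta>] x by auto
      then show ?thesis by (simp add: g_def \<psi>(3))
    next
      case False
      then show ?thesis using \<eta>_support[of w] \<epsilon> by simp
    qed
    then show ?thesis unfolding convol_eq[OF bump g_borel] by (simp only: Bochner_Integration.integral_zero)
  qed
  have D\<phi>: "partial_deriv (axis j 1) ?\<phi> x $ i = convol (D\<eta> j) (\<lambda>x. g x $ i) x" for i j x
    by (simp add: partial_deriv_convol[OF bump g_ball \<epsilon>(1)]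
        convol_bounded_linear[OF bounded_linear_vec_nth bump_D g_ball \<epsilon>(1)])
  have dW_comp: "dW x (axis j 1) $ i $ j' = convol (D\<eta> j) (\<lambda>x. G (u x) $ i $ j') x" for i j j' x
    unfolding dW_axis
    by (rule convol_bounded_linear[OF bounded_linear_compose[OF bounded_linear_vec_nth bounded_linear_vec_nth]
          bump_D ball_integrable_G[OF \<epsilon>(4)] \<epsilon>(1)])
  have bump_neg: "bump_within \<epsilon> (\<lambda>w. D\<eta> j (- w))" for j
    using C_on_mult[OF open_UNIV C_on_const[of _ "-1"], of _ "D\<eta> j"] bump_D[of j]
    by (simp add: bump_within_def D\<eta>_odd)
  have neg: "convol (\<lambda>w. D\<eta> j (- w)) f x = - convol (D\<eta> j) f x" for j x and f :: "real^'m \<Rightarrow> real"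
    by (simp add: convol_def D\<eta>_odd)
  obtain CG where CG: "0 < CG" "\<And>v. v \<in> \<O> \<Longrightarrow> norm (G v) \<le> CG * (1 + norm v ^ 3)"
    using growth by metis
  define C where "C = CG * (C\<psi> * Cb)"
  have C0: "0 \<le> C" using CG C\<psi> Cb by (simp add: C_def)
  let ?h = "\<lambda>w y. C * (indicator S y + 4 * (indicator S y * norm (u y) ^ 3) + 4 * (indicator S y * norm (u (y - w) - u y) ^ 3))"
  have h_int: "integrable ?M (?h w)" if "norm w \<le> \<epsilon>" for w
    using integrable_indicator_orbit[OF per K] u_L3 besov(1)[of w] that \<epsilon>
    by (intro integrable_mult_right Bochner_Integration.integrable_add) auto
  have dom: "\<bar>G (u (y + w)) $ i $ j * g y $ i\<bar> \<le> ?h (- w) y" for y w i j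
  proof (cases "y \<in> S")
    case True
    have "norm (u (y + w)) ^ 3 \<le> (norm (u y) + norm (u (y + w) - u y)) ^ 3"
      by (intro power_mono) norm+
    also have "\<dots> \<le> 4 * (norm (u y) ^ 3 + norm (u (y + w) - u y) ^ 3)" by (intro power3_add_le) auto
    finally have n: "norm (u (y + w)) ^ 3 \<le> 4 * (norm (u y) ^ 3 + norm (u (y + w) - u y) ^ 3)" .
    have "\<bar>G (u (y + w)) $ i $ j\<bar> \<le> norm (G (u (y + w)))"
      using component_le_norm_cart[of "G (u (y + w)) $ i" j] Finite_Cartesian_Product.norm_nth_le[of "G (u (y + w))" i]
      by simp
    also have "\<dots> \<le> CG * (1 + norm (u (y + w)) ^ 3)" by (rule CG(2)[OF u_in])
    also have "\<dots> \<le> CG * (1 + 4 * (norm (u y) ^ 3 + norm (u (y + w) - u y) ^ 3))"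
      using n CG(1) by simp
    finally have "\<bar>G (u (y + w)) $ i $ j\<bar> \<le> CG * (1 + 4 * (norm (u y) ^ 3 + norm (u (y + w) - u y) ^ 3))" .
    moreover have "\<bar>g y $ i\<bar> \<le> C\<psi> * Cb"
      using component_le_norm_cart[of "g y" i] g_le[of y] True by simp
    ultimately have "\<bar>G (u (y + w)) $ i $ j * g y $ i\<bar>
        \<le> (CG * (1 + 4 * (norm (u y) ^ 3 + norm (u (y + w) - u y) ^ 3))) * (C\<psi> * Cb)"
      unfolding abs_mult using CG(1) by (intro mult_mono) auto
    then show ?thesis using True by (simp add: C_def algebra_simps)
  next
    case False
    then have "g y = 0" by (simp add: g_def \<psi>(3))
    with False show ?thesis by simp
  qed
  define B where "B = C * ((LINT y|?M. indicator S y) + 4 * (LINT y|?M. indicator S y * norm (u y) ^ 3) + 4 * A)"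
  have h_le: "(LINT y|?M. ?h w y) \<le> B" if w: "norm w \<le> \<epsilon>" for w
  proof -
    have "(LINT y|?M. ?h w y) = C * ((LINT y|?M. indicator S y) + 4 * (LINT y|?M. indicator S y * norm (u y) ^ 3)
        + 4 * (LINT y|?M. indicator S y * norm (u (y - w) - u y) ^ 3))"
      using integrable_indicator_orbit[OF per K] u_L3 besov(1)[of w] w \<epsilon> by simp
    also have "\<dots> \<le> B"
    proof -
      have "norm w powr (3 * \<alpha>) \<le> 1" using w \<epsilon> \<alpha> by (intro powr_le1) auto
      then have "A * norm w powr (3 * \<alpha>) \<le> A" using A by (rule mult_left_le)
      then have "(LINT y|?M. indicator S y * norm (u (y - w) - u y) ^ 3) \<le> A"
        using besov(2)[of w] w \<epsilon> by auto
      then show ?thesis unfolding B_def using C0 by (intro mult_left_mono) auto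
    qed
    finally show ?thesis .
  qed
  have Gb: "(\<lambda>x. G (u x) $ i $ j) \<in> borel_measurable borel" and gb: "(\<lambda>x. g x $ i) \<in> borel_measurable borel" for i j
    by (intro borel_measurable_vec_component G_borel g_borel)+
  have int: "integrable ?M (\<lambda>y. G (u (y + w)) $ i $ j * g y $ i)" if w: "norm w \<le> \<epsilon>" for w i j
  proof (rule Bochner_Integration.integrable_bound[OF h_int[of "- w"]])
    show "AE y in ?M. norm (G (u (y + w)) $ i $ j * g y $ i) \<le> norm (?h (- w) y)"
      using order_trans[OF dom abs_ge_self] by (intro AE_I2) simp
    have "(\<lambda>y. G (u (y + w)) $ i $ j) \<in> borel_measurable borel"
      by (rule measurable_compose[OF _ Gb]) measurable
    then show "(\<lambda>y. G (u (y + w)) $ i $ j * g y $ i) \<in> borel_measurable ?M"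
      unfolding measurable_cong_sets[OF sets_cell_measure refl] by measurable
  qed (use w in simp)
  have bd: "(LINT y|?M. \<bar>G (u (y + w)) $ i $ j * g y $ i\<bar>) \<le> B" if w: "norm w \<le> \<epsilon>" for w i j
  proof -
    have "(LINT y|?M. \<bar>G (u (y + w)) $ i $ j * g y $ i\<bar>) \<le> (LINT y|?M. ?h (- w) y)"
      by (rule integral_mono'[OF h_int]) (use w dom order_trans[OF abs_ge_zero dom] in auto)
    with h_le[of "- w"] w show ?thesis by auto
  qed
  have Gper: "periodic per (\<lambda>x. G (u x) $ i $ j)" and gper: "periodic per (\<lambda>x. g x $ i)" for i j
    using u_periodic g_periodic by (simp_all add: periodic_def)
  note gG = bump_D bump_neg Gb gb Gper gper int bd
  have i1: "integrable ?M (\<lambda>x. G (u x) $ i $ j * partial_deriv (axis j 1) ?\<phi> x $ i)" for i j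
    unfolding D\<phi> by (rule cell_convol_swap(2)[OF per]; fact gG)
  have "integrable ?M (\<lambda>x. g x $ i * convol (\<lambda>w. D\<eta> j (- w)) (\<lambda>x. G (u x) $ i $ j) x)" for i j
    by (rule cell_convol_swap(3)[OF per]; fact gG)
  then have i2: "integrable ?M (\<lambda>x. g x $ i * dW x (axis j 1) $ i $ j)" for i j
    by (simp add: neg dW_comp)
  have "(LINT x|?M. G (u x) $ i $ j * convol (D\<eta> j) (\<lambda>x. g x $ i) x)
      = (LINT x|?M. g x $ i * convol (\<lambda>w. D\<eta> j (- w)) (\<lambda>x. G (u x) $ i $ j) x)" for i j
    by (rule cell_convol_swap(1)[OF per]; fact gG)
  then have eq: "(LINT x|?M. G (u x) $ i $ j * partial_deriv (axis j 1) ?\<phi> x $ i)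
      = - (LINT x|?M. g x $ i * dW x (axis j 1) $ i $ j)" for i j
    by (simp add: D\<phi> neg dW_comp)
  have gW: "(\<Sum>j\<in>UNIV. \<Sum>i\<in>UNIV. \<psi> x * b (V x) $ i * dW x (axis j 1) $ i $ j)
      = (\<Sum>i\<in>UNIV. \<Sum>j\<in>UNIV. g x $ i * dW x (axis j 1) $ i $ j)" for x
    by (subst sum.swap) (simp add: g_def)
  show "integrable ?M (\<lambda>x. \<Sum>j\<in>UNIV. \<Sum>i\<in>UNIV. \<psi> x * b (V x) $ i * dW x (axis j 1) $ i $ j)"
    unfolding gW by (intro Bochner_Integration.integrable_sum i2)
  have "0 = (LINT x|?M. (\<Sum>i\<in>UNIV. \<Sum>j\<in>UNIV. G (u x) $ i $ j * partial_deriv (axis j 1) ?\<phi> x $ i))"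
    by (rule law[symmetric]; fact smooth perio outside)
  also have "\<dots> = - (LINT x|?M. (\<Sum>i\<in>UNIV. \<Sum>j\<in>UNIV. g x $ i * dW x (axis j 1) $ i $ j))"
    by (simp add: Bochner_Integration.integral_sum Bochner_Integration.integrable_sum i1 i2 eq sum_negf)
  finally show "(LINT x|?M. (\<Sum>j\<in>UNIV. \<Sum>i\<in>UNIV. \<psi> x * b (V x) $ i * dW x (axis j 1) $ i $ j)) = 0"
    unfolding gW by simp
qed

end

end

section \<open>Passage to the limit\<close>

context mollified_law
begin

text \<open>The integral of \<open>q(u) \<bullet> D\<psi>\<close> differs from two vanishing integrals, that of the divergence of the
  flux and that of \<open>\<psi> b(V) div W\<close>, by the integral of \<open>(q(u) - q(V)) \<bullet> D\<psi> + D(\<psi> b(V)) : E\<close>, which is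
  bounded pointwise by third moments of the increments.\<close>

lemma defect_bound:
  fixes C\<psi> Cq :: real
  assumes C\<psi>: "0 \<le> C\<psi>" "\<And>x. \<bar>\<psi> x\<bar> \<le> C\<psi>" "\<And>x j. \<bar>d\<psi> x (axis j 1)\<bar> \<le> C\<psi>"
    and Cq: "0 < Cq" "\<And>v w j. v \<in> \<O> \<Longrightarrow> w \<in> \<O> \<Longrightarrow>
      \<bar>q w $ j - q v $ j\<bar> \<le> Cq * (1 + norm v + norm (w - v)) * norm (w - v)"
  defines "C1 \<equiv> real CARD('m) * (C\<psi> * Cq * 17 * (1 + c ^ 3))
      + real CARD('m) * (real CARD('n) * (C\<psi> * Cb * (2 * cG * c * (1 + c\<^sup>2)) * (1 + c)))"
  shows "\<bar>LINT x|cell_measure per. (\<Sum>j\<in>UNIV. q (u x) $ j * d\<psi> x (axis j 1))\<bar>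
    \<le> C1 * (sqrt \<epsilon> * (LINT x|cell_measure per. indicator S x * (1 + norm (u x) ^ 3)) + A * \<epsilon> powr (3 * \<alpha> - 1))"
proof -
  let ?M = "cell_measure per"
  define CE where "CE = 2 * cG * c * (1 + c\<^sup>2)"
  have CE: "0 \<le> CE" using cG c by (simp add: CE_def)
  let ?I = "\<lambda>x. \<Sum>j\<in>UNIV. q (u x) $ j * d\<psi> x (axis j 1)"
  let ?R = "\<lambda>x. \<Sum>j\<in>UNIV. \<Sum>i\<in>UNIV. \<psi> x * b (V x) $ i * dW x (axis j 1) $ i $ j"
  define T where "T x = ?I x - ((\<Sum>j\<in>UNIV. dflux j x (axis j 1)) - ?R x)" for x
  let ?H = "\<lambda>x. C1 * (sqrt \<epsilon> * (indicator S x * (1 + norm (u x) ^ 3)) + indicator S x * moment 3 x / \<epsilon>)"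
  have T_eq: "T x = (\<Sum>j\<in>UNIV. (q (u x) $ j - q (V x) $ j) * d\<psi> x (axis j 1)
      + (\<Sum>i\<in>UNIV. (d\<psi> x (axis j 1) * b (V x) $ i + \<psi> x * Db (V x) (dV x (axis j 1)) $ i) * E x $ i $ j))" for x
    unfolding T_def dflux_axis
    by (simp only: sum.distrib sum_subtractf left_diff_distrib mult.commute[of "q _ $ _"])
  have T_le: "\<bar>T x\<bar> \<le> ?H x" for x
  proof (cases "x \<in> S")
    case False
    then show ?thesis by (simp add: T_eq d\<psi>_outside \<psi>(3))
  next
    case True
    define n where "n = norm (u x)"
    define d where "d = norm (V x - u x)"
    define m where "m = moment 3 x / \<epsilon>"
    have m: "0 \<le> m" using moment_facts(5)[of x] \<epsilon> by (simp add: m_def)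
    have sqrt0: "0 \<le> sqrt \<epsilon> * (1 + n ^ 3)" using \<epsilon> by (simp add: n_def)
    have d3: "d ^ 3 / \<epsilon> \<le> c ^ 3 * m"
    proof -
      have "d ^ 3 \<le> (c * moment 1 x) ^ 3" unfolding d_def by (intro power_mono V_minus_u) simp
      also have "\<dots> \<le> c ^ 3 * moment 3 x"
        using moment_facts(8)[of x] c by (simp add: power_mult_distrib)
      finally show ?thesis using \<epsilon> by (simp add: m_def divide_right_mono)
    qed
    \<comment> \<open>error of replacing \<open>q(u)\<close> by \<open>q(V)\<close>\<close>
    have q: "\<bar>(q (u x) $ j - q (V x) $ j) * d\<psi> x (axis j 1)\<bar>
        \<le> C\<psi> * Cq * 17 * (1 + c ^ 3) * (sqrt \<epsilon> * (1 + n ^ 3) + m)" for j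
    proof -
      have "(1 + n + d) * d \<le> 17 * (sqrt \<epsilon> * (1 + n ^ 3) + d ^ 3 / \<epsilon>)"
        using \<epsilon> by (intro two_scale_bound) (auto simp: n_def d_def)
      also have "\<dots> \<le> 17 * (1 + c ^ 3) * (sqrt \<epsilon> * (1 + n ^ 3) + m)"
        using d3 m sqrt0 c mult_nonneg_nonneg[of "c ^ 3" "sqrt \<epsilon> * (1 + n ^ 3)"]
        by (simp add: distrib_left distrib_right)
      finally have *: "(1 + n + d) * d \<le> 17 * (1 + c ^ 3) * (sqrt \<epsilon> * (1 + n ^ 3) + m)" .
      have "\<bar>q (u x) $ j - q (V x) $ j\<bar> \<le> Cq * ((1 + n + d) * d)"
        using Cq(2)[OF u_in[of x] V_in[of x], of j]
        by (simp add: n_def d_def abs_minus_commute mult.assoc)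
      also have "\<dots> \<le> Cq * (17 * (1 + c ^ 3) * (sqrt \<epsilon> * (1 + n ^ 3) + m))"
        using * Cq(1) by (intro mult_left_mono) auto
      finally have "\<bar>q (u x) $ j - q (V x) $ j\<bar> * \<bar>d\<psi> x (axis j 1)\<bar>
          \<le> (Cq * (17 * (1 + c ^ 3) * (sqrt \<epsilon> * (1 + n ^ 3) + m))) * C\<psi>"
        using C\<psi>(3)[of x j] Cq(1) c m sqrt0 by (intro mult_mono) auto
      then show ?thesis by (simp add: abs_mult mult_ac)
    qed
    \<comment> \<open>commutator term: a first moment over \<open>\<epsilon>\<close> times a second moment\<close>
    have e: "\<bar>(d\<psi> x (axis j 1) * b (V x) $ i + \<psi> x * Db (V x) (dV x (axis j 1)) $ i) * E x $ i $ j\<bar>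
        \<le> C\<psi> * Cb * CE * (1 + c) * (sqrt \<epsilon> * (1 + n ^ 3) + m)" for i j
    proof -
      have "\<bar>b (V x) $ i\<bar> \<le> Cb"
        using component_le_norm_cart[of "b (V x)" i] Cb(2)[OF V_in[of x]] by simp
      then have 1: "\<bar>d\<psi> x (axis j 1) * b (V x) $ i\<bar> \<le> C\<psi> * Cb"
        unfolding abs_mult using C\<psi> by (intro mult_mono) auto
      have "\<bar>Db (V x) (dV x (axis j 1)) $ i\<bar> \<le> Cb * norm (dV x (axis j 1))"
        using component_le_norm_cart[of "Db (V x) (dV x (axis j 1))" i] Cb(3)[OF V_in[of x], of "dV x (axis j 1)"] by simp
      also have "\<dots> \<le> Cb * (c / \<epsilon> * moment 1 x)"
        using DV_le[of j x] Cb(1) unfolding dV_axis by (rule mult_left_mono)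
      finally have 2: "\<bar>\<psi> x * Db (V x) (dV x (axis j 1)) $ i\<bar> \<le> C\<psi> * (Cb * (c / \<epsilon> * moment 1 x))"
        unfolding abs_mult using C\<psi> by (intro mult_mono) auto
      have 3: "\<bar>d\<psi> x (axis j 1) * b (V x) $ i + \<psi> x * Db (V x) (dV x (axis j 1)) $ i\<bar>
          \<le> C\<psi> * Cb * (1 + c / \<epsilon> * moment 1 x)"
        using 1 2 by (simp add: algebra_simps)
      have 4: "\<bar>E x $ i $ j\<bar> \<le> CE * moment 2 x"
        using component_le_norm_cart[of "E x $ i" j] Finite_Cartesian_Product.norm_nth_le[of "E x" i] E_le[of x]
        unfolding CE_def by linarith
      have "\<bar>(d\<psi> x (axis j 1) * b (V x) $ i + \<psi> x * Db (V x) (dV x (axis j 1)) $ i) * E x $ i $ j\<bar>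
          \<le> (C\<psi> * Cb * (1 + c / \<epsilon> * moment 1 x)) * (CE * moment 2 x)"
        unfolding abs_mult[of "_ + _"] using 3 4 C\<psi> Cb(1) c \<epsilon> moment_facts(3)[of x] by (intro mult_mono) auto
      also have "\<dots> = C\<psi> * Cb * CE * (moment 2 x + c * (moment 1 x * moment 2 x) / \<epsilon>)"
        by (simp add: algebra_simps)
      also have "\<dots> \<le> C\<psi> * Cb * CE * ((1 + c) * (sqrt \<epsilon> * (1 + n ^ 3) + m))"
      proof (rule mult_left_mono)
        have "\<epsilon>\<^sup>2 \<le> sqrt \<epsilon>"
        proof -
          have "\<epsilon>\<^sup>2 \<le> \<epsilon>" using \<epsilon> by (simp add: power2_eq_square mult_left_le)
          also have "\<epsilon> \<le> sqrt \<epsilon>" using \<epsilon> by (intro real_le_rsqrt) (simp add: power2_eq_square mult_left_le)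
          finally show ?thesis .
        qed
        moreover have "sqrt \<epsilon> \<le> sqrt \<epsilon> * (1 + n ^ 3)" using \<epsilon> by (simp add: n_def)
        ultimately have a: "moment 2 x \<le> m + sqrt \<epsilon> * (1 + n ^ 3)"
          using moment_facts(9)[of x] by (simp add: m_def)
        have "c * (moment 1 x * moment 2 x) / \<epsilon> \<le> c * moment 3 x / \<epsilon>"
          using moment_facts(6)[of x] c \<epsilon> by (intro divide_right_mono mult_left_mono) auto
        then have b: "c * (moment 1 x * moment 2 x) / \<epsilon> \<le> c * m" by (simp add: m_def)
        show "moment 2 x + c * (moment 1 x * moment 2 x) / \<epsilon> \<le> (1 + c) * (sqrt \<epsilon> * (1 + n ^ 3) + m)"
          using a b mult_nonneg_nonneg[OF less_imp_le[OF c] sqrt0] by (simp add: distrib_left distrib_right)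
      qed (use C\<psi> Cb CE in auto)
      finally show ?thesis by (simp add: mult.assoc)
    qed
    have "\<bar>T x\<bar> \<le> (\<Sum>j\<in>(UNIV::'m set). C\<psi> * Cq * 17 * (1 + c ^ 3) * (sqrt \<epsilon> * (1 + n ^ 3) + m)
        + (\<Sum>i\<in>(UNIV::'n set). C\<psi> * Cb * CE * (1 + c) * (sqrt \<epsilon> * (1 + n ^ 3) + m)))"
      unfolding T_eq
      by (intro order_trans[OF sum_abs] sum_mono order_trans[OF abs_triangle_ineq] add_mono q e)
    also have "\<dots> = C1 * (sqrt \<epsilon> * (1 + n ^ 3) + m)"
      unfolding C1_def CE_def[symmetric] by (simp add: algebra_simps)
    finally show ?thesis using True by (simp add: n_def m_def)
  qed
  have iS: "integrable ?M (\<lambda>x. indicator S x * (1 + norm (u x) ^ 3))"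
    using integrable_indicator_orbit[OF per K] u_L3 by (simp add: distrib_left)
  have iH: "integrable ?M ?H"
    using iS moment3_bound(1) by (intro integrable_mult_right Bochner_Integration.integrable_add integrable_divide) auto
  have C1: "0 \<le> C1" using C\<psi> Cq Cb cG c by (simp add: C1_def)
  have Tb: "T \<in> borel_measurable ?M"
  proof -
    have "(\<lambda>x. q (u x) $ j * d\<psi> x (axis j 1)) \<in> borel_measurable borel" for j
      by (intro borel_measurable_times q_borel borel_measurable_continuous_onI C1_axis_continuous \<psi>(2))
    then have I: "?I \<in> borel_measurable ?M"
      unfolding measurable_cong_sets[OF sets_cell_measure refl] by (intro borel_measurable_sum)
    have F: "(\<lambda>x. \<Sum>j\<in>UNIV. dflux j x (axis j 1)) \<in> borel_measurable ?M"
      by (intro borel_measurable_sum borel_measurable_integrable dflux_integral(1))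
    show ?thesis
      unfolding T_def[abs_def]
      by (intro borel_measurable_diff I F borel_measurable_integrable[OF mollified_weak_law(1)[OF C\<psi>(1,2)]])
  qed
  have iT: "integrable ?M T"
    by (rule Bochner_Integration.integrable_bound[OF iH Tb])
      (use T_le in \<open>auto intro!: AE_I2 intro: order_trans[OF _ abs_ge_self]\<close>)
  have iF: "integrable ?M (\<lambda>x. \<Sum>j\<in>UNIV. dflux j x (axis j 1))"
    by (intro Bochner_Integration.integrable_sum dflux_integral)
  note R = mollified_weak_law[OF C\<psi>(1,2)]
  have "(LINT x|?M. ?I x) = (LINT x|?M. T x + ((\<Sum>j\<in>UNIV. dflux j x (axis j 1)) - ?R x))"
    by (simp add: T_def)
  also have "\<dots> = (LINT x|?M. T x) + ((LINT x|?M. (\<Sum>j\<in>UNIV. dflux j x (axis j 1))) - (LINT x|?M. ?R x))"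
    using iT iF R(1) by simp
  also have "(LINT x|?M. (\<Sum>j\<in>UNIV. dflux j x (axis j 1))) = 0"
    by (simp add: dflux_integral)
  finally have "\<bar>LINT x|?M. ?I x\<bar> = norm (LINT x|?M. T x)" using R(2) by simp
  also have "\<dots> \<le> (LINT x|?M. ?H x)" by (rule norm_integral_le[OF iH]) (use T_le in simp)
  also have "\<dots> = C1 * (sqrt \<epsilon> * (LINT x|?M. indicator S x * (1 + norm (u x) ^ 3)) + (LINT x|?M. indicator S x * moment 3 x) / \<epsilon>)"
    using iS moment3_bound(1) by simp
  also have "\<dots> \<le> C1 * (sqrt \<epsilon> * (LINT x|?M. indicator S x * (1 + norm (u x) ^ 3)) + A * \<epsilon> powr (3 * \<alpha> - 1))"
  proof (intro mult_left_mono add_left_mono C1)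
    have "(LINT x|?M. indicator S x * moment 3 x) / \<epsilon> \<le> A * \<epsilon> powr (3 * \<alpha>) / \<epsilon>"
      using moment3_bound(2) \<epsilon> by (intro divide_right_mono) auto
    also have "\<dots> = A * \<epsilon> powr (3 * \<alpha> - 1)" using \<epsilon> by (simp add: powr_diff)
    finally show "(LINT x|?M. indicator S x * moment 3 x) / \<epsilon> \<le> A * \<epsilon> powr (3 * \<alpha> - 1)" .
  qed
  finally show ?thesis .
qed

end

text \<open>Letting \<open>\<epsilon>\<close> tend to zero; the exponent \<open>3 \<alpha> - 1\<close> is positive.\<close>

theorem (in companion_law) companion_integral:
  "(LINT x|cell_measure per. (\<Sum>j\<in>UNIV. q (u x) $ j * frechet_derivative \<psi> (at x) (axis j 1))) = 0"
proof -
  let ?I = "LINT x|cell_measure per. (\<Sum>j\<in>UNIV. q (u x) $ j * frechet_derivative \<psi> (at x) (axis j 1))"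
  obtain c :: real where c: "0 < c" and moll: "\<And>\<epsilon>. 0 < \<epsilon> \<Longrightarrow> \<exists>\<eta>::real^'m \<Rightarrow> real. mollifier c \<epsilon> \<eta>"
    using exists_mollifier by blast
  obtain Cq where Cq: "0 < Cq" "\<And>v w j. v \<in> \<O> \<Longrightarrow> w \<in> \<O> \<Longrightarrow>
      \<bar>q w $ j - q v $ j\<bar> \<le> Cq * (1 + norm v + norm (w - v)) * norm (w - v)"
    using q_increment by metis
  have \<psi>cont: "continuous_on UNIV \<psi>" using C_on_le[of 0 1 \<psi> UNIV] \<psi>(2) by simp
  have d\<psi>cont: "continuous_on UNIV (partial_deriv (axis j 1) \<psi>)" for j
    using \<psi>(2) by simp
  have d\<psi>per: "periodic per (partial_deriv (axis j 1) \<psi>)" for j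
    using periodic_derivative[OF \<psi>(1)] \<psi>(2) by (simp add: periodic_def partial_deriv_def)
  obtain M0 where M0: "0 \<le> M0" "\<And>x. x \<in> S \<Longrightarrow> \<bar>\<psi> x\<bar> \<le> M0"
    using bounded_periodic_continuous[OF per K \<psi>cont \<psi>(1)] by (metis real_norm_def)
  have "\<exists>M. 0 \<le> M \<and> (\<forall>x\<in>S. \<bar>partial_deriv (axis j 1) \<psi> x\<bar> \<le> M)" for j
    using bounded_periodic_continuous[OF per K d\<psi>cont d\<psi>per, of j] by (metis real_norm_def)
  then obtain M where M: "\<And>j. 0 \<le> M j" "\<And>j x. x \<in> S \<Longrightarrow> \<bar>partial_deriv (axis j 1) \<psi> x\<bar> \<le> M j"
    by metis
  define C\<psi> where "C\<psi> = M0 + sum M UNIV"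
  have sM: "0 \<le> sum M UNIV" "M j \<le> sum M UNIV" for j
    using M(1) by (auto intro: sum_nonneg member_le_sum)
  have C\<psi>: "0 \<le> C\<psi>" "\<bar>\<psi> x\<bar> \<le> C\<psi>" for x
    using M0(1) M0(2)[of x] \<psi>(3)[of x] sM by (cases "x \<in> S"; force simp: C\<psi>_def)+
  have dzero: "frechet_derivative \<psi> (at x) h = 0" if "x \<notin> S" for x h
    using that by (simp add: frechet_derivative_eq_0_outside[OF orbit_closed[OF K] _ \<psi>(3)])
  have C\<psi>': "\<bar>frechet_derivative \<psi> (at x) (axis j 1)\<bar> \<le> C\<psi>" for x j
    using M(2)[of x j] sM(2)[of j] M0(1) C\<psi>(1) dzero[of x]
    by (cases "x \<in> S") (auto simp: C\<psi>_def partial_deriv_def)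
  define C1 where "C1 = real CARD('m) * (C\<psi> * Cq * 17 * (1 + c ^ 3))
      + real CARD('m) * (real CARD('n) * (C\<psi> * Cb * (2 * cG * c * (1 + c\<^sup>2)) * (1 + c)))"
  define B where "B = (LINT x|cell_measure per. indicator S x * (1 + norm (u x) ^ 3))"
  have bound: "\<bar>?I\<bar> \<le> C1 * (sqrt \<epsilon> * B + A * \<epsilon> powr (3 * \<alpha> - 1))"
    if \<epsilon>: "0 < \<epsilon>" "\<epsilon> < min 1 (min \<delta> r0)" for \<epsilon>
  proof -
    obtain \<eta> :: "real^'m \<Rightarrow> real" where \<eta>: "mollifier c \<epsilon> \<eta>"
      using moll[OF \<epsilon>(1)] by blast
    interpret mollified_law per u \<O> G b q \<psi> K r0 \<delta> A \<alpha> cG Cb \<epsilon> c \<eta>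
      by unfold_locales (use \<epsilon> c \<eta> in auto)
    show ?thesis
      using defect_bound[OF C\<psi> C\<psi>' Cq] by (simp add: C1_def B_def)
  qed
  have "((\<lambda>\<epsilon>. C1 * (sqrt \<epsilon> * B + A * \<epsilon> powr (3 * \<alpha> - 1))) \<longlongrightarrow> C1 * (sqrt 0 * B + A * 0)) (at_right 0)"
  proof (intro tendsto_intros)
    show "((\<lambda>\<epsilon>. \<epsilon> powr (3 * \<alpha> - 1)) \<longlongrightarrow> 0) (at_right 0)"
      using \<alpha> tendsto_powr'[of "\<lambda>\<epsilon>. \<epsilon>" 0 "at_right 0" "\<lambda>_. 3 * \<alpha> - 1" "3 * \<alpha> - 1"]
      by (auto simp: eventually_at_right_less intro!: tendsto_eq_intros eventually_at_rightI[of 0 1])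
  qed
  then have "((\<lambda>\<epsilon>. C1 * (sqrt \<epsilon> * B + A * \<epsilon> powr (3 * \<alpha> - 1))) \<longlongrightarrow> 0) (at_right 0)" by simp
  moreover have "eventually (\<lambda>\<epsilon>. \<bar>?I\<bar> \<le> C1 * (sqrt \<epsilon> * B + A * \<epsilon> powr (3 * \<alpha> - 1))) (at_right 0)"
    by (rule eventually_at_rightI[of 0 "min 1 (min \<delta> r0)"]) (use bound \<delta> r0 in auto)
  ultimately have "\<bar>?I\<bar> \<le> 0"
    by (rule tendsto_lowerbound) simp
  then show ?thesis by simp
qed

section \<open>Multipliers with bounded weak derivative\<close>

lemma C_on_bounded_linear:
  assumes "bounded_linear L" "open S" "C_on m f S"
  shows "C_on m (\<lambda>x. L (f x)) S"
  using assms(3)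
proof (induction m arbitrary: f)
  case 0
  then show ?case
    using linear_continuous_on[OF assms(1)] continuous_on_compose2[of UNIV L S f] by auto
next
  case (Suc m)
  have d: "((\<lambda>x. L (f x)) has_derivative (\<lambda>h. L (frechet_derivative f (at x) h))) (at x)" if "x \<in> S" for x
    using Suc.prems that
    by (intro bounded_linear.has_derivative[OF assms(1)]) (simp flip: frechet_derivative_works)
  have "C_on m (partial_deriv i (\<lambda>x. L (f x))) S" if i: "i \<in> Basis" for i
  proof (rule C_on_cong[OF assms(2)])
    show "C_on m (\<lambda>x. L (partial_deriv i f x)) S" by (rule Suc.IH[OF C_on_SucD[OF Suc.prems i]])
    show "L (partial_deriv i f x) = partial_deriv i (\<lambda>x. L (f x)) x" if "x \<in> S" for x
      by (simp add: partial_deriv_def frechet_derivative_at[OF d[OF that], symmetric])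
  qed
  then show ?case using d by (auto simp: differentiable_def)
qed

lemma cell_measure_0: "cell_measure (\<lambda>_::'m::finite. 0) = lborel"
proof -
  have "indicator (period_cell (\<lambda>_::'m. 0)) = (\<lambda>_. 1::ennreal)"
    by (simp add: period_cell_def fun_eq_iff)
  then show ?thesis by (simp add: cell_measure_def density_1)
qed

lemma period_lattice_0: "period_lattice (\<lambda>_. 0) = {0}"
  by (auto simp: period_lattice_def vec_eq_iff)

lemma orbit_0: "orbit (\<lambda>_. 0) K = K"
  by (simp add: orbit_def period_lattice_0)

text \<open>Testing the distributional derivative with a mollifier centred at \<open>v\<close> and integrating by
  parts shows that averages of the classical derivative near \<open>v\<close> are bounded by the essential
  bound of the distributional one; continuity gives the bound at \<open>v\<close> itself.\<close>

lemma W1inf_partial_deriv_bounded: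
  fixes f :: "real^'n::finite \<Rightarrow> 'b::euclidean_space"
  assumes S: "open S" and f: "C_on 1 f S" and W: "f \<in> W1inf_space S"
  obtains C where "0 \<le> C" "\<And>i v. v \<in> S \<Longrightarrow> norm (partial_deriv (axis i 1) f v) \<le> C"
proof -
  have "\<exists>C\<ge>0. \<forall>v\<in>S. norm (partial_deriv (axis i 1) f v) \<le> C" for i
  proof -
    let ?e = "axis i (1::real)"
    obtain g where g: "g \<in> Linf_space S" "\<And>\<phi>. \<phi> \<in> test_functions (\<lambda>_. 0) S \<Longrightarrow>
        (LINT x : S | lebesgue. partial_deriv ?e \<phi> x *\<^sub>R f x) = - (LINT x : S | lebesgue. \<phi> x *\<^sub>R g x)"
      using W unfolding W1inf_space_def by blast
    obtain C0 where C0: "AE x in lebesgue. x \<in> S \<longrightarrow> norm (g x) \<le> C0"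
      using g(1) unfolding Linf_space_def by blast
    define C where "C = max C0 0"
    have C: "AE x in lebesgue. x \<in> S \<longrightarrow> norm (g x) \<le> C" "0 \<le> C"
      using C0 by (auto simp: C_def)
    have df: "(f has_derivative frechet_derivative f (at x)) (at x)" if "x \<in> S" for x
      using f that by (simp flip: frechet_derivative_works)
    have fc: "continuous_on S f" using C_on_le[of 0 1 f S] f by simp
    have pc: "continuous_on S (partial_deriv ?e f)" using f by simp
    have "norm (partial_deriv ?e f v) \<le> C + k" if v: "v \<in> S" and k: "0 < k" for v k
    proof -
      obtain r1 where r1: "0 < r1" "cball v r1 \<subseteq> S"
        using S v by (meson open_contains_cball)
      have "continuous (at v) (partial_deriv ?e f)"
        using pc S v by (simp add: continuous_on_eq_continuous_at)
      then have "\<exists>r>0. \<forall>x. dist x v < r \<longrightarrow> dist (partial_deriv ?e f x) (partial_deriv ?e f v) < k"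
        using k by (simp only: continuous_at_eps_delta)
      then obtain r2 where r2: "0 < r2" "\<And>x. dist x v < r2 \<Longrightarrow> dist (partial_deriv ?e f x) (partial_deriv ?e f v) < k"
        by blast
      define r where "r = min r1 (r2 / 2)"
      have r: "0 < r" "r \<le> r1" "r < r2" using r1 r2 by (auto simp: r_def)
      have rS: "cball v r \<subseteq> S" using r1(2) r(2) by auto
      obtain c :: real where "0 < c" and moll: "\<And>\<epsilon>. 0 < \<epsilon> \<Longrightarrow> \<exists>\<eta>::real^'n \<Rightarrow> real. mollifier c \<epsilon> \<eta>"
        using exists_mollifier by blast
      obtain \<eta> :: "real^'n \<Rightarrow> real" where \<eta>:
       "\<And>m. C_on m \<eta> UNIV" "\<And>w. 0 \<le> \<eta> w" "\<And>w. \<eta> (- w) = \<eta> w"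
       "\<And>w. r \<le> norm w \<Longrightarrow> \<eta> w = 0" "integrable lborel \<eta>" "(LINT w|lborel. \<eta> w) = 1"
        using moll[OF r(1)] unfolding mollifier_def by blast
      \<comment> \<open>mollifier centred at \<open>v\<close>, supported in a ball inside \<open>S\<close> on which the derivative varies by at
        most \<open>k\<close>\<close>
      define \<phi> where "\<phi> x = \<eta> (x - v)" for x
      have shift: "C_on m (\<lambda>x. h (x - v)) UNIV" if "C_on m h UNIV" for m and h :: "real^'n \<Rightarrow> real"
        using that
      proof (induction m arbitrary: h)
        case 0
        then have "continuous_on UNIV h" by simp
        then show ?case
          by (simp, rule continuous_on_compose2) (auto intro!: continuous_intros)
      next
        case (Suc m)
        have d: "((\<lambda>x. h (x - v)) has_derivative frechet_derivative h (at (x - v))) (at x)" for x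
        proof -
          have "(h has_derivative frechet_derivative h (at (x - v))) (at (x - v))"
            using Suc.prems by (simp flip: frechet_derivative_works)
          then have "((\<lambda>x. h (x - v)) has_derivative (\<lambda>y. frechet_derivative h (at (x - v)) y)) (at x)"
            by (rule has_derivative_compose[rotated]) (auto intro!: derivative_eq_intros)
          then show ?thesis .
        qed
        have "partial_deriv i (\<lambda>x. h (x - v)) = (\<lambda>x. partial_deriv i h (x - v))" for i
          by (simp add: partial_deriv_def fun_eq_iff frechet_derivative_at[OF d, symmetric])
        then show ?case using Suc d by (auto simp: differentiable_def)
      qed
      have \<phi>: "C_on m \<phi> UNIV" "0 \<le> \<phi> x" "r \<le> dist v x \<Longrightarrow> \<phi> x = 0" for m x
        using shift[OF \<eta>(1)] \<eta>(2) \<eta>(4)[of "x - v"] by (auto simp: \<phi>_def[abs_def] dist_norm norm_minus_commute)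
      have \<phi>1: "integrable lborel \<phi>" "(LINT x|lborel. \<phi> x) = 1"
      proof -
        have m: "\<eta> \<in> borel_measurable borel" using \<eta>(5) by auto
        have e: "\<phi> = (\<lambda>x. \<eta> (v - x))" using \<eta>(3)[of "_ - v"] by (auto simp: \<phi>_def fun_eq_iff)
        show "integrable lborel \<phi>" "(LINT x|lborel. \<phi> x) = 1"
          unfolding e using lborel_reflect[OF m, of v] \<eta>(5,6) by simp_all
      qed
      have d\<phi>: "(\<phi> has_derivative frechet_derivative \<phi> (at x)) (at x)" for x
        using \<phi>(1)[of 1] by (simp flip: frechet_derivative_works)
      have "\<phi> \<in> test_functions (\<lambda>_. 0) S"
        unfolding test_functions_def maps_on_def smooth_on_def
        using C_on_subset[OF \<phi>(1)] \<phi>(3) rS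
        by (auto simp: period_lattice_0 intro!: exI[of _ "cball v r"]) (meson linorder_not_le less_imp_le)
      from g(2)[OF this]
      have weak: "(LINT x : S | lebesgue. partial_deriv ?e \<phi> x *\<^sub>R f x) = - (LINT x : S | lebesgue. \<phi> x *\<^sub>R g x)" .
      \<comment> \<open>\<open>\<phi> f\<close> extended by zero, so that integration by parts on the whole space applies\<close>
      define F where "F x = (if x \<in> S then \<phi> x *\<^sub>R f x else 0)" for x
      define F' where "F' x h = (if x \<in> S then \<phi> x *\<^sub>R frechet_derivative f (at x) h + frechet_derivative \<phi> (at x) h *\<^sub>R f x else 0)" for x h
      have open_c: "open (- cball v r)" by auto
      have "frechet_derivative \<phi> (at x) = (\<lambda>_. 0)" if "x \<notin> cball v r" for x
        using \<phi>(3) by (intro frechet_derivative_eq_0_outside[OF closed_cball that]) auto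
      then have d\<phi>0: "frechet_derivative \<phi> (at x) h = 0" if "x \<notin> cball v r" for x h
        using that by simp
      have F: "(F has_derivative F' x) (at x)" for x
      proof (cases "x \<in> S")
        case True
        have "((\<lambda>x. \<phi> x *\<^sub>R f x) has_derivative F' x) (at x)"
          using has_derivative_scaleR[OF d\<phi> df[OF True]] True by (simp add: F'_def[abs_def])
        then show ?thesis
          by (rule has_derivative_transform_within_open[OF _ S True]) (simp add: F_def)
      next
        case False
        then have x: "x \<in> - cball v r" using rS by auto
        have "((\<lambda>_. 0) has_derivative F' x) (at x)" using False by (simp add: F'_def[abs_def])
        then show ?thesis
          by (rule has_derivative_transform_within_open[OF _ open_c x]) (use \<phi>(3) in \<open>auto simp: F_def\<close>)
      qed
      have p\<phi>c: "continuous_on T (partial_deriv ?e \<phi>)" and \<phi>c: "continuous_on T \<phi>" for T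
      proof -
        have "C_on 0 (partial_deriv ?e \<phi>) UNIV" by (rule C_on_SucD[OF \<phi>(1)[of "Suc 0"]]) simp
        then show "continuous_on T (partial_deriv ?e \<phi>)" "continuous_on T \<phi>"
          using \<phi>(1)[of 0] by (auto intro: continuous_on_subset)
      qed
      have "continuous_on (S \<union> - cball v r) (\<lambda>x. F' x ?e)"
      proof (rule continuous_on_open_Un[OF S open_c])
        have "continuous_on S (\<lambda>x. \<phi> x *\<^sub>R partial_deriv ?e f x + partial_deriv ?e \<phi> x *\<^sub>R f x)"
          by (intro continuous_intros pc fc p\<phi>c \<phi>c)
        then show "continuous_on S (\<lambda>x. F' x ?e)"
          by (rule continuous_on_eq) (simp add: F'_def partial_deriv_def)
        show "continuous_on (- cball v r) (\<lambda>x. F' x ?e)"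
          by (rule continuous_on_eq[OF continuous_on_const[of _ 0]]) (use d\<phi>0 \<phi>(3) in \<open>auto simp: F'_def\<close>)
      qed
      moreover have "S \<union> - cball v r = UNIV" using rS by auto
      ultimately have F'c: "continuous_on UNIV (\<lambda>x. F' x ?e)" by simp
      have "(LINT x|cell_measure (\<lambda>_. 0). F' x ?e) = 0"
        by (rule cell_integral_derivative[OF _ compact_cball[of v r] F F'c])
          (use \<phi>(3) in \<open>auto simp: periodic_def period_lattice_0 orbit_0 F_def\<close>)
      then have F'0: "(LINT x|lborel. F' x ?e) = 0" by (simp add: cell_measure_0)
      have indS: "S \<in> sets borel" using S by simp
      define p1 where "p1 x = indicator S x *\<^sub>R (partial_deriv ?e \<phi> x *\<^sub>R f x)" for x
      define p2 where "p2 x = indicator S x *\<^sub>R (\<phi> x *\<^sub>R partial_deriv ?e f x)" for x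
      have cb: "emeasure lborel (cball v r) < \<infinity>" by (rule emeasure_bounded_finite[OF bounded_cball])
      have supported: "integrable lborel (\<lambda>x. indicator S x *\<^sub>R h x)"
        if h: "continuous_on S h" "\<And>x. x \<notin> cball v r \<Longrightarrow> h x = 0" for h :: "real^'n \<Rightarrow> 'b"
      proof -
        have "integrable lborel (\<lambda>x. indicator (cball v r) x *\<^sub>R h x)"
          using h(1) rS by (intro borel_integrable_compact compact_cball) (auto intro: continuous_on_subset)
        moreover have "(\<lambda>x. indicator (cball v r) x *\<^sub>R h x) = (\<lambda>x. indicator S x *\<^sub>R h x)"
          using h(2) rS by (auto simp: fun_eq_iff indicator_def)
        ultimately show ?thesis by simp
      qed
      have p1: "integrable lborel p1"
        unfolding p1_def[abs_def]
        by (intro supported continuous_intros fc p\<phi>c) (simp add: partial_deriv_def d\<phi>0)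
      have p2: "integrable lborel p2"
        unfolding p2_def[abs_def]
        by (intro supported continuous_intros pc \<phi>c) (simp add: \<phi>(3))
      have "F' x ?e = p2 x + p1 x" for x
        by (simp add: F'_def p1_def p2_def partial_deriv_def)
      then have "(LINT x|lborel. p2 x) = - (LINT x|lborel. p1 x)"
        using F'0 p1 p2 by (simp add: add_eq_0_iff2)
      also have "(LINT x|lborel. p1 x) = (LINT x : S | lebesgue. partial_deriv ?e \<phi> x *\<^sub>R f x)"
        using borel_measurable_integrable[OF p1]
        by (simp add: set_lebesgue_integral_def p1_def[abs_def] integral_completion)
      finally have "(LINT x|lborel. p2 x) = (LINT x : S | lebesgue. \<phi> x *\<^sub>R g x)" using weak by simp
      moreover have "norm (LINT x : S | lebesgue. \<phi> x *\<^sub>R g x) \<le> C"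
      proof -
        have "norm (LINT x : S | lebesgue. \<phi> x *\<^sub>R g x) \<le> (LINT x|lebesgue. norm (indicator S x *\<^sub>R \<phi> x *\<^sub>R g x))"
          unfolding set_lebesgue_integral_def by (rule Bochner_Integration.integral_norm_bound)
        also have "\<dots> \<le> (LINT x|lebesgue. C * \<phi> x)"
        proof (rule integral_mono_AE')
          show "integrable lebesgue (\<lambda>x. C * \<phi> x)"
            using \<phi>1(1) by (intro integrable_mult_right) (simp add: integrable_completion borel_measurable_integrable)
          show "AE x in lebesgue. norm (indicator S x *\<^sub>R \<phi> x *\<^sub>R g x) \<le> C * \<phi> x"
            using C(1)
          proof eventually_elim
            case (elim x)
            then show ?case
              using \<phi>(2)[of x] C(2) by (cases "x \<in> S") (auto simp: mult.commute[of C] mult_left_mono)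
          qed
        qed (use C \<phi> in auto)
        also have "\<dots> = C"
          using \<phi>1 by (simp add: integral_completion borel_measurable_integrable)
        finally show ?thesis .
      qed
      ultimately have "norm (LINT x|lborel. p2 x) \<le> C" by simp
      moreover have "norm ((LINT x|lborel. p2 x) - partial_deriv ?e f v) \<le> k"
      proof -
        have "(LINT x|lborel. p2 x) - partial_deriv ?e f v
            = (LINT x|lborel. p2 x) - (LINT x|lborel. \<phi> x *\<^sub>R partial_deriv ?e f v)"
          using \<phi>1 by simp
        also have "\<dots> = (LINT x|lborel. p2 x - \<phi> x *\<^sub>R partial_deriv ?e f v)"
          using p2 \<phi>1 by simp
        also have "norm \<dots> \<le> (LINT x|lborel. \<phi> x * k)"
        proof (rule norm_integral_le)
          fix x
          show "norm (p2 x - \<phi> x *\<^sub>R partial_deriv ?e f v) \<le> \<phi> x * k"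
          proof (cases "r \<le> dist v x")
            case True
            then show ?thesis using \<phi>(3)[of x] by (simp add: p2_def)
          next
            case False
            then have "x \<in> S" "dist x v < r2" using rS r(3) by (auto simp: dist_commute)
            then have "p2 x - \<phi> x *\<^sub>R partial_deriv ?e f v = \<phi> x *\<^sub>R (partial_deriv ?e f x - partial_deriv ?e f v)"
              and "norm (partial_deriv ?e f x - partial_deriv ?e f v) \<le> k"
              using r2(2)[of x] by (auto simp: p2_def scaleR_diff_right dist_norm)
            then show ?thesis using \<phi>(2)[of x] by (simp add: mult_left_mono)
          qed
        qed (use \<phi>1 in simp)
        also have "\<dots> = k" using \<phi>1 by simp
        finally show ?thesis .
      qed
      ultimately show ?thesis by norm
    qed
    then have "norm (partial_deriv ?e f v) \<le> C" if "v \<in> S" for v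
      using that by (meson field_le_epsilon)
    then show ?thesis using C(2) by blast
  qed
  then obtain C where C: "\<And>i. 0 \<le> C i" "\<And>i v. v \<in> S \<Longrightarrow> norm (partial_deriv (axis i 1) f v) \<le> C i"
    by metis
  show thesis
  proof (rule that[of "sum C UNIV"])
    show "0 \<le> sum C UNIV" using C(1) by (simp add: sum_nonneg)
    show "norm (partial_deriv (axis i 1) f v) \<le> sum C UNIV" if "v \<in> S" for i v
      using C(2)[OF that, of i] member_le_sum[of i UNIV C] C(1) by force
  qed
qed

text \<open>The set where the essential bound is exceeded is open and negligible, hence empty.\<close>

lemma Linf_continuous_bounded:
  fixes f :: "real^'n::finite \<Rightarrow> 'b::euclidean_space"
  assumes "open S" "continuous_on S f" "f \<in> Linf_space S"
  obtains C where "0 \<le> C" "\<And>v. v \<in> S \<Longrightarrow> norm (f v) \<le> C"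
proof -
  obtain C where C: "AE x in lebesgue. x \<in> S \<longrightarrow> norm (f x) \<le> C"
    using assms(3) unfolding Linf_space_def by blast
  let ?N = "S \<inter> f -` {y. C < norm y}"
  have "open {y::'b. C < norm y}" by (intro open_Collect_less continuous_intros)
  then have "open ?N" by (rule continuous_open_preimage[OF assms(2,1)])
  moreover have "negligible ?N"
  proof -
    have "{x. \<not> (x \<in> S \<longrightarrow> norm (f x) \<le> C)} \<in> null_sets lebesgue"
      using C completion.AE_iff_null_sets[of _ "lborel::(real^'n) measure"] by simp
    moreover have "{x. \<not> (x \<in> S \<longrightarrow> norm (f x) \<le> C)} = ?N" by auto
    ultimately show ?thesis by (simp add: negligible_iff_null_sets)
  qed
  ultimately have "?N = {}" using open_not_negligible by blast
  then have "norm (f v) \<le> max C 0" if "v \<in> S" for v using that by fastforce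
  then show thesis by (intro that[of "max C 0"]) auto
qed

section \<open>From Lebesgue to Borel functions\<close>

text \<open>Besov regularity is given for each component; this passes to the Euclidean norm.\<close>

lemma norm_cube_le_sum:
  fixes v :: "real^'n::finite"
  shows "norm v ^ 3 \<le> real CARD('n) ^ 3 * (\<Sum>i\<in>UNIV. \<bar>v $ i\<bar> ^ 3)"
proof -
  obtain i where i: "\<And>j. \<bar>v $ j\<bar> \<le> \<bar>v $ i\<bar>"
  proof -
    have "Max (range (\<lambda>j. \<bar>v $ j\<bar>)) \<in> range (\<lambda>j. \<bar>v $ j\<bar>)" by (intro Max_in) auto
    then obtain i where "Max (range (\<lambda>j. \<bar>v $ j\<bar>)) = \<bar>v $ i\<bar>" by (elim rangeE)
    then have "\<bar>v $ j\<bar> \<le> \<bar>v $ i\<bar>" for j by (metis Max_ge finite finite_imageI rangeI)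
    then show thesis by (rule that)
  qed
  have "norm v \<le> (\<Sum>j\<in>UNIV. \<bar>v $ j\<bar>)" by (rule norm_le_l1_cart)
  also have "\<dots> \<le> (\<Sum>j\<in>(UNIV::'n set). \<bar>v $ i\<bar>)" by (intro sum_mono i)
  finally have "norm v ^ 3 \<le> (real CARD('n) * \<bar>v $ i\<bar>) ^ 3" by (intro power_mono) auto
  also have "\<dots> = real CARD('n) ^ 3 * \<bar>v $ i\<bar> ^ 3" by (simp add: power_mult_distrib)
  also have "\<dots> \<le> real CARD('n) ^ 3 * (\<Sum>i\<in>UNIV. \<bar>v $ i\<bar> ^ 3)"
    by (intro mult_left_mono member_le_sum[of i UNIV "\<lambda>i. \<bar>v $ i\<bar> ^ 3"]) auto
  finally show ?thesis .
qed

lemma AE_lborel_translate: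
  assumes "AE x in lborel. P x" shows "AE x in lborel. P (x + a :: 'a::euclidean_space)"
proof -
  have "AE x in distr lborel borel ((+) a). P x" using assms by (simp only: lborel_distr_plus)
  then have "AE x in lborel. P (a + x)" by (rule AE_distrD[rotated]) simp
  then show ?thesis by (simp add: add.commute)
qed

lemma integrable_lborel_translate:
  fixes g :: "'a::euclidean_space \<Rightarrow> 'b::{banach, second_countable_topology}"
  assumes "g \<in> borel_measurable borel"
  shows "integrable lborel (\<lambda>x. g (x + a)) \<longleftrightarrow> integrable lborel g"
proof -
  have "integrable (distr lborel borel ((+) a)) g \<longleftrightarrow> integrable lborel (\<lambda>x. g (a + x))"
    using assms by (intro integrable_distr_eq) auto
  then show ?thesis by (simp only: lborel_distr_plus add.commute)
qed

lemma lebesgue_borel_version: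
  fixes f h :: "'a::euclidean_space \<Rightarrow> 'b::euclidean_space"
  assumes T: "T \<in> sets borel" and h: "h \<in> borel_measurable borel"
    and eq: "AE x in lborel. x \<in> T \<longrightarrow> f x = h x"
  shows "set_integrable lebesgue T f \<longleftrightarrow> set_integrable lborel T h"
    and "(LINT x : T | lebesgue. f x) = (LINT x : T | lborel. h x)"
proof -
  let ?F = "\<lambda>x. indicator T x *\<^sub>R f x" and ?H = "\<lambda>x. indicator T x *\<^sub>R h x"
  have H: "?H \<in> borel_measurable lborel" using T h by simp
  have HL: "?H \<in> borel_measurable lebesgue" by (rule measurable_completion[OF H])
  have ae: "AE x in lebesgue. ?H x = ?F x"
    by (rule AE_completion, use eq in eventually_elim) (auto simp: indicator_def)
  have FL: "?F \<in> borel_measurable lebesgue" by (rule borel_measurable_AE[OF HL ae])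
  show "set_integrable lebesgue T f \<longleftrightarrow> set_integrable lborel T h"
    unfolding set_integrable_def integrable_cong_AE[OF HL FL ae, symmetric] by (rule integrable_completion[OF H])
  show "(LINT x : T | lebesgue. f x) = (LINT x : T | lborel. h x)"
    unfolding set_lebesgue_integral_def integral_cong_AE[OF HL FL ae, symmetric] by (rule integral_completion[OF H])
qed

lemma lebesgue_cell_version:
  fixes f h :: "real^'m::finite \<Rightarrow> 'b::euclidean_space"
  assumes X: "X \<in> sets borel" and h: "h \<in> borel_measurable borel"
    and eq: "AE x in lborel. x \<in> X \<longrightarrow> f x = h x"
  shows "set_integrable lebesgue (X \<inter> period_cell per) f \<longleftrightarrow> integrable (cell_measure per) (\<lambda>x. indicator X x *\<^sub>R h x)"
    and "(LINT x : X \<inter> period_cell per | lebesgue. f x) = (LINT x|cell_measure per. indicator X x *\<^sub>R h x)"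
proof -
  have T: "X \<inter> period_cell per \<in> sets borel" using X by simp
  have ae: "AE x in lborel. x \<in> X \<inter> period_cell per \<longrightarrow> f x = h x" using eq by eventually_elim auto
  have m: "(\<lambda>x. indicator X x *\<^sub>R h x) \<in> borel_measurable borel" using X h by simp
  have e: "(\<lambda>x. indicator (X \<inter> period_cell per) x *\<^sub>R h x) = (\<lambda>x. indicator (period_cell per) x *\<^sub>R indicator X x *\<^sub>R h x)"
    by (auto simp: fun_eq_iff indicator_def)
  show "set_integrable lebesgue (X \<inter> period_cell per) f \<longleftrightarrow> integrable (cell_measure per) (\<lambda>x. indicator X x *\<^sub>R h x)"
    using lebesgue_borel_version(1)[OF T h ae] integrable_cell_measure(1)[OF m]
    unfolding set_integrable_def e by blast
  show "(LINT x : X \<inter> period_cell per | lebesgue. f x) = (LINT x|cell_measure per. indicator X x *\<^sub>R h x)"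
    using lebesgue_borel_version(2)[OF T h ae] integrable_cell_measure(2)[OF m]
    unfolding set_lebesgue_integral_def e by simp
qed

lemma open_domain_translate_iff:
  assumes "open_domain per X" "z \<in> period_lattice per"
  shows "x + z \<in> X \<longleftrightarrow> x \<in> X"
proof
  assume "x + z \<in> X"
  then have "x + z + - z \<in> X"
    using assms(1) period_lattice_uminus[OF assms(2)] unfolding open_domain_def by blast
  then show "x \<in> X" by simp
qed (use assms in \<open>auto simp: open_domain_def\<close>)

text \<open>A Borel version on the cell is continued periodically.  Outside the domain, and at those points
  of it where the value is not in \<open>\<O>\<close>, it is set to \<open>v0\<close>.  The latter points form a null set, since
  countably many translates of a null set are null.\<close>

lemma periodic_borel_version:
  fixes U :: "real^'m::finite \<Rightarrow> real^'n::finite"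
  assumes per: "\<And>j. 0 \<le> per j" and X: "open_domain per X" and U: "U \<in> maps_on per X \<O>"
    and \<O>: "open \<O>" and v0: "v0 \<in> \<O>"
    and m: "\<And>i. set_borel_measurable lebesgue (X \<inter> period_cell per) (\<lambda>x. U x $ i)"
  obtains u where "u \<in> borel_measurable borel" "periodic per u" "\<And>x. u x \<in> \<O>"
    "\<And>x. x \<notin> X \<Longrightarrow> u x = v0" "AE x in lborel. x \<in> X \<longrightarrow> u x = U x"
proof -
  let ?C = "period_cell per" and ?\<rho> = "reduce per"
  let ?U0 = "\<lambda>i x. indicator (X \<inter> ?C) x *\<^sub>R U x $ i"
  have "\<forall>i. \<exists>g. g \<in> borel_measurable borel \<and> (AE x in lborel. ?U0 i x = g x)"
  proof
    fix i
    have "\<exists>g\<in>borel_measurable lborel. AE x in lborel. ?U0 i x = g x"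
      using m[of i] unfolding set_borel_measurable_def by (rule completion_ex_borel_measurable_real)
    then show "\<exists>g. g \<in> borel_measurable borel \<and> (AE x in lborel. ?U0 i x = g x)"
      by auto
  qed
  from choice[OF this] obtain g where g: "\<And>i. g i \<in> borel_measurable borel" "\<And>i. AE x in lborel. ?U0 i x = g i x"
    by blast
  have Xo: "open X" using X by (simp add: open_domain_def)
  have X_iff: "?\<rho> x \<in> X \<longleftrightarrow> x \<in> X" for x
    using open_domain_translate_iff[OF X reduce_lattice[of per x, OF per], of x] by simp
  define u' where "u' x = (\<chi> i. g i x)" for x
  have u': "u' \<in> borel_measurable borel"
  proof (rule borel_measurable_euclidean_space[THEN iffD2], rule ballI)
    fix i :: "real^'n" assume "i \<in> Basis"
    then obtain j where j: "i = axis j 1" by (auto simp: Basis_vec_def)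
    have "(\<lambda>x. u' x \<bullet> i) = g j" by (simp add: j inner_axis u'_def)
    then show "(\<lambda>x. u' x \<bullet> i) \<in> borel_measurable borel" using g(1) by simp
  qed
  define h where "h x = (if x \<in> X \<and> u' x \<in> \<O> then u' x else v0)" for x
  have h: "h \<in> borel_measurable borel"
  proof -
    have "X \<inter> (u' -` \<O> \<inter> space borel) \<in> sets borel"
      using Xo \<O> by (intro sets.Int borel_open measurable_sets[OF u']) auto
    moreover have "X \<inter> (u' -` \<O> \<inter> space borel) = {x. x \<in> X \<and> u' x \<in> \<O>}" by auto
    ultimately have "{x \<in> space borel. x \<in> X \<and> u' x \<in> \<O>} \<in> sets borel" by simp
    then show ?thesis unfolding h_def[abs_def] using u' by (intro measurable_If) auto
  qed
  have "AE x in lborel. \<forall>z\<in>period_lattice per. \<forall>i\<in>UNIV. ?U0 i (x + z) = g i (x + z)"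
    using g(2) by (intro AE_ball_countable' countable_period_lattice AE_lborel_translate) auto
  then have ae: "AE x in lborel. x \<in> X \<longrightarrow> h (?\<rho> x) = U x"
  proof eventually_elim
    case (elim x)
    show ?case
    proof
      assume x: "x \<in> X"
      let ?z = "?\<rho> x - x"
      have z: "?z \<in> period_lattice per" by (rule reduce_lattice[OF per])
      have "U (x + ?z) = U x" using U x z unfolding maps_on_def by blast
      then have r: "U (?\<rho> x) = U x" by simp
      have "?U0 i (?\<rho> x) = g i (?\<rho> x)" for i using elim z by (metis UNIV_I add.commute diff_add_cancel)
      then have "u' (?\<rho> x) = U x"
        using x r reduce_in_cell[of per x, OF per] X_iff[of x] by (simp add: u'_def vec_eq_iff)
      moreover have "U x \<in> \<O>" using U x unfolding maps_on_def by blast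
      ultimately show "h (?\<rho> x) = U x" using x X_iff by (simp add: h_def)
    qed
  qed
  show thesis
  proof (rule that[of "\<lambda>x. h (?\<rho> x)"])
    show "(\<lambda>x. h (?\<rho> x)) \<in> borel_measurable borel"
      by (rule measurable_compose[OF reduce_measurable[OF per] h])
    show "periodic per (\<lambda>x. h (?\<rho> x))" by (rule periodic_comp_reduce[OF per])
    show "h (?\<rho> x) \<in> \<O>" for x using v0 by (simp add: h_def)
    show "h (?\<rho> x) = v0" if "x \<notin> X" for x using that X_iff by (simp add: h_def)
  qed (fact ae)
qed

lemma powr_cube: "(x powr a) ^ 3 = x powr (3 * a)" for x :: real
proof -
  have "(x powr a) ^ 3 = (x powr a) powr 3" by simp
  also have "\<dots> = x powr (a * 3)" by (rule powr_powr)
  finally show ?thesis by (simp only: mult.commute)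
qed

text \<open>Translation invariance shows that the integrals in the Besov seminorm exist, so that the
  bounds given for them are not bounds for a default value.\<close>

lemma besov_cell_bounds:
  fixes U u :: "real^'m::finite \<Rightarrow> real^'n::finite"
  assumes per: "\<And>j. 0 \<le> per j" and X: "open_domain per X"
    and U: "U \<in> besov_maps \<alpha> 3 per X \<O>"
    and u: "u \<in> borel_measurable borel" "periodic per u" "AE x in lborel. x \<in> X \<longrightarrow> u x = U x"
  shows "integrable (cell_measure per) (\<lambda>x. indicator X x * norm (u x) ^ 3)"
    and "\<And>w. integrable (cell_measure per) (\<lambda>x. indicator (X \<inter> (\<lambda>x. x + w) ` X) x * norm (u (x - w) - u x) ^ 3)"
    and "\<exists>A\<ge>0. \<forall>w. w \<noteq> 0 \<longrightarrow> (LINT x|cell_measure per. indicator (X \<inter> (\<lambda>x. x + w) ` X) x * norm (u (x - w) - u x) ^ 3)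
           \<le> A * norm w powr (3 * \<alpha>)"
proof -
  let ?M = "cell_measure per"
  let ?D = "\<lambda>w. X \<inter> (\<lambda>x. x + w) ` X"
  note [measurable] = u(1)
  have Xo: "open X" using X by (simp add: open_domain_def)
  then have Xb [measurable]: "X \<in> sets borel" by simp
  have D_iff: "x \<in> ?D w \<longleftrightarrow> x \<in> X \<and> x - w \<in> X" for x w
    by (auto simp: image_iff) (metis diff_add_cancel)
  have "open (?D w)" for w using Xo by (intro open_Int open_translation_subtract[of X "- w", simplified])
  then have Db [measurable]: "?D w \<in> sets borel" for w by simp
  have ui [measurable]: "(\<lambda>x. u x $ i) \<in> borel_measurable borel" for i
    by (rule borel_measurable_vec_component[OF u(1)])
  have uiw: "(\<lambda>x. u (x - w) $ i) \<in> borel_measurable borel" for i w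
    by (rule measurable_compose[OF _ ui]) simp
  note [measurable] = uiw
  have Lq: "set_integrable lebesgue (X \<inter> period_cell per) (\<lambda>x. \<bar>U x $ i\<bar> powr 3)" for i
    using U unfolding besov_maps_def besov_def Lq_space_def by auto
  have comp: "integrable ?M (\<lambda>x. indicator X x * \<bar>u x $ i\<bar> ^ 3)" for i
  proof -
    have "AE x in lborel. x \<in> X \<longrightarrow> \<bar>U x $ i\<bar> powr 3 = \<bar>u x $ i\<bar> ^ 3"
      using u(3) by eventually_elim simp
    from lebesgue_cell_version(1)[OF Xb _ this, of per] Lq[of i] show ?thesis by simp
  qed
  show L3: "integrable ?M (\<lambda>x. indicator X x * norm (u x) ^ 3)"
  proof (rule Bochner_Integration.integrable_bound)
    show "integrable ?M (\<lambda>x. real CARD('n) ^ 3 * (\<Sum>i\<in>UNIV. indicator X x * \<bar>u x $ i\<bar> ^ 3))"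
      by (intro integrable_mult_right Bochner_Integration.integrable_sum comp)
    show "(\<lambda>x. indicator X x * norm (u x) ^ 3) \<in> borel_measurable ?M"
      unfolding measurable_cong_sets[OF sets_cell_measure refl] by measurable
    show "AE x in ?M. norm (indicator X x * norm (u x) ^ 3)
        \<le> norm (real CARD('n) ^ 3 * (\<Sum>i\<in>UNIV. indicator X x * \<bar>u x $ i\<bar> ^ 3))"
    proof (rule AE_I2)
      fix x
      have "indicator X x * norm (u x) ^ 3 \<le> indicator X x * (real CARD('n) ^ 3 * (\<Sum>i\<in>UNIV. \<bar>u x $ i\<bar> ^ 3))"
        by (intro mult_left_mono norm_cube_le_sum) auto
      then show "norm (indicator X x * norm (u x) ^ 3)
          \<le> norm (real CARD('n) ^ 3 * (\<Sum>i\<in>UNIV. indicator X x * \<bar>u x $ i\<bar> ^ 3))"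
        by (simp add: sum_distrib_left mult_ac)
    qed
  qed
  have Xper: "periodic per (\<lambda>x. indicator X x * norm (u x) ^ 3)"
    using u(2) open_domain_translate_iff[OF X] by (simp add: periodic_def indicator_def)
  have L3w: "integrable ?M (\<lambda>x. indicator X (x - w) * norm (u (x - w)) ^ 3)" for w
    using cell_translate(1)[OF per _ Xper, of "- w"] L3 by simp
  show I: "integrable ?M (\<lambda>x. indicator (?D w) x * norm (u (x - w) - u x) ^ 3)" for w
  proof (rule Bochner_Integration.integrable_bound)
    show "integrable ?M (\<lambda>x. 4 * (indicator X (x - w) * norm (u (x - w)) ^ 3 + indicator X x * norm (u x) ^ 3))"
      using L3 L3w by (intro integrable_mult_right Bochner_Integration.integrable_add)
    have "(\<lambda>x. u (x - w)) \<in> borel_measurable borel" by (rule measurable_compose[OF _ u(1)]) simp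
    then show "(\<lambda>x. indicator (?D w) x * norm (u (x - w) - u x) ^ 3) \<in> borel_measurable ?M"
      unfolding measurable_cong_sets[OF sets_cell_measure refl] by measurable
    show "AE x in ?M. norm (indicator (?D w) x * norm (u (x - w) - u x) ^ 3)
        \<le> norm (4 * (indicator X (x - w) * norm (u (x - w)) ^ 3 + indicator X x * norm (u x) ^ 3))"
    proof (rule AE_I2)
      fix x
      have "norm (u (x - w) - u x) ^ 3 \<le> (norm (u (x - w)) + norm (u x)) ^ 3"
        by (intro power_mono norm_triangle_ineq4) auto
      also have "\<dots> \<le> 4 * (norm (u (x - w)) ^ 3 + norm (u x) ^ 3)" by (intro power3_add_le) auto
      finally show "norm (indicator (?D w) x * norm (u (x - w) - u x) ^ 3)
        \<le> norm (4 * (indicator X (x - w) * norm (u (x - w)) ^ 3 + indicator X x * norm (u x) ^ 3))"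
        using D_iff[of x w] by (cases "x \<in> ?D w") auto
    qed
  qed
  let ?J = "\<lambda>i w. LINT x|?M. indicator (?D w) x * \<bar>u x $ i - u (x - w) $ i\<bar> ^ 3"
  have Ji: "integrable ?M (\<lambda>x. indicator (?D w) x * \<bar>u x $ i - u (x - w) $ i\<bar> ^ 3)" for i w
  proof (rule Bochner_Integration.integrable_bound[OF I])
    show "(\<lambda>x. indicator (?D w) x * \<bar>u x $ i - u (x - w) $ i\<bar> ^ 3) \<in> borel_measurable ?M"
      unfolding measurable_cong_sets[OF sets_cell_measure refl] by measurable
    have "\<bar>u x $ i - u (x - w) $ i\<bar> ^ 3 \<le> norm (u (x - w) - u x) ^ 3" for x
      using component_le_norm_cart[of "u (x - w) - u x" i] by (intro power_mono) (auto simp: abs_minus_commute)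
    then show "AE x in ?M. norm (indicator (?D w) x * \<bar>u x $ i - u (x - w) $ i\<bar> ^ 3)
        \<le> norm (indicator (?D w) x * norm (u (x - w) - u x) ^ 3)"
      by (intro AE_I2) (auto simp: abs_mult intro!: mult_left_mono)
  qed
  have "\<forall>i. \<exists>M. 0 \<le> M \<and> (\<forall>w. w \<noteq> 0 \<longrightarrow> ?J i w \<le> M * norm w powr (3 * \<alpha>))"
  proof
    fix i
    have "bdd_above ((\<lambda>\<xi>. norm \<xi> powr (-\<alpha>) *
             Lq_norm 3 (X \<inter> (\<lambda>x. x + \<xi>) ` X \<inter> period_cell per) (\<lambda>x. U x $ i - U (x - \<xi>) $ i)) ` {\<xi>. \<xi> \<noteq> 0})"
    proof -
      have "(\<lambda>x. U x $ i) \<in> besov \<alpha> 3 per X" using U by (simp add: besov_maps_def)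
      then show ?thesis unfolding besov_def mem_Collect_eq by (elim conjE)
    qed
    then obtain M where M: "\<And>w. w \<noteq> 0 \<Longrightarrow> norm w powr (-\<alpha>) *
             Lq_norm 3 (?D w \<inter> period_cell per) (\<lambda>x. U x $ i - U (x - w) $ i) \<le> M"
      unfolding bdd_above_def by auto
    have "?J i w \<le> (max M 0) ^ 3 * norm w powr (3 * \<alpha>)" if w: "w \<noteq> 0" for w
    proof -
      have "AE x in lborel. x - w \<in> X \<longrightarrow> u (x - w) = U (x - w)"
        using AE_lborel_translate[OF u(3), of "- w"] by simp
      with u(3) have "AE x in lborel. x \<in> ?D w \<longrightarrow> \<bar>U x $ i - U (x - w) $ i\<bar> powr 3 = \<bar>u x $ i - u (x - w) $ i\<bar> ^ 3"
        by eventually_elim (auto simp: D_iff)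
      from lebesgue_cell_version(2)[OF Db _ this, of per]
      have J: "(LINT x : ?D w \<inter> period_cell per | lebesgue. \<bar>U x $ i - U (x - w) $ i\<bar> powr 3) = ?J i w"
        by simp
      have J0: "0 \<le> ?J i w" by (intro Bochner_Integration.integral_nonneg) auto
      have "norm w powr (-\<alpha>) * ?J i w powr (1 / 3) \<le> M"
        using M[OF w] unfolding Lq_norm_def J .
      then have "norm w powr \<alpha> * (norm w powr (-\<alpha>) * ?J i w powr (1 / 3)) \<le> norm w powr \<alpha> * max M 0"
        by (intro mult_left_mono) auto
      moreover have "norm w powr \<alpha> * norm w powr (-\<alpha>) = 1"
        using w by (simp add: powr_minus)
      ultimately have "?J i w powr (1 / 3) \<le> max M 0 * norm w powr \<alpha>"
        by (simp only: mult.assoc[symmetric] mult_1_left mult.commute[of "max M 0"])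
      then have "(?J i w powr (1 / 3)) ^ 3 \<le> (max M 0 * norm w powr \<alpha>) ^ 3" by (intro power_mono) auto
      moreover have "(?J i w powr (1 / 3)) ^ 3 = ?J i w"
        using J0 unfolding powr_cube by simp
      ultimately show ?thesis by (simp only: power_mult_distrib powr_cube)
    qed
    then show "\<exists>M. 0 \<le> M \<and> (\<forall>w. w \<noteq> 0 \<longrightarrow> ?J i w \<le> M * norm w powr (3 * \<alpha>))"
      by (intro exI[of _ "(max M 0) ^ 3"]) auto
  qed
  from choice[OF this] obtain A where A: "\<And>i. 0 \<le> A i"
    "\<And>i w. w \<noteq> 0 \<Longrightarrow> ?J i w \<le> A i * norm w powr (3 * \<alpha>)" by blast
  show "\<exists>A\<ge>0. \<forall>w. w \<noteq> 0 \<longrightarrow> (LINT x|?M. indicator (?D w) x * norm (u (x - w) - u x) ^ 3) \<le> A * norm w powr (3 * \<alpha>)"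
  proof (intro exI[of _ "real CARD('n) ^ 3 * sum A UNIV"] conjI allI impI)
    show "0 \<le> real CARD('n) ^ 3 * sum A UNIV" using A(1) by (simp add: sum_nonneg)
    fix w :: "real^'m" assume w: "w \<noteq> 0"
    have "(LINT x|?M. indicator (?D w) x * norm (u (x - w) - u x) ^ 3)
        \<le> (LINT x|?M. real CARD('n) ^ 3 * (\<Sum>i\<in>UNIV. indicator (?D w) x * \<bar>u x $ i - u (x - w) $ i\<bar> ^ 3))"
    proof (rule integral_mono[OF I])
      show "integrable ?M (\<lambda>x. real CARD('n) ^ 3 * (\<Sum>i\<in>UNIV. indicator (?D w) x * \<bar>u x $ i - u (x - w) $ i\<bar> ^ 3))"
        by (intro integrable_mult_right Bochner_Integration.integrable_sum Ji)
      fix x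
      have "indicator (?D w) x * norm (u (x - w) - u x) ^ 3
          \<le> indicator (?D w) x * (real CARD('n) ^ 3 * (\<Sum>i\<in>UNIV. \<bar>(u (x - w) - u x) $ i\<bar> ^ 3))"
        by (intro mult_left_mono norm_cube_le_sum) auto
      then show "indicator (?D w) x * norm (u (x - w) - u x) ^ 3
          \<le> real CARD('n) ^ 3 * (\<Sum>i\<in>UNIV. indicator (?D w) x * \<bar>u x $ i - u (x - w) $ i\<bar> ^ 3)"
        by (simp only: sum_distrib_left[symmetric] mult.left_commute[of "real CARD('n) ^ 3"]
            vector_minus_component abs_minus_commute)
    qed
    also have "\<dots> = real CARD('n) ^ 3 * (\<Sum>i\<in>UNIV. ?J i w)"
      unfolding integral_mult_right_zero by (subst Bochner_Integration.integral_sum) (rule Ji, rule refl)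
    also have "\<dots> \<le> real CARD('n) ^ 3 * (\<Sum>i\<in>UNIV. A i * norm w powr (3 * \<alpha>))"
      using A(2)[OF w] by (intro mult_left_mono sum_mono) auto
    finally show "(LINT x|?M. indicator (?D w) x * norm (u (x - w) - u x) ^ 3)
        \<le> real CARD('n) ^ 3 * sum A UNIV * norm w powr (3 * \<alpha>)"
      by (simp add: sum_distrib_right mult.assoc)
  qed
qed

text \<open>A ball whose diameter is at most every period fits into a translate of the cell.\<close>

lemma ball_integrable_of_cell:
  fixes f :: "real^'m::finite \<Rightarrow> real"
  assumes per: "\<And>j. 0 \<le> per j" and f: "f \<in> borel_measurable borel" "periodic per f" "integrable (cell_measure per) f"
    and r: "\<And>j. per j \<noteq> 0 \<Longrightarrow> 4 * r \<le> per j"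
  shows "set_integrable lborel (ball x (2 * r)) f"
proof -
  define w where "w = (\<chi> j. if per j = 0 then 0 else per j / 2 - x $ j)"
  have "integrable (cell_measure per) (\<lambda>y. f (y - w))"
    using cell_translate(1)[OF per f(1,2), of "- w"] f(3) by simp
  then have "integrable lborel (\<lambda>y. indicator (period_cell per) y *\<^sub>R f (y - w))"
    using f(1) by (subst (asm) integrable_cell_measure(1)) (simp_all add: set_integrable_def)
  then have "integrable lborel (\<lambda>y. indicator (period_cell per) (y + w) *\<^sub>R f y)"
    using f(1) integrable_lborel_translate[of "\<lambda>y. indicator (period_cell per) y *\<^sub>R f (y - w)" w] by simp
  moreover have "(\<lambda>y. indicator (period_cell per) (y + w) *\<^sub>R f y) = (\<lambda>y. indicator {y. y + w \<in> period_cell per} y *\<^sub>R f y)"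
    by (simp add: indicator_def)
  ultimately have i: "set_integrable lborel {y. y + w \<in> period_cell per} f"
    by (simp add: set_integrable_def)
  have "ball x (2 * r) \<subseteq> {y. y + w \<in> period_cell per}"
  proof
    fix y assume "y \<in> ball x (2 * r)"
    then have "\<bar>y $ j - x $ j\<bar> < 2 * r" for j
      using component_le_norm_cart[of "y - x" j] by (simp add: dist_norm norm_minus_commute)
    then have y: "\<bar>y $ j - x $ j\<bar> < per j / 2" if "per j \<noteq> 0" for j
      using r[OF that] by (smt (verit) field_sum_of_halves)
    have "0 \<le> (y + w) $ j \<and> (y + w) $ j < per j" if "per j \<noteq> 0" for j
    proof -
      have "(y + w) $ j = (y $ j - x $ j) + per j / 2" using that by (simp add: w_def)
      then show ?thesis using y[OF that] by linarith
    qed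
    then show "y \<in> {y. y + w \<in> period_cell per}" by (simp add: period_cell_def)
  qed
  then show ?thesis by (rule set_integrable_subset[OF i, rotated]) simp
qed

section \<open>The companion law\<close>

lemma jacobian_component: "jacobian f (at x) $ i $ j = frechet_derivative f (at x) (axis j 1) $ i"
  by (simp add: jacobian_def matrix_def)

text \<open>The companion relation between Jacobians, read componentwise.\<close>

lemma column_companion_derivative:
  fixes G :: "real^'n::finite \<Rightarrow> real^'m::finite^'n" and Q :: "real^'n \<Rightarrow> real^'m^1" and B :: "real^'n \<Rightarrow> real^'n^1"
  assumes G: "G differentiable (at v)" and Q: "(\<lambda>W. column j (Q W)) differentiable (at v)"
    and eq: "jacobian (\<lambda>W. column j (Q W)) (at v) = B v ** jacobian (\<lambda>W. column j (G W)) (at v)"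
  shows "((\<lambda>v. Q v $ 1 $ j) has_derivative
    (\<lambda>h. \<Sum>i\<in>UNIV. B v $ 1 $ i * frechet_derivative G (at v) h $ i $ j)) (at v)"
proof -
  let ?DQ = "frechet_derivative (\<lambda>W. column j (Q W)) (at v)"
  let ?DG = "frechet_derivative (\<lambda>W. column j (G W)) (at v)"
  have col: "bounded_linear (\<lambda>A::real^'m^'n. column j A)"
  proof -
    have "linear (\<lambda>A::real^'m^'n. column j A)"
      by (rule linearI) (simp_all add: column_def vec_eq_iff)
    then show ?thesis by (simp add: linear_conv_bounded_linear)
  qed
  have "(G has_derivative frechet_derivative G (at v)) (at v)"
    using G by (simp flip: frechet_derivative_works)
  from bounded_linear.has_derivative[OF col this]
  have DG: "((\<lambda>W. column j (G W)) has_derivative (\<lambda>h. column j (frechet_derivative G (at v) h))) (at v)" .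
  then have DG_eq: "?DG = (\<lambda>h. column j (frechet_derivative G (at v) h))"
    by (simp add: frechet_derivative_at[symmetric])
  have DQ: "((\<lambda>W. column j (Q W)) has_derivative ?DQ) (at v)"
    using Q by (simp flip: frechet_derivative_works)
  have "?DQ h = B v *v ?DG h" for h
  proof -
    have "?DQ h = jacobian (\<lambda>W. column j (Q W)) (at v) *v h"
      unfolding jacobian_def
      by (rule fun_cong[OF matrix_vector_mul(2)[OF has_derivative_linear[OF DQ]], symmetric])
    also have "\<dots> = B v *v (jacobian (\<lambda>W. column j (G W)) (at v) *v h)"
      by (simp add: eq matrix_vector_mul_assoc)
    also have "jacobian (\<lambda>W. column j (G W)) (at v) *v h = ?DG h"
      unfolding jacobian_def DG_eq
      by (rule fun_cong[OF matrix_vector_mul(2)[OF has_derivative_linear[OF DG]]])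
    finally show ?thesis .
  qed
  then have "?DQ h $ 1 = (\<Sum>i\<in>UNIV. B v $ 1 $ i * frechet_derivative G (at v) h $ i $ j)" for h
    by (simp only: DG_eq matrix_vector_mult_def vec_lambda_beta) (simp only: column_def vec_lambda_beta)
  moreover have "((\<lambda>W. column j (Q W) $ 1) has_derivative (\<lambda>h. ?DQ h $ 1)) (at v)"
    by (rule bounded_linear.has_derivative[OF bounded_linear_vec_nth DQ])
  ultimately show ?thesis by (simp add: column_def)
qed

lemma compact_enlarge_in_open:
  fixes K :: "'a::euclidean_space set"
  assumes "compact K" "open X" "K \<subseteq> X"
  obtains \<delta> where "0 < \<delta>" "compact {y + v |y v. y \<in> K \<and> v \<in> cball 0 \<delta>}" "{y + v |y v. y \<in> K \<and> v \<in> cball 0 \<delta>} \<subseteq> X"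
proof -
  obtain \<delta> where \<delta>: "0 < \<delta>" "(\<Union>x\<in>K. cball x \<delta>) \<subseteq> X"
    using compact_subset_open_imp_cball_epsilon_subset[OF assms] by metis
  show thesis
  proof (rule that[OF \<delta>(1)])
    show "compact {y + v |y v. y \<in> K \<and> v \<in> cball 0 \<delta>}"
      using compact_sums[OF assms(1) compact_cball[of 0 \<delta>]] by simp
    show "{y + v |y v. y \<in> K \<and> v \<in> cball 0 \<delta>} \<subseteq> X"
    proof clarify
      fix y v assume "y \<in> K" "v \<in> cball (0::'a) \<delta>"
      then have "y + v \<in> cball y \<delta>" by (simp add: dist_norm)
      with \<delta>(2) \<open>y \<in> K\<close> show "y + v \<in> X" by blast
    qed
  qed
qed

lemma orbit_subset:
  assumes "open_domain per X" "K \<subseteq> X" shows "orbit per K \<subseteq> X"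
  using assms unfolding open_domain_def orbit_def by auto

theorem theorem1p2:
  fixes \<O> :: "(real^'n::finite) set"
    and t :: "'m::finite"
    and per :: "'m \<Rightarrow> real"
    and \<X> :: "(real^'m) set"
    and \<alpha> :: real
    and G :: "real^'n \<Rightarrow> real^'m^'n"
    and U :: "real^'m \<Rightarrow> real^'n"
    and Q :: "real^'n \<Rightarrow> real^'m^1"
    and \<B> :: "real^'n \<Rightarrow> real^'n^1"
  assumes "open \<O>"
    and "euclidean_periods per \<or> cylinder_periods t per"
    and "open_domain per \<X>"
    and "0 < \<alpha>" and "\<alpha> < 1" and "\<alpha> > 1 / 3"
    and "C_on 2 G \<O>"
    and "U \<in> besov_maps \<alpha> 3 per \<X> \<O>"
    and "weak_solution per \<X> \<O> G U"
    and "continuous_on \<O> Q"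
    and "C_on 1 \<B> \<O>"
    and companion: "\<And>V j. V \<in> \<O> \<Longrightarrow>
          (\<lambda>W. column j (Q W)) differentiable (at V) \<and>
          jacobian (\<lambda>W. column j (Q W)) (at V) =
            \<B> V ** jacobian (\<lambda>W. column j (G W)) (at V)"
    and "convex \<O>"
    and "\<B> \<in> W1inf_space \<O>"
    and "\<exists>C. \<forall>V\<in>\<O>. norm (Q V) \<le> C * (1 + norm V ^ 3)"
    and "bdd_above {norm (partial_deriv (axis i 1) (partial_deriv (axis j 1) G) V) | i j V. V \<in> \<O>}"
  shows "weak_solution per \<X> \<O> Q U"
proof (cases "\<X> = {}")
  case True
  then show ?thesis
    using assms(9) unfolding weak_solution_def locally_integrable_on_def
    by (simp add: set_integrable_def set_lebesgue_integral_def maps_on_def)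
next
  case False
  let ?M = "cell_measure per"
  note \<O> = \<open>open \<O>\<close> \<open>convex \<O>\<close>
  note X = \<open>open_domain per \<X>\<close>
  have Xo: "open \<X>" using X by (simp add: open_domain_def)
  then have Xb [measurable]: "\<X> \<in> sets borel" by simp
  have per: "0 \<le> per j" for j
    using assms(2) unfolding euclidean_periods_def cylinder_periods_def by (metis less_eq_real_def)
  have UX: "U \<in> maps_on per \<X> \<O>" using assms(8) by (simp add: besov_maps_def)
  obtain x0 where "x0 \<in> \<X>" using False by blast
  then have v0: "U x0 \<in> \<O>" using UX unfolding maps_on_def by blast
  have "set_borel_measurable lebesgue (\<X> \<inter> period_cell per) (\<lambda>x. U x $ i)" for i
  proof -
    have "(\<lambda>x. U x $ i) \<in> besov \<alpha> 3 per \<X>" using assms(8) by (simp add: besov_maps_def)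
    then show ?thesis unfolding besov_def Lq_space_def by simp
  qed
  from periodic_borel_version[of per, OF per X UX \<O>(1) v0 this]
  obtain u where u [measurable]: "u \<in> borel_measurable borel" and uper: "periodic per u"
    and uin: "\<And>x. u x \<in> \<O>" and uout: "\<And>x. x \<notin> \<X> \<Longrightarrow> u x = U x0"
    and uU: "AE x in lborel. x \<in> \<X> \<longrightarrow> u x = U x" by blast
  note bounds = besov_cell_bounds[of per, OF per X assms(8) u uper uU]
  obtain A where A: "0 \<le> A" "\<And>w. w \<noteq> 0 \<Longrightarrow>
      (LINT x|?M. indicator (\<X> \<inter> (\<lambda>x. x + w) ` \<X>) x * norm (u (x - w) - u x) ^ 3) \<le> A * norm w powr (3 * \<alpha>)"
    using bounds(3) by blast
  \<comment> \<open>at most a quarter of each period, so that balls of radius \<open>2 r0\<close> fit into a cell\<close>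
  define r0 where "r0 = Min (insert 1 ((\<lambda>j. per j / 4) ` {j. per j \<noteq> 0}))"
  have r0: "0 < r0" "per j \<noteq> 0 \<Longrightarrow> 4 * r0 \<le> per j" for j
  proof -
    have "\<forall>a\<in>insert 1 ((\<lambda>j. per j / 4) ` {j. per j \<noteq> 0}). 0 < a"
      using per by (auto simp: less_le)
    then show "0 < r0" unfolding r0_def by (subst Min_gr_iff) auto
    show "4 * r0 \<le> per j" if "per j \<noteq> 0"
    proof -
      have "r0 \<le> per j / 4" unfolding r0_def using that by (intro Min_le) auto
      then show ?thesis by simp
    qed
  qed
  have Xind_per: "periodic per (\<lambda>x. indicator \<X> x * norm (u x) ^ 3)"
    using uper open_domain_translate_iff[OF X] by (simp add: periodic_def indicator_def)
  have ind_u: "set_integrable lborel (ball x (2 * r0)) (\<lambda>y. indicator \<X> y * norm (u y) ^ 3)" for x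
    by (rule ball_integrable_of_cell[of per, OF per _ Xind_per bounds(1) r0(2)]) measurable
  have uball: "set_integrable lborel (ball x (2 * r0)) (\<lambda>y. norm (u y) ^ 3)" for x
    unfolding set_integrable_def
  proof (rule integrable_dominated)
    show "integrable lborel (\<lambda>y. indicator (ball x (2 * r0)) y *\<^sub>R (indicator \<X> y * norm (u y) ^ 3)
        + norm (U x0) ^ 3 * indicator (ball x (2 * r0)) y)"
      using ind_u[of x] emeasure_bounded_finite[OF bounded_ball, of x "2 * r0"]
      unfolding set_integrable_def
      by (intro Bochner_Integration.integrable_add integrable_mult_right) (simp_all add: integrable_indicator_iff)
    show "norm (indicator (ball x (2 * r0)) y *\<^sub>R norm (u y) ^ 3)
        \<le> norm (indicator (ball x (2 * r0)) y *\<^sub>R (indicator \<X> y * norm (u y) ^ 3)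
        + norm (U x0) ^ 3 * indicator (ball x (2 * r0)) y)" for y
      using uout[of y] by (cases "y \<in> \<X>"; cases "y \<in> ball x (2 * r0)") auto
    have "ball x (2 * r0) \<in> sets borel" by simp
    then show "(\<lambda>y. indicator (ball x (2 * r0)) y *\<^sub>R norm (u y) ^ 3) \<in> borel_measurable lborel" by measurable
  qed
  obtain M where M: "norm (partial_deriv (axis i 1) (partial_deriv (axis j 1) G) V) \<le> M" if "V \<in> \<O>" for i j V
    using assms(16) unfolding bdd_above_def by blast
  have axisE: "\<exists>k. i = axis k (1::real)" if "i \<in> Basis" for i :: "real^'n"
    using that by (auto simp: Basis_vec_def)
  obtain cG where cG: "0 \<le> cG"
    "\<And>v w h. v \<in> \<O> \<Longrightarrow> w \<in> \<O> \<Longrightarrow>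
       norm (frechet_derivative G (at w) h - frechet_derivative G (at v) h) \<le> cG * norm (w - v) * norm h"
    "\<And>v w. v \<in> \<O> \<Longrightarrow> w \<in> \<O> \<Longrightarrow>
       norm (G w - G v - frechet_derivative G (at v) (w - v)) \<le> cG * (norm (w - v))\<^sup>2"
  proof (rule Taylor2_C_on[OF \<open>C_on 2 G \<O>\<close> \<O>(2,1)])
    show "norm (partial_deriv i (partial_deriv j G) x) \<le> M" if "i \<in> Basis" "j \<in> Basis" "x \<in> \<O>" for i j x
      using axisE[OF that(1)] axisE[OF that(2)] M[OF that(3)] by auto
  qed (auto intro: that)
  have G_diff: "G differentiable (at v)" if "v \<in> \<O>" for v
    using \<open>C_on 2 G \<O>\<close> that by (simp add: numeral_2_eq_2)
  have G_cont: "continuous_on \<O> G"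
    using G_diff by (simp add: continuous_at_imp_continuous_on differentiable_imp_continuous_within)
  define b where "b v = \<B> v $ 1" for v
  define q where "q v = Q v $ 1" for v
  have b_C1: "C_on 1 b \<O>"
    unfolding b_def[abs_def] by (rule C_on_bounded_linear[OF bounded_linear_vec_nth \<O>(1) \<open>C_on 1 \<B> \<O>\<close>])
  have B_diff: "\<B> differentiable (at v)" if "v \<in> \<O>" for v
    using \<open>C_on 1 \<B> \<O>\<close> that by simp
  obtain C1 where C1: "0 \<le> C1" "\<And>v. v \<in> \<O> \<Longrightarrow> norm (\<B> v) \<le> C1"
  proof (rule Linf_continuous_bounded[OF \<O>(1)])
    show "continuous_on \<O> \<B>"
      using B_diff by (simp add: continuous_at_imp_continuous_on differentiable_imp_continuous_within)
    show "\<B> \<in> Linf_space \<O>" using assms(14) by (simp add: W1inf_space_def)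
  qed (auto intro: that)
  obtain C2 where C2: "0 \<le> C2" "\<And>i v. v \<in> \<O> \<Longrightarrow> norm (partial_deriv (axis i 1) \<B> v) \<le> C2"
    using W1inf_partial_deriv_bounded[OF \<O>(1) \<open>C_on 1 \<B> \<O>\<close> assms(14)] by blast
  define Cb where "Cb = C1 + real DIM(real^'n) * C2"
  have Cb0: "0 \<le> Cb" using C1 C2 by (simp add: Cb_def)
  have Cb1: "norm (b v) \<le> Cb" if "v \<in> \<O>" for v
  proof -
    have "norm (b v) \<le> norm (\<B> v)" unfolding b_def by (rule Finite_Cartesian_Product.norm_nth_le)
    also have "\<dots> \<le> Cb" using C1(2)[OF that] C2(1) unfolding Cb_def by (intro add_increasing2) auto
    finally show ?thesis .
  qed
  have Cb2: "norm (frechet_derivative b (at v) h) \<le> Cb * norm h" if v: "v \<in> \<O>" for v h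
  proof -
    have "(\<B> has_derivative frechet_derivative \<B> (at v)) (at v)"
      using B_diff[OF v] by (simp flip: frechet_derivative_works)
    from bounded_linear.has_derivative[OF bounded_linear_vec_nth this]
    have "(b has_derivative (\<lambda>h. frechet_derivative \<B> (at v) h $ 1)) (at v)" unfolding b_def[abs_def] .
    then have "frechet_derivative b (at v) h = frechet_derivative \<B> (at v) h $ 1"
      by (simp add: frechet_derivative_at[symmetric])
    then have "norm (frechet_derivative b (at v) h) \<le> norm (frechet_derivative \<B> (at v) h)"
      by (simp add: Finite_Cartesian_Product.norm_nth_le)
    also have "\<dots> \<le> real DIM(real^'n) * C2 * norm h"
      by (rule norm_frechet_derivative_le_sum[OF B_diff[OF v]]) (use axisE C2(2)[OF v] in blast)
    also have "\<dots> \<le> Cb * norm h" using C1(1) unfolding Cb_def by (intro mult_right_mono) auto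
    finally show ?thesis .
  qed
  have q_deriv: "((\<lambda>v. q v $ j) has_derivative
      (\<lambda>h. \<Sum>i\<in>UNIV. b v $ i * frechet_derivative G (at v) h $ i $ j)) (at v)" if "v \<in> \<O>" for v j
    unfolding q_def b_def using companion[OF that, of j]
    by (intro column_companion_derivative G_diff that) auto
  have Gu: "(\<lambda>x. G (u x)) \<in> borel_measurable borel"
    by (intro borel_comp_continuous_on[OF G_cont] borel_open \<O> u uin)
  have Qu [measurable]: "(\<lambda>x. Q (u x)) \<in> borel_measurable borel"
    by (intro borel_comp_continuous_on[OF \<open>continuous_on \<O> Q\<close>] borel_open \<O> u uin)
  show ?thesis
    unfolding weak_solution_def
  proof (intro conjI ballI)
    show "U \<in> maps_on per \<X> \<O>" by (fact UX)
    show "locally_integrable_on (\<lambda>x. Q (U x)) \<X>"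
      unfolding locally_integrable_on_def
    proof (intro allI impI, elim conjE)
      fix K assume K: "compact K" "K \<subseteq> \<X>"
      obtain C where C: "\<And>V. V \<in> \<O> \<Longrightarrow> norm (Q V) \<le> C * (1 + norm V ^ 3)" using assms(15) by blast
      obtain D where D: "finite D" "K \<subseteq> (\<Union>x\<in>D. ball x (2 * r0))"
      proof (rule compactE_image[OF K(1), of K "\<lambda>x. ball x (2 * r0)"])
        show "K \<subseteq> (\<Union>x\<in>K. ball x (2 * r0))" using r0(1) by auto
      qed (auto intro: that)
      let ?T = "\<Union>x\<in>D. ball x (2 * r0)"
      have T: "?T \<in> sets borel" by (intro borel_open open_UN) auto
      have i1: "set_integrable lborel ?T (\<lambda>y. norm (u y) ^ 3)"
        by (rule set_integrable_UN[OF D(1) uball]) auto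
      have "bounded ?T" using D(1) by auto
      from emeasure_bounded_finite[OF this] have i2: "integrable lborel (indicator ?T :: _ \<Rightarrow> real)"
        using T by (simp add: integrable_indicator_iff)
      have Kb: "K \<in> sets borel" using K(1) by (simp add: borel_compact)
      have "set_integrable lborel K (\<lambda>y. Q (u y))"
        unfolding set_integrable_def
      proof (rule integrable_dominated)
        show "integrable lborel (\<lambda>y. C * (indicator ?T y + indicator ?T y *\<^sub>R norm (u y) ^ 3))"
          using i1 i2 unfolding set_integrable_def
          by (intro integrable_mult_right Bochner_Integration.integrable_add)
        show "norm (indicator K y *\<^sub>R Q (u y)) \<le> norm (C * (indicator ?T y + indicator ?T y *\<^sub>R norm (u y) ^ 3))" for y
        proof (cases "y \<in> K")
          case True
          then have "y \<in> ?T" using D(2) by blast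
          then have "indicator ?T y = (1::real)" by (rule indicator_simps)
          with True show ?thesis using order_trans[OF C[OF uin[of y]] abs_ge_self] by (simp add: abs_mult)
        qed simp
        show "(\<lambda>y. indicator K y *\<^sub>R Q (u y)) \<in> borel_measurable lborel" using Kb by measurable
      qed
      moreover have "AE x in lborel. x \<in> K \<longrightarrow> Q (U x) = Q (u x)"
        using uU K(2) by (auto elim!: eventually_mono)
      ultimately show "set_integrable lebesgue K (\<lambda>x. Q (U x))"
        by (simp only: lebesgue_borel_version(1)[OF Kb Qu])
    qed
    fix \<psi> :: "real^'m \<Rightarrow> real^1" assume \<psi>: "\<psi> \<in> test_functions per \<X>"
    then obtain K where K: "compact K" "K \<subseteq> \<X>" and \<psi>K: "\<And>x. x \<in> \<X> \<Longrightarrow> \<psi> x \<noteq> 0 \<Longrightarrow> x \<in> orbit per K"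
      unfolding test_functions_def orbit_iff by blast
    have \<psi>per: "\<psi> (x + z) = \<psi> x" if "x \<in> \<X>" "z \<in> period_lattice per" for x z
      using \<psi> that unfolding test_functions_def maps_on_def by blast
    have \<psi>C1: "C_on 1 \<psi> \<X>" using \<psi> unfolding test_functions_def smooth_on_def by blast
    have SX: "orbit per K \<subseteq> \<X>" by (rule orbit_subset[OF X K(2)])
    \<comment> \<open>the scalar test function, extended by zero to the whole space\<close>
    define \<psi>0 where "\<psi>0 x = (if x \<in> \<X> then \<psi> x $ 1 else 0)" for x
    have \<psi>0_out: "\<psi>0 x = 0" if "x \<notin> orbit per K" for x
      using \<psi>K[of x] that by (cases "\<psi> x = 0") (auto simp: \<psi>0_def)
    have \<psi>0_per: "periodic per \<psi>0"
      using \<psi>per open_domain_translate_iff[OF X] by (simp add: periodic_def \<psi>0_def)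
    have \<psi>0_C1: "C_on 1 \<psi>0 UNIV"
    proof -
      have o: "open (- orbit per K)" using orbit_closed[OF K(1)] by auto
      have "C_on 1 \<psi>0 \<X>"
        by (rule C_on_cong[OF Xo _ C_on_bounded_linear[OF bounded_linear_vec_nth[of 1] Xo \<psi>C1]]) (simp add: \<psi>0_def)
      moreover have "C_on 1 \<psi>0 (- orbit per K)"
        by (rule C_on_cong[OF o _ C_on_const[of 1 0]]) (simp add: \<psi>0_out)
      ultimately have "C_on 1 \<psi>0 (\<X> \<union> - orbit per K)" by (rule C_on_Un[OF _ _ Xo o])
      moreover have "\<X> \<union> - orbit per K = UNIV" using SX by auto
      ultimately show ?thesis by simp
    qed
    obtain \<delta> where \<delta>: "0 < \<delta>" and K': "compact {y + v |y v. y \<in> K \<and> v \<in> cball 0 \<delta>}"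
      "{y + v |y v. y \<in> K \<and> v \<in> cball 0 \<delta>} \<subseteq> \<X>"
      using compact_enlarge_in_open[OF K(1) Xo K(2)] .
    have S'X: "orbit per {y + v |y v. y \<in> K \<and> v \<in> cball 0 \<delta>} \<subseteq> \<X>" by (rule orbit_subset[OF X K'(2)])
    have Sb [measurable]: "orbit per K \<in> sets borel" by (rule orbit_borel[OF K(1)])
    \<comment> \<open>on the support of \<open>\<psi>\<close> small increments are among those that the Besov seminorm measures\<close>
    have SD: "orbit per K \<subseteq> \<X> \<inter> (\<lambda>x. x + w) ` \<X>" if w: "norm w \<le> \<delta>" for w
    proof
      fix x assume x: "x \<in> orbit per K"
      have "x + - w \<in> \<X>" using orbit_enlarge[OF x, of "- w" \<delta>] w S'X by auto
      then have "x = (x - w) + w" "x - w \<in> \<X>" by auto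
      then show "x \<in> \<X> \<inter> (\<lambda>x. x + w) ` \<X>" using x SX by blast
    qed
    have ind_le: "indicator (orbit per K) x * c \<le> indicator (\<X> \<inter> (\<lambda>x. x + w) ` \<X>) x * c"
      if "norm w \<le> \<delta>" "0 \<le> c" for w x and c :: real
      using SD[OF that(1)] that(2) by (auto simp: indicator_def)
    have incr_m: "(\<lambda>x. indicator (orbit per K) x * norm (u (x - w) - u x) ^ 3) \<in> borel_measurable ?M" for w
    proof -
      have "(\<lambda>x. u (x - w)) \<in> borel_measurable borel" by (rule measurable_compose[OF _ u]) simp
      then show ?thesis unfolding measurable_cong_sets[OF sets_cell_measure refl] by measurable
    qed
    have besov1: "integrable ?M (\<lambda>x. indicator (orbit per K) x * norm (u (x - w) - u x) ^ 3)" if "norm w \<le> \<delta>" for w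
      by (rule Bochner_Integration.integrable_bound[OF bounds(2)[of w] incr_m])
        (use ind_le[OF that] in \<open>auto intro!: AE_I2 simp del: Int_iff\<close>)
    have besov2: "(LINT x|?M. indicator (orbit per K) x * norm (u (x - w) - u x) ^ 3) \<le> A * norm w powr (3 * \<alpha>)"
      if w: "norm w \<le> \<delta>" for w
    proof (cases "w = 0")
      case False
      have "(LINT x|?M. indicator (orbit per K) x * norm (u (x - w) - u x) ^ 3)
          \<le> (LINT x|?M. indicator (\<X> \<inter> (\<lambda>x. x + w) ` \<X>) x * norm (u (x - w) - u x) ^ 3)"
        using ind_le[OF w] by (intro integral_mono besov1[OF w] bounds(2)) auto
      with A(2)[OF False] show ?thesis by linarith
    qed (use A in simp)
    have uL3: "integrable ?M (\<lambda>x. indicator (orbit per K) x * norm (u x) ^ 3)"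
    proof (rule Bochner_Integration.integrable_bound[OF bounds(1)])
      show "(\<lambda>x. indicator (orbit per K) x * norm (u x) ^ 3) \<in> borel_measurable ?M"
        unfolding measurable_cong_sets[OF sets_cell_measure refl] by measurable
    qed (use SX in \<open>auto intro!: AE_I2 simp: indicator_def\<close>)
    have law: "(LINT x|?M. (\<Sum>i\<in>UNIV. \<Sum>j\<in>UNIV. G (u x) $ i $ j * partial_deriv (axis j 1) \<phi> x $ i)) = 0"
      if \<phi>: "\<And>m. C_on m \<phi> UNIV" "periodic per \<phi>"
        "\<And>x. x \<notin> orbit per {y + v |y v. y \<in> K \<and> v \<in> cball 0 \<delta>} \<Longrightarrow> \<phi> x = 0" for \<phi> :: "real^'m \<Rightarrow> real^'n"
    proof -
      let ?K' = "{y + v |y v. y \<in> K \<and> v \<in> cball 0 \<delta>}"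
      let ?h = "\<lambda>x. \<Sum>i\<in>UNIV. \<Sum>j\<in>UNIV. G (u x) $ i $ j * partial_deriv (axis j 1) \<phi> x $ i"
      have "\<phi> \<in> test_functions per \<X>"
        unfolding test_functions_def
      proof (intro CollectI conjI exI[of _ ?K'] ballI impI)
        show "\<phi> \<in> maps_on per \<X> UNIV" using \<phi>(2) by (simp add: maps_on_def periodic_def)
        show "smooth_on \<phi> \<X>" unfolding smooth_on_def using C_on_subset[OF \<phi>(1)] by blast
        show "\<exists>y\<in>?K'. \<exists>z\<in>period_lattice per. x = y + z" if "\<phi> x \<noteq> 0" for x
          using \<phi>(3)[of x] that unfolding orbit_iff by blast
      qed (use K' in auto)
      then have 0: "(LINT x : \<X> \<inter> period_cell per | lebesgue. G (U x) \<bullet> jacobian \<phi> (at x)) = 0"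
        using assms(9) unfolding weak_solution_def by blast
      have D\<phi>: "(\<lambda>x. partial_deriv (axis j 1) \<phi> x $ i) \<in> borel_measurable borel" for i j
      proof -
        have "C_on 0 (partial_deriv (axis j 1) \<phi>) UNIV" by (rule C_on_SucD[OF \<phi>(1)[of "Suc 0"]]) simp
        then show ?thesis
          by (intro borel_measurable_vec_component borel_measurable_continuous_onI) simp
      qed
      have h: "?h \<in> borel_measurable borel"
        by (intro borel_measurable_sum borel_measurable_times D\<phi> borel_measurable_vec_component Gu)
      have "AE x in lborel. x \<in> \<X> \<longrightarrow> G (U x) \<bullet> jacobian \<phi> (at x) = ?h x"
        using uU by eventually_elim (simp add: inner_vec_def jacobian_component partial_deriv_def)
      from lebesgue_cell_version(2)[OF Xb h this, of per] 0
      have "(LINT x|?M. indicator \<X> x *\<^sub>R ?h x) = 0" by simp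
      moreover have "indicator \<X> x *\<^sub>R ?h x = ?h x" for x
      proof (cases "x \<in> \<X>")
        case False
        then have "frechet_derivative \<phi> (at x) = (\<lambda>_. 0)"
          using S'X by (intro frechet_derivative_eq_0_outside[OF orbit_closed[OF K'(1)] _ \<phi>(3)]) auto
        then show ?thesis by (simp add: partial_deriv_def)
      qed simp
      ultimately show ?thesis by (simp only:)
    qed
    have core: "companion_law per u \<O> G b q \<psi>0 K r0 \<delta> A \<alpha> cG Cb"
      by (unfold_locales; fact per \<O> u uper uin r0(1) uball K(1) \<psi>0_per \<psi>0_C1 \<psi>0_out uL3 \<delta> besov1 besov2
          A(1) assms(6) G_diff cG b_C1 Cb0 Cb1 Cb2 q_deriv law)
    let ?h = "\<lambda>x. \<Sum>j\<in>UNIV. q (u x) $ j * frechet_derivative \<psi>0 (at x) (axis j 1)"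
    have D\<psi>0: "frechet_derivative \<psi>0 (at x) v = frechet_derivative \<psi> (at x) v $ 1" if x: "x \<in> \<X>" for x v
    proof -
      have "(\<psi> has_derivative frechet_derivative \<psi> (at x)) (at x)"
        using \<psi>C1 x by (simp flip: frechet_derivative_works)
      from bounded_linear.has_derivative[OF bounded_linear_vec_nth[of 1] this]
      have "(\<psi>0 has_derivative (\<lambda>v. frechet_derivative \<psi> (at x) v $ 1)) (at x)"
        by (rule has_derivative_transform_within_open[OF _ Xo x]) (simp add: \<psi>0_def)
      then show ?thesis by (simp add: frechet_derivative_at[symmetric])
    qed
    have ae: "AE x in lborel. x \<in> \<X> \<longrightarrow> Q (U x) \<bullet> jacobian \<psi> (at x) = ?h x"
      using uU by eventually_elim (simp add: inner_vec_def jacobian_component D\<psi>0 q_def sum_1)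
    have h: "?h \<in> borel_measurable borel"
    proof (intro borel_measurable_sum borel_measurable_times)
      fix j
      show "(\<lambda>x. q (u x) $ j) \<in> borel_measurable borel"
        unfolding q_def by (intro borel_measurable_vec_component Qu)
      have "C_on 0 (partial_deriv (axis j 1) \<psi>0) UNIV"
        by (rule C_on_SucD) (use \<psi>0_C1 in simp_all)
      then show "(\<lambda>x. frechet_derivative \<psi>0 (at x) (axis j 1)) \<in> borel_measurable borel"
        by (intro borel_measurable_continuous_onI) (simp add: partial_deriv_def[abs_def])
    qed
    have "indicator \<X> x *\<^sub>R ?h x = ?h x" for x
    proof (cases "x \<in> \<X>")
      case False
      then have "frechet_derivative \<psi>0 (at x) = (\<lambda>_. 0)"
        using SX by (intro frechet_derivative_eq_0_outside[OF orbit_closed[OF K(1)] _ \<psi>0_out]) auto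
      then show ?thesis by simp
    qed simp
    then have "(LINT x : \<X> \<inter> period_cell per | lebesgue. Q (U x) \<bullet> jacobian \<psi> (at x)) = (LINT x|?M. ?h x)"
      using lebesgue_cell_version(2)[OF Xb h ae, of per] by (simp only:)
    also have "\<dots> = 0" by (rule companion_law.companion_integral[OF core])
    finally show "(LINT x : \<X> \<inter> period_cell per | lebesgue. Q (U x) \<bullet> jacobian \<psi> (at x)) = 0" .
  qed
qed

end
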